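(* Let $\varphi$ be an anisotropy in $\mathbb{R}^2$ such that the unit ball $W^\varphi=\{\varphi\le 1\}$ is symmetric with respect to the coordinate axes and does not have vertical facets. Let $p\in[1,+\infty)$ and let $I\subset\mathbb{R}$ be a bounded open interval. Then there exists $\sigma=\sigma(\varphi,p,|I|)>0$ (depending only on $\varphi$, $p$ and the length $|I|$) such that for any $g\in L^\infty(I)$ with $\|g\|_\infty<\sigma$, every minimizer of the functional $$\mathcal{G}(u)=\int_I\varphi^o(-Du,1)+\int_I|u-g|^p\,ds,\qquad u\in L^1(I),$$ is Lipschitz in $I$. Additionally, if $\varphi$ is $C^2$ out of the origin and elliptic, then minimizers are $C^{1,1}$ in $I$.
   Context: An anisotropy in $\mathbb{R}^2$ is an even, convex, positively one-homogeneous function $\varphi:\mathbb{R}^2\to[0,+\infty)$ with $c\le\varphi\le 1/c$ on the unit circle for some $c\in(0,1]$ (i.e. a norm). Its dual is $\varphi^o(\xi)=\max_{\varphi(\eta)=1}\langle\xi,\eta\rangle$. $\varphi$ is elliptic if there is $\lambda>0$ such that $\varphi-\lambda|\cdot|$ is also an anisotropy ($|\cdot|$ the Euclidean norm). "No vertical facets" means that $\partial W^\varphi$ contains no nondegenerate vertical segment. For $u\in BV(I)$, $$\int_I\varphi^o(-Du,1):=\sup\Big\{\int_I(uh_1'+h_2)\,ds:\ (h_1,h_2)\in C_c^1(I;\mathbb{R}^2),\ \|\varphi(h_1,h_2)\|_\infty\le1\Big\},$$ and $\mathcal{G}(u)=+\infty$ if $u\notin BV(I)$ or $u-g\notin L^p(I)$.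 Functions are identified when equal a.e.; regularity refers to a suitable representative. $u\in C^{1,1}(I)$ means that $u$ is continuously differentiable and $u'$ is Lipschitz in $I$. *)

theory Defs
  imports "HOL-Probability.Essential_Supremum"
begin

section \<open>Anisotropies of the plane\<close>

definition anisotropy :: "(real \<times> real \<Rightarrow> real) \<Rightarrow> bool" where
  "anisotropy \<phi> \<longleftrightarrow>
     (\<forall>x. 0 \<le> \<phi> x) \<and>
     (\<forall>x. \<phi> (- x) = \<phi> x) \<and>
     convex_on UNIV \<phi> \<and>
     (\<forall>t>0. \<forall>x. \<phi> (t *\<^sub>R x) = t * \<phi> x) \<and>
     (\<exists>c. 0 < c \<and> c \<le> 1 \<and> (\<forall>x\<in>sphere 0 1. c \<le> \<phi> x \<and> \<phi> x \<le> 1 / c))"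

definition elliptic :: "(real \<times> real \<Rightarrow> real) \<Rightarrow> bool" where
  "elliptic \<phi> \<longleftrightarrow> (\<exists>c>0. anisotropy (\<lambda>x. \<phi> x - c * norm x))"

definition aniso_ball :: "(real \<times> real \<Rightarrow> real) \<Rightarrow> (real \<times> real) set" where
  "aniso_ball \<phi> = {x. \<phi> x \<le> 1}"

definition axis_symmetric :: "(real \<times> real) set \<Rightarrow> bool" where
  "axis_symmetric W \<longleftrightarrow> (\<lambda>(x, y). (- x, y)) ` W = W \<and> (\<lambda>(x, y). (x, - y)) ` W = W"

definition no_vertical_facets :: "(real \<times> real) set \<Rightarrow> bool" where
  "no_vertical_facets W \<longleftrightarrow>
     \<not> (\<exists>x y\<^sub>1 y\<^sub>2. y\<^sub>1 < y\<^sub>2 \<and> closed_segment (x, y\<^sub>1) (x, y\<^sub>2) \<subseteq> frontier W)"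

text \<open>Only meant for open sets \<open>S\<close>: the derivatives are two-sided Frechet derivatives.\<close>

definition C2_on :: "'a::real_normed_vector set \<Rightarrow> ('a \<Rightarrow> 'b::real_normed_vector) \<Rightarrow> bool" where
  "C2_on S f \<longleftrightarrow>
     (\<exists>(f' :: 'a \<Rightarrow> ('a \<Rightarrow>\<^sub>L 'b)) (f'' :: 'a \<Rightarrow> ('a \<Rightarrow>\<^sub>L ('a \<Rightarrow>\<^sub>L 'b))).
        (\<forall>x\<in>S. (f has_derivative blinfun_apply (f' x)) (at x)) \<and>
        (\<forall>x\<in>S. (f' has_derivative blinfun_apply (f'' x)) (at x)) \<and>
        continuous_on S f'')"


section \<open>Function spaces on an open set of reals\<close>

text \<open>
  Functions on \<open>I\<close> are represented by functions on the whole line whose values outside \<open>I\<close>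
  are irrelevant. Elements of the spaces below are representatives, not equivalence classes.
\<close>

definition Lp_on :: "real \<Rightarrow> real set \<Rightarrow> (real \<Rightarrow> real) set" where
  "Lp_on p I = {f. f \<in> borel_measurable (lebesgue_on I) \<and>
                   integrable (lebesgue_on I) (\<lambda>x. \<bar>f x\<bar> powr p)}"

definition Linf_norm :: "real set \<Rightarrow> (real \<Rightarrow> real) \<Rightarrow> ereal" where
  "Linf_norm I f = esssup (lebesgue_on I) (\<lambda>x. ereal \<bar>f x\<bar>)"

definition Linf_on :: "real set \<Rightarrow> (real \<Rightarrow> real) set" where
  "Linf_on I = {f. f \<in> borel_measurable (lebesgue_on I) \<and> Linf_norm I f < \<infinity>}"

text \<open>
  A test function is extended by zero, so its support is closed in the whole line;
  being contained in \<open>I\<close> it is then zero outside \<open>I\<close>.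
\<close>

definition Cc1_on :: "real set \<Rightarrow> (real \<Rightarrow> real) set" where
  "Cc1_on I = {h. h C1_differentiable_on I \<and>
                  compact (closure {x. h x \<noteq> 0}) \<and> closure {x. h x \<noteq> 0} \<subseteq> I}"

definition total_variation :: "real set \<Rightarrow> (real \<Rightarrow> real) \<Rightarrow> ereal" where
  "total_variation I u =
     Sup {ereal (\<integral>s. u s * deriv h s \<partial>lebesgue_on I) | h. h \<in> Cc1_on I \<and> Linf_norm I h \<le> 1}"

definition BV_on :: "real set \<Rightarrow> (real \<Rightarrow> real) set" where
  "BV_on I = {u \<in> Lp_on 1 I. total_variation I u < \<infinity>}"

definition lipschitz_rep :: "real set \<Rightarrow> (real \<Rightarrow> real) \<Rightarrow> bool" where
  "lipschitz_rep I u \<longleftrightarrow>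
     (\<exists>w. (AE x in lebesgue_on I. u x = w x) \<and> (\<exists>C. C-lipschitz_on I w))"

definition C11_rep :: "real set \<Rightarrow> (real \<Rightarrow> real) \<Rightarrow> bool" where
  "C11_rep I u \<longleftrightarrow>
     (\<exists>w. (AE x in lebesgue_on I. u x = w x) \<and>
          w C1_differentiable_on I \<and> (\<exists>C. C-lipschitz_on I (deriv w)))"


section \<open>The functional\<close>

text \<open>
  \<open>aniso_area \<phi> I u\<close> is the integral over \<open>I\<close> of \<open>\<phi>\<^sup>o(-Du, 1)\<close>, where \<open>\<phi>\<^sup>o\<close> is the norm dual
  to \<open>\<phi>\<close>. For \<open>u\<close> in \<open>BV(I)\<close> it is defined by duality, with the constraint expressed through
  \<open>\<phi>\<close> itself.
\<close>

definition aniso_area :: "(real \<times> real \<Rightarrow> real) \<Rightarrow> real set \<Rightarrow> (real \<Rightarrow> real) \<Rightarrow> ereal" where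
  "aniso_area \<phi> I u =
     Sup {ereal (\<integral>s. (u s * deriv h\<^sub>1 s + h\<^sub>2 s) \<partial>lebesgue_on I) | h\<^sub>1 h\<^sub>2.
          h\<^sub>1 \<in> Cc1_on I \<and> h\<^sub>2 \<in> Cc1_on I \<and> Linf_norm I (\<lambda>s. \<phi> (h\<^sub>1 s, h\<^sub>2 s)) \<le> 1}"

definition aniso_functional ::
    "(real \<times> real \<Rightarrow> real) \<Rightarrow> real \<Rightarrow> real set \<Rightarrow> (real \<Rightarrow> real) \<Rightarrow> (real \<Rightarrow> real) \<Rightarrow> ereal" where
  "aniso_functional \<phi> p I g u =
     (if u \<in> BV_on I \<and> (\<lambda>s. u s - g s) \<in> Lp_on p I
      then aniso_area \<phi> I u + ereal (\<integral>s. \<bar>u s - g s\<bar> powr p \<partial>lebesgue_on I)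
      else \<infinity>)"

definition is_minimizer ::
    "(real \<times> real \<Rightarrow> real) \<Rightarrow> real \<Rightarrow> real set \<Rightarrow> (real \<Rightarrow> real) \<Rightarrow> (real \<Rightarrow> real) \<Rightarrow> bool" where
  "is_minimizer \<phi> p I g u \<longleftrightarrow>
     u \<in> Lp_on 1 I \<and>
     (\<forall>v\<in>Lp_on 1 I. aniso_functional \<phi> p I g u \<le> aniso_functional \<phi> p I g v)"

end

theory Submission
  imports Defs "HOL-Library.Function_Algebras"
begin

text \<open>
  The idea is convex duality. Let the unit ball be the region between the graphs of \<open>k\<close> and \<open>- k\<close> over
  \<open>[- m, m]\<close>, with \<open>k\<close> concave; that there are no vertical facets means \<open>k m = 0\<close>. Then
  \<open>\<phi>\<^sup>o (- \<xi>, 1)\<close> is the maximum of \<open>k x - \<xi> x\<close> over \<open>\<bar>x\<bar> \<le> m\<close>, and the area of \<open>u\<close> is the supremum of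
  \<open>\<integral> u h' + \<integral> k h\<close> over compactly supported \<open>h\<close> with \<open>\<bar>h\<bar> \<le> m\<close>. Formally a minimizer has a dual
  potential \<open>x\<close>, vanishing at the end points, which attains this supremum and whose derivative is minus
  a subgradient of the fidelity term \<open>\<bar>u - g\<bar> powr p\<close>. The Euler-Lagrange equation is \<open>u' = k' x\<close>. As long as
  \<open>\<bar>x\<bar>\<close> stays below some \<open>r < m\<close>, the concave function \<open>k\<close> is Lipschitz on the range of \<open>x\<close>, and \<open>u\<close>
  is Lipschitz. If \<open>\<phi>\<close> is twice continuously differentiable, then \<open>k'\<close> is locally Lipschitz by implicit
  differentiation (\<open>slope_lipschitz\<close>), and since \<open>x\<close> is Lipschitz, so is \<open>u'\<close>.

  The potential is obtained from the Hahn-Banach theorem. Minimality says that the convex increment of the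
  area at \<open>u\<close> lies above the concave negative increment of the fidelity term, and a linear functional \<open>l\<close> on
  bounded functions fits in between (\<open>minimizer_dual_functional\<close>). Being controlled by the fidelity term, \<open>l\<close> is
  bounded by \<open>M\<close> times the \<open>L\<^sup>1\<close> norm, and the values of \<open>l\<close> on indicators of initial subintervals form an
  \<open>M\<close>-Lipschitz potential. The constant \<open>M\<close> is uniform, because comparison with the zero function bounds the
  minimizer (\<open>minimizer_bounded_representative\<close>).

  Smallness of \<open>g\<close> keeps the potential away from \<open>m\<close> (\<open>small_data_certificate\<close>). Duality gives
  \<open>\<integral> (k 0 - k x) \<le> l g \<le> M \<integral> \<bar>g\<bar>\<close>. Because \<open>k m = 0 < k 0\<close> and \<open>x\<close> is \<open>M\<close>-Lipschitz, an \<open>x\<close> that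
  comes close to \<open>\<plusminus> m\<close> makes the left-hand side larger than a constant that depends only on \<open>\<phi>\<close> and \<open>M\<close>.

  Regularity then follows by testing the supremum with small variations \<open>x + t \<eta>\<close> of the potential, which
  bounds the distributional derivative of \<open>u\<close> (\<open>variation_le\<close>). Distributional statements become pointwise
  ones by means of averages over short intervals (\<open>AE_modulus_from_test_functions\<close>).
\<close>

section \<open>Separation of convex functions by linear functionals\<close>

text \<open>
  Positive homogeneity includes the factor \<open>0\<close>, so that a sublinear function vanishes at \<open>0\<close>.
\<close>
definition sublinear_on :: "'a::real_vector set \<Rightarrow> ('a \<Rightarrow> real) \<Rightarrow> bool" where
  "sublinear_on E p \<longleftrightarrow>
     (\<forall>x\<in>E. \<forall>y\<in>E. p (x + y) \<le> p x + p y) \<and> (\<forall>t\<ge>0. \<forall>x\<in>E. p (t *\<^sub>R x) = t * p x)"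

lemma sublinear_on_zero: "sublinear_on E p \<Longrightarrow> subspace E \<Longrightarrow> p 0 = 0"
  unfolding sublinear_on_def using subspace_0[of E] by (metis mult_zero_left order_refl scaleR_zero_left)

lemma sublinear_on_minus:
  assumes "sublinear_on E p" "subspace E" "x \<in> E"
  shows "- p (- x) \<le> p x"
proof -
  have "p (x + - x) \<le> p x + p (- x)"
    using assms subspace_neg[of E x] unfolding sublinear_on_def by blast
  then show ?thesis using sublinear_on_zero[OF assms(1,2)] by simp
qed

text \<open>
  In a chain the smaller of two members may be used for both summands, which gives subadditivity of the
  infimum.
\<close>
lemma sublinear_on_chain_INF:
  fixes E :: "'a::real_vector set"
  assumes E: "subspace E" and C: "C \<noteq> {}"
    and sub: "\<And>p. p \<in> C \<Longrightarrow> sublinear_on E p"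
    and total: "\<And>p q. p \<in> C \<Longrightarrow> q \<in> C \<Longrightarrow> p \<le> q \<or> q \<le> p"
    and bdd: "\<And>x. x \<in> E \<Longrightarrow> bdd_below ((\<lambda>p. p x) ` C)"
  shows "sublinear_on E (\<lambda>x. INF p\<in>C. p x)"
  unfolding sublinear_on_def
proof (intro conjI ballI allI impI)
  fix x y assume x: "x \<in> E" and y: "y \<in> E"
  have *: "(INF p\<in>C. p (x + y)) \<le> p x + q y" if p: "p \<in> C" and q: "q \<in> C" for p q
  proof -
    obtain r where r: "r \<in> C" "r \<le> p" "r \<le> q"
      using total[OF p q] p q by blast
    have "(INF p\<in>C. p (x + y)) \<le> r (x + y)"
      by (rule cINF_lower[OF bdd r(1)]) (use E x y in \<open>auto intro: subspace_add\<close>)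
    also have "\<dots> \<le> r x + r y" using sub[OF r(1)] x y by (auto simp: sublinear_on_def)
    also have "\<dots> \<le> p x + q y" using r by (auto simp: le_fun_def intro: add_mono)
    finally show ?thesis .
  qed
  have "(INF p\<in>C. p (x + y)) - p x \<le> (INF q\<in>C. q y)" if "p \<in> C" for p
    by (rule cINF_greatest[OF C]) (use *[OF that] in \<open>auto simp: algebra_simps\<close>)
  then have "(INF p\<in>C. p (x + y)) - (INF q\<in>C. q y) \<le> (INF p\<in>C. p x)"
    by (intro cINF_greatest[OF C]) (auto simp: algebra_simps)
  then show "(INF p\<in>C. p (x + y)) \<le> (INF p\<in>C. p x) + (INF p\<in>C. p y)" by simp
next
  fix t :: real and x assume t: "0 \<le> t" and x: "x \<in> E"
  have eq: "(\<lambda>p. p (t *\<^sub>R x)) ` C = (\<lambda>p. t * p x) ` C"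
    using sub x t by (intro image_cong) (auto simp: sublinear_on_def)
  have "(INF p\<in>C. t * p x) = t * (INF p\<in>C. p x)"
  proof (cases "t = 0")
    case False
    then have t0: "t > 0" using t by simp
    show ?thesis
    proof (rule antisym)
      have "(INF p\<in>C. t * p x) / t \<le> (INF p\<in>C. p x)"
      proof (rule cINF_greatest[OF C])
        fix p assume p: "p \<in> C"
        obtain B where "\<And>q. q \<in> C \<Longrightarrow> B \<le> q x" using bdd[OF x] by (auto simp: bdd_below_def)
        then have "bdd_below ((\<lambda>p. t * p x) ` C)" using t0 by (intro bdd_belowI2[of _ "t * B"]) auto
        then have "(INF p\<in>C. t * p x) \<le> t * p x" by (rule cINF_lower) (rule p)
        then show "(INF p\<in>C. t * p x) / t \<le> p x" using t0 by (simp add: field_simps)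
      qed
      then show "(INF p\<in>C. t * p x) \<le> t * (INF p\<in>C. p x)" using t0 by (simp add: field_simps)
      show "t * (INF p\<in>C. p x) \<le> (INF p\<in>C. t * p x)"
        using t0 by (intro cINF_greatest[OF C] mult_left_mono cINF_lower[OF bdd[OF x]]) auto
    qed
  qed (use C in auto)
  then show "(INF p\<in>C. p (t *\<^sub>R x)) = t * (INF p\<in>C. p x)" using eq by simp
qed

text \<open>
  Pushing a sublinear function down along the ray spanned by \<open>w\<close> keeps it sublinear. A minimal
  sublinear function is therefore unchanged by this operation, which makes it additive along \<open>w\<close>.
\<close>
lemma sublinear_on_tilt:
  fixes E :: "'a::real_vector set"
  assumes E: "subspace E" and p: "sublinear_on E p" and w: "w \<in> E"
  defines "P \<equiv> \<lambda>v. INF t\<in>{0::real..}. p (v + t *\<^sub>R w) - t * p w"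
  shows "sublinear_on E P" "\<And>v t. v \<in> E \<Longrightarrow> 0 \<le> t \<Longrightarrow> P v \<le> p (v + t *\<^sub>R w) - t * p w"
proof -
  have padd: "p (x + y) \<le> p x + p y" if "x \<in> E" "y \<in> E" for x y
    using p that by (auto simp: sublinear_on_def)
  have phom: "p (t *\<^sub>R x) = t * p x" if "x \<in> E" "0 \<le> t" for x t
    using p that by (auto simp: sublinear_on_def)
  have vw: "v + t *\<^sub>R w \<in> E" if "v \<in> E" for v t
    using E w that by (intro subspace_add subspace_scale)
  have bdd: "bdd_below ((\<lambda>t. p (v + t *\<^sub>R w) - t * p w) ` {0..})" if v: "v \<in> E" for v
  proof (rule bdd_belowI2[of _ "- p (- v)"])
    fix t :: real assume t: "t \<in> {0..}"
    have "t * p w = p ((v + t *\<^sub>R w) + - v)" using phom[OF w] t by simp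
    also have "\<dots> \<le> p (v + t *\<^sub>R w) + p (- v)" by (rule padd[OF vw[OF v] subspace_neg[OF E v]])
    finally show "- p (- v) \<le> p (v + t *\<^sub>R w) - t * p w" by simp
  qed
  show lower: "P v \<le> p (v + t *\<^sub>R w) - t * p w" if "v \<in> E" "0 \<le> t" for v t
    unfolding P_def by (rule cINF_lower[OF bdd[OF that(1)]]) (use that in auto)
  have greatest: "z \<le> P v" if "\<And>t. 0 \<le> t \<Longrightarrow> z \<le> p (v + t *\<^sub>R w) - t * p w" for z v
    unfolding P_def by (rule cINF_greatest) (use that in auto)
  show "sublinear_on E P"
    unfolding sublinear_on_def
  proof (intro conjI ballI allI impI)
    fix x y assume x: "x \<in> E" and y: "y \<in> E"
    have *: "P (x + y) \<le> (p (x + s *\<^sub>R w) - s * p w) + (p (y + t *\<^sub>R w) - t * p w)"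
      if "0 \<le> s" "0 \<le> t" for s t
    proof -
      have "P (x + y) \<le> p ((x + y) + (s + t) *\<^sub>R w) - (s + t) * p w"
        using that E x y by (intro lower subspace_add) auto
      also have "(x + y) + (s + t) *\<^sub>R w = (x + s *\<^sub>R w) + (y + t *\<^sub>R w)"
        by (simp add: algebra_simps)
      also have "p \<dots> \<le> p (x + s *\<^sub>R w) + p (y + t *\<^sub>R w)" by (rule padd[OF vw[OF x] vw[OF y]])
      finally show ?thesis by (simp add: algebra_simps)
    qed
    have "P (x + y) - (p (x + s *\<^sub>R w) - s * p w) \<le> P y" if "0 \<le> s" for s
      using *[OF that] by (intro greatest) (simp add: algebra_simps)
    then have "P (x + y) - P y \<le> P x" by (intro greatest) (simp add: algebra_simps)
    then show "P (x + y) \<le> P x + P y" by simp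
  next
    fix c :: real and x assume c: "0 \<le> c" and x: "x \<in> E"
    show "P (c *\<^sub>R x) = c * P x"
    proof (cases "c = 0")
      case True
      have "P 0 \<le> 0" using lower[of 0 0] sublinear_on_zero[OF p E] subspace_0[OF E] by simp
      moreover have "0 \<le> P 0" using phom[OF w] by (intro greatest) simp
      ultimately show ?thesis using True by simp
    next
      case False
      then have c0: "c > 0" using c by simp
      have scale: "p (c *\<^sub>R x + (c * t) *\<^sub>R w) - (c * t) * p w = c * (p (x + t *\<^sub>R w) - t * p w)" for t
        using phom[OF vw[OF x], of c t] c by (simp add: algebra_simps)
      show ?thesis
      proof (rule antisym)
        have "P (c *\<^sub>R x) / c \<le> P x"
        proof (rule greatest)
          fix t :: real assume "0 \<le> t"
          then have "P (c *\<^sub>R x) \<le> c * (p (x + t *\<^sub>R w) - t * p w)"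
            using lower[of "c *\<^sub>R x" "c * t"] subspace_scale[OF E x] c scale[of t] by simp
          then show "P (c *\<^sub>R x) / c \<le> p (x + t *\<^sub>R w) - t * p w" using c0 by (simp add: field_simps)
        qed
        then show "P (c *\<^sub>R x) \<le> c * P x" using c0 by (simp add: field_simps)
        show "c * P x \<le> P (c *\<^sub>R x)"
        proof (rule greatest)
          fix t :: real assume t: "0 \<le> t"
          have "c * P x \<le> c * (p (x + (t / c) *\<^sub>R w) - (t / c) * p w)"
            using c0 t by (intro mult_left_mono lower[OF x]) auto
          also have "\<dots> = p (c *\<^sub>R x + t *\<^sub>R w) - t * p w" using scale[of "t / c"] c0 by simp
          finally show "c * P x \<le> p (c *\<^sub>R x + t *\<^sub>R w) - t * p w" .
        qed
      qed
    qed
  qed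
qed

text \<open>
  The Hahn-Banach theorem in its sublinear form. By Zorn's lemma there is a minimal sublinear function
  below \<open>N\<close>, and minimality under tilting forces linearity. Functions are normalized to vanish outside
  \<open>E\<close>, since otherwise the pointwise order on \<open>E\<close> would not be antisymmetric.
\<close>
theorem sublinear_dominates_linear:
  fixes E :: "'a::real_vector set"
  assumes E: "subspace E" and N: "sublinear_on E N"
  obtains l where "\<And>x y. x \<in> E \<Longrightarrow> y \<in> E \<Longrightarrow> l (x + y) = l x + l y"
    and "\<And>c x. x \<in> E \<Longrightarrow> l (c *\<^sub>R x) = c * l x"
    and "\<And>x. x \<in> E \<Longrightarrow> l x \<le> (N x :: real)"
proof -
  define S where "S = {p. sublinear_on E p \<and> (\<forall>x\<in>E. p x \<le> N x) \<and> (\<forall>x. x \<notin> E \<longrightarrow> p x = 0)}"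
  have restr: "sublinear_on E (\<lambda>x. if x \<in> E then p x else 0) \<longleftrightarrow> sublinear_on E p" for p
    using subspace_add[OF E] subspace_scale[OF E] by (auto simp: sublinear_on_def)
  have "\<exists>m\<in>S. \<forall>p\<in>S. p \<le> m \<longrightarrow> p = m"
  proof (rule predicate_Zorn)
    show "partial_order_on S (relation_of (\<lambda>p q. q \<le> p) S)"
      by (rule partial_order_on_relation_ofI) auto
    fix C assume C: "C \<in> Chains (relation_of (\<lambda>p q. q \<le> p) S)"
    then have CS: "C \<subseteq> S" and tot: "\<And>p q. p \<in> C \<Longrightarrow> q \<in> C \<Longrightarrow> p \<le> q \<or> q \<le> p"
      unfolding Chains_def relation_of_def by auto
    show "\<exists>u\<in>S. \<forall>a\<in>C. u \<le> a"
    proof (cases "C = {}")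
      case True
      have "(\<lambda>x. if x \<in> E then N x else 0) \<in> S" using restr[of N] N by (simp add: S_def)
      then show ?thesis using True by blast
    next
      case False
      have bdd: "bdd_below ((\<lambda>p. p x) ` C)" if x: "x \<in> E" for x
      proof (rule bdd_belowI2[of _ "- N (- x)"])
        fix p assume "p \<in> C"
        then have "sublinear_on E p" "p (- x) \<le> N (- x)"
          using CS subspace_neg[OF E x] by (auto simp: S_def)
        then show "- N (- x) \<le> p x" using sublinear_on_minus[OF _ E x, of p] by linarith
      qed
      define u where "u = (\<lambda>x. if x \<in> E then INF p\<in>C. p x else 0)"
      have "sublinear_on E (\<lambda>x. INF p\<in>C. p x)"
        using CS by (intro sublinear_on_chain_INF E False tot bdd) (auto simp: S_def)
      then have "sublinear_on E u" unfolding u_def restr .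
      moreover have below: "u \<le> p" if "p \<in> C" for p
        using that CS by (auto simp: le_fun_def u_def S_def intro: cINF_lower bdd)
      moreover have "u x \<le> N x" if "x \<in> E" for x
      proof -
        obtain p where "p \<in> C" using False by blast
        then show ?thesis using below[of p] CS that by (force simp: le_fun_def S_def intro: order_trans)
      qed
      ultimately show ?thesis by (intro bexI[of _ u]) (auto simp: S_def u_def)
    qed
  qed
  then obtain p where pS: "p \<in> S" and min: "\<And>q. q \<in> S \<Longrightarrow> q \<le> p \<Longrightarrow> q = p" by blast
  have p: "sublinear_on E p" using pS by (simp add: S_def)
  have add: "p (v + w) = p v + p w" if v: "v \<in> E" and w: "w \<in> E" for v w
  proof -
    define P where "P v = (INF t\<in>{0::real..}. p (v + t *\<^sub>R w) - t * p w)" for v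
    note P = sublinear_on_tilt[OF E p w, folded P_def]
    define q where "q = (\<lambda>v. if v \<in> E then P v else 0)"
    have le: "q \<le> p" using P(2)[of _ 0] pS by (auto simp: le_fun_def q_def S_def)
    have "q x \<le> N x" if "x \<in> E" for x
      using le_funD[OF le, of x] pS that by (force simp: S_def)
    then have "q \<in> S" using P(1) restr[of P] by (auto simp: S_def q_def)
    from min[OF this le] have "P v = p v" using v by (auto simp: q_def fun_eq_iff split: if_splits)
    then have "p v \<le> p (v + w) - p w" using P(2)[OF v, of 1] by simp
    moreover have "p (v + w) \<le> p v + p w" using p v w by (auto simp: sublinear_on_def)
    ultimately show ?thesis by simp
  qed
  have hom: "p (c *\<^sub>R x) = c * p x" if x: "x \<in> E" for c x
  proof (cases "0 \<le> c")
    case True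
    then show ?thesis using p x by (auto simp: sublinear_on_def)
  next
    case False
    have "0 = p (c *\<^sub>R x + (- c) *\<^sub>R x)" using sublinear_on_zero[OF p E] by (simp flip: scaleR_add_left)
    also have "\<dots> = p (c *\<^sub>R x) + p ((- c) *\<^sub>R x)" by (rule add) (use E x in \<open>auto intro!: subspace_scale subspace_neg\<close>)
    also have "p ((- c) *\<^sub>R x) = - c * p x" using p x False unfolding sublinear_on_def by (metis linear neg_0_le_iff_le)
    finally show ?thesis by simp
  qed
  show ?thesis using add hom pS by (intro that[of p]) (auto simp: S_def)
qed

text \<open>
  The infimum of the quotients \<open>(A v + B (v - t w)) / t\<close> over \<open>v \<in> V\<close> and \<open>t > 0\<close> is a sublinear
  function of \<open>w\<close>: it is the directional derivative at \<open>0\<close> of the infimal convolution of \<open>A\<close> with the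
  reflection of \<open>B\<close>. A linear function below it separates \<open>A\<close> from \<open>- B\<close>. The function \<open>A\<close> lives on a
  convex subset \<open>V\<close> only, because the area of a function may be infinite.
\<close>
theorem sandwich_linear:
  fixes E :: "'a::real_vector set" and A B :: "'a \<Rightarrow> real"
  assumes E: "subspace E" and VE: "V \<subseteq> E" and V0: "0 \<in> V"
    and A: "convex_on V A" and B: "convex_on E B" and A0: "A 0 = 0" and B0: "B 0 = 0"
    and nonneg: "\<And>v. v \<in> V \<Longrightarrow> 0 \<le> A v + B v"
  obtains l where "\<And>x y. x \<in> E \<Longrightarrow> y \<in> E \<Longrightarrow> l (x + y) = l x + l y"
    and "\<And>c x. x \<in> E \<Longrightarrow> l (c *\<^sub>R x) = c * l x"
    and "\<And>v. v \<in> V \<Longrightarrow> l v \<le> A v" and "\<And>w. w \<in> E \<Longrightarrow> - B w \<le> (l w :: real)"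
proof -
  define D where "D w = (\<lambda>(v, t). (A v + B (v - t *\<^sub>R w)) / t)" for w
  define T where "T = V \<times> {0::real<..}"
  define N where "N w = (INF z\<in>T. D w z)" for w
  have Tne: "T \<noteq> {}" using V0 by (auto simp: T_def intro: gt_ex)
  have inE: "v - t *\<^sub>R w \<in> E" if "v \<in> V" "w \<in> E" for v t w
    using that VE E by (intro subspace_diff subspace_scale) auto
  have lb: "- B w \<le> D w z" if w: "w \<in> E" and z: "z \<in> T" for w z
  proof -
    obtain v t where vt: "z = (v, t)" "v \<in> V" "t > 0" using z by (auto simp: T_def)
    define c where "c = 1 / (1 + t)"
    have c: "0 < c" "c \<le> 1" "1 - c = t * c" using vt by (auto simp: c_def field_simps)
    have a: "A (c *\<^sub>R v) \<le> c * A v"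
      using convex_onD[OF A, of c 0 v] c V0 vt A0 by simp
    \<comment> \<open>The convex combination is \<open>c *\<^sub>R v\<close>, where \<open>A + B\<close> is nonnegative; this bounds the infimum from below.\<close>
    have "B ((1 - c) *\<^sub>R w + c *\<^sub>R (v - t *\<^sub>R w)) \<le> (1 - c) * B w + c * B (v - t *\<^sub>R w)"
      by (rule convex_onD[OF B]) (use c w inE[OF vt(2) w] in auto)
    moreover have "(1 - c) *\<^sub>R w + c *\<^sub>R (v - t *\<^sub>R w) = c *\<^sub>R v"
      by (simp add: c(3) scaleR_diff_right mult.commute)
    moreover have "c *\<^sub>R v \<in> V"
    proof -
      have "convex V" using A by (simp add: convex_on_def)
      then have "(1 - c) *\<^sub>R 0 + c *\<^sub>R v \<in> V" using c vt V0 by (intro convexD) auto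
      then show ?thesis by simp
    qed
    ultimately have "0 \<le> c * A v + ((t * c) * B w + c * B (v - t *\<^sub>R w))"
      using nonneg[of "c *\<^sub>R v"] a c(3) by simp
    then have "0 \<le> c * (A v + t * B w + B (v - t *\<^sub>R w))" by (simp add: algebra_simps)
    then have "0 \<le> A v + t * B w + B (v - t *\<^sub>R w)" using c by (simp add: zero_le_mult_iff)
    then show ?thesis using vt by (simp add: D_def field_simps)
  qed
  have bdd: "bdd_below (D w ` T)" if "w \<in> E" for w
    using lb[OF that] by (rule bdd_belowI2)
  have low: "N w \<le> (A v + B (v - t *\<^sub>R w)) / t" if "w \<in> E" "v \<in> V" "t > 0" for w v t
    unfolding N_def using cINF_lower[OF bdd[OF that(1)], of "(v, t)"] that by (auto simp: D_def T_def)
  have great: "z \<le> N w" if "\<And>v t. v \<in> V \<Longrightarrow> t > 0 \<Longrightarrow> z \<le> (A v + B (v - t *\<^sub>R w)) / t" for z w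
    unfolding N_def by (rule cINF_greatest[OF Tne]) (use that in \<open>auto simp: D_def T_def\<close>)
  have "sublinear_on E N"
    unfolding sublinear_on_def
  proof (intro conjI ballI allI impI)
    fix x y assume x: "x \<in> E" and y: "y \<in> E"
    have *: "N (x + y) \<le> (A v + B (v - t *\<^sub>R x)) / t + (A v' + B (v' - t' *\<^sub>R y)) / t'"
      if v: "v \<in> V" "t > 0" and v': "v' \<in> V" "t' > 0" for v t v' t'
    proof -
      \<comment> \<open>The weights are chosen so that both perturbations receive the same step \<open>s\<close>.\<close>
      define c where "c = t / (t + t')"
      define s where "s = t * t' / (t + t')"
      have c: "0 < c" "c < 1" "1 - c = t' / (t + t')" using v v' by (auto simp: c_def field_simps)
      have s: "s > 0" "(1 - c) * t = s" "c * t' = s"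
        using v v' unfolding c(3) by (auto simp: s_def c_def)
      have wV: "(1 - c) *\<^sub>R v + c *\<^sub>R v' \<in> V"
        using A c v v' by (intro convexD) (auto simp: convex_on_def)
      have ts: "(1 - c) / s = 1 / t" "c / s = 1 / t'"
        using s c v v' by (simp_all add: field_simps)
      have "N (x + y) \<le> (A ((1 - c) *\<^sub>R v + c *\<^sub>R v') + B (((1 - c) *\<^sub>R v + c *\<^sub>R v') - s *\<^sub>R (x + y))) / s"
        by (rule low[OF subspace_add[OF E x y] wV s(1)])
      also have "((1 - c) *\<^sub>R v + c *\<^sub>R v') - s *\<^sub>R (x + y)
          = (1 - c) *\<^sub>R (v - t *\<^sub>R x) + c *\<^sub>R (v' - t' *\<^sub>R y)"
        using s(2,3) by (simp add: scaleR_diff_right scaleR_add_right)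
      also have "(A ((1 - c) *\<^sub>R v + c *\<^sub>R v') + B \<dots>) / s
          \<le> (((1 - c) * A v + c * A v') + ((1 - c) * B (v - t *\<^sub>R x) + c * B (v' - t' *\<^sub>R y))) / s"
        using s(1) c v v' x y by (intro divide_right_mono add_mono convex_onD[OF A] convex_onD[OF B] inE) auto
      also have "\<dots> = (A v + B (v - t *\<^sub>R x)) * ((1 - c) / s) + (A v' + B (v' - t' *\<^sub>R y)) * (c / s)"
        by (simp add: add_divide_distrib diff_divide_distrib algebra_simps)
      finally show ?thesis by (simp add: ts)
    qed
    have "N (x + y) - (A v + B (v - t *\<^sub>R x)) / t \<le> N y" if "v \<in> V" "t > 0" for v t
      using *[OF that] by (intro great) (simp add: algebra_simps)
    then have "N (x + y) - N y \<le> N x" by (intro great) (simp add: algebra_simps)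
    then show "N (x + y) \<le> N x + N y" by simp
  next
    fix c :: real and x assume c: "0 \<le> c" and x: "x \<in> E"
    show "N (c *\<^sub>R x) = c * N x"
    proof (cases "c = 0")
      case True
      have "N 0 \<le> 0" using low[OF subspace_0[OF E] V0, of 1] A0 B0 by simp
      moreover have "0 \<le> N 0" using nonneg by (intro great) simp
      ultimately show ?thesis using True by simp
    next
      case False
      then have c0: "c > 0" using c by simp
      show ?thesis
      proof (rule antisym)
        have "N (c *\<^sub>R x) / c \<le> N x"
        proof (rule great)
          fix v t assume vt: "v \<in> V" "(0::real) < t"
          have "N (c *\<^sub>R x) \<le> (A v + B (v - (t / c) *\<^sub>R c *\<^sub>R x)) / (t / c)"
            using c0 vt by (intro low subspace_scale[OF E x]) auto
          then show "N (c *\<^sub>R x) / c \<le> (A v + B (v - t *\<^sub>R x)) / t" using c0 vt by (simp add: field_simps)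
        qed
        then show "N (c *\<^sub>R x) \<le> c * N x" using c0 by (simp add: field_simps)
        show "c * N x \<le> N (c *\<^sub>R x)"
        proof (rule great)
          fix v t assume vt: "v \<in> V" "(0::real) < t"
          have "N x \<le> (A v + B (v - (t * c) *\<^sub>R x)) / (t * c)"
            using c0 vt by (intro low[OF x]) auto
          then show "c * N x \<le> (A v + B (v - t *\<^sub>R c *\<^sub>R x)) / t" using c0 vt by (simp add: field_simps)
        qed
      qed
    qed
  qed
  from sublinear_dominates_linear[OF E this] obtain l
    where l: "\<And>x y. x \<in> E \<Longrightarrow> y \<in> E \<Longrightarrow> l (x + y) = l x + l y"
      "\<And>c x. x \<in> E \<Longrightarrow> l (c *\<^sub>R x) = c * l x" "\<And>x. x \<in> E \<Longrightarrow> l x \<le> N x" by metis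
  show ?thesis
  proof (rule that[of l, OF l(1,2)])
    show "l v \<le> A v" if "v \<in> V" for v
    proof -
      have "v \<in> E" using that VE by blast
      then show ?thesis using l(3)[of v] low[OF _ that, of v 1] B0 by simp
    qed
    show "- B w \<le> l w" if "w \<in> E" for w
    proof -
      have "l ((-1) *\<^sub>R w) \<le> N ((-1) *\<^sub>R w)" using that E by (intro l(3) subspace_scale)
      also have "\<dots> \<le> B w"
        using low[of "- w" 0 1] that E V0 A0 by (simp add: subspace_neg)
      finally show ?thesis using l(2)[OF that, of "-1"] by simp
    qed
  qed
qed

text \<open>
  Real functions under pointwise operations form the real vector space to which separation is applied.
\<close>
instantiation "fun" :: (type, real_vector) real_vector
begin
definition "scaleR_fun c (f :: 'a \<Rightarrow> 'b) = (\<lambda>x. c *\<^sub>R f x)"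
instance
  by standard (simp_all add: scaleR_fun_def fun_eq_iff algebra_simps)
end

section \<open>Averages over short intervals\<close>

text \<open>
  The primitive of \<open>u\<close> with value \<open>0\<close> at \<open>- \<infinity>\<close>.
\<close>
definition prim :: "(real \<Rightarrow> real) \<Rightarrow> real \<Rightarrow> real" where
  "prim u s = (LBINT t. indicator {..s} t * u t)"

text \<open>
  The mean of \<open>u\<close> over the interval from \<open>s\<close> to \<open>s + \<delta>\<close>, written as a difference quotient because
  this form shows at once that it is continuously differentiable in \<open>s\<close> when \<open>u\<close> is continuous.
\<close>
definition avg :: "real \<Rightarrow> (real \<Rightarrow> real) \<Rightarrow> real \<Rightarrow> real" where
  "avg \<delta> u s = (prim u (s + \<delta>) - prim u s) / \<delta>"

lemma integrable_indicator_interval [simp]: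
  fixes c d :: real
  shows "integrable lborel (\<lambda>s. indicator {c..d} s :: real)" "integrable lborel (\<lambda>s. indicator {c<..d} s :: real)"
  by (cases "c \<le> d"; simp add: integrable_real_indicator)+

lemma integrable_indicator_mult:
  fixes u :: "real \<Rightarrow> real"
  assumes "integrable lborel u" "A \<in> sets borel"
  shows "integrable lborel (\<lambda>t. indicator A t * u t)"
  using integrable_mult_indicator[OF _ assms(1), of A] assms(2) by simp

lemma integrable_bounded_interval:
  fixes f :: "real \<Rightarrow> real"
  assumes [measurable]: "f \<in> borel_measurable borel" and "\<And>s. \<bar>f s\<bar> \<le> B" and "\<And>s. s \<notin> {c..d} \<Longrightarrow> f s = 0"
  shows "integrable lborel f"
proof (rule Bochner_Integration.integrable_bound)
  show "integrable lborel (\<lambda>s. B * indicator {c..d} s)" by simp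
  show "AE s in lborel. norm (f s) \<le> norm (B * indicator {c..d} s)"
  proof (rule AE_I2)
    fix s show "norm (f s) \<le> norm (B * indicator {c..d} s)"
      using assms(2)[of s] assms(3)[of s] by (auto simp: indicator_def)
  qed
qed simp

lemma prim_diff:
  assumes u: "integrable lborel u" and "s \<le> t"
  shows "prim u t - prim u s = (LBINT r. indicator {s<..t} r * u r)"
proof -
  have "prim u t - prim u s = (LBINT r. indicator {..t} r * u r - indicator {..s} r * u r)"
    unfolding prim_def by (intro Bochner_Integration.integral_diff[symmetric] integrable_indicator_mult u) auto
  also have "\<dots> = (LBINT r. indicator {s<..t} r * u r)"
    using assms(2) by (intro Bochner_Integration.integral_cong) (auto simp: indicator_def)
  finally show ?thesis .
qed

lemma integral_indicator_bound:
  fixes u :: "real \<Rightarrow> real"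
  assumes u: "integrable lborel u" and st: "s \<le> t" and B: "\<And>r. s < r \<Longrightarrow> r \<le> t \<Longrightarrow> \<bar>u r\<bar> \<le> B"
  shows "\<bar>LBINT r. indicator {s<..t} r * u r\<bar> \<le> B * (t - s)"
proof -
  have "\<bar>LBINT r. indicator {s<..t} r * u r\<bar> \<le> (LBINT r. \<bar>indicator {s<..t} r * u r\<bar>)"
    by (rule integral_abs_bound)
  also have "\<dots> \<le> (LBINT r. B * indicator {s<..t} r)"
    using B by (intro integral_mono integrable_abs integrable_indicator_mult u)
      (auto simp: abs_mult split: split_indicator)
  also have "\<dots> = B * (t - s)" using st by simp
  finally show ?thesis .
qed

lemma prim_lipschitz:
  assumes u: "integrable lborel u" and B: "\<And>r. \<bar>u r\<bar> \<le> B"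
  shows "\<bar>prim u t - prim u s\<bar> \<le> B * \<bar>t - s\<bar>"
proof (induction s t rule: linorder_wlog)
  case (le s t)
  show ?case using integral_indicator_bound[OF u le B] le by (simp add: prim_diff[OF u le])
next
  case (sym s t)
  then show ?case by (simp add: abs_minus_commute)
qed

lemma prim_has_derivative:
  assumes u: "integrable lborel u" and cont: "isCont u s"
  shows "(prim u has_real_derivative u s) (at s)"
  unfolding has_field_derivative_def has_derivative_at_alt
proof (intro conjI allI impI)
  show "bounded_linear ((*) (u s))" by (rule bounded_linear_mult_right)
  fix e :: real assume "0 < e"
  then obtain d where d: "d > 0" "\<And>r. \<bar>r - s\<bar> < d \<Longrightarrow> \<bar>u r - u s\<bar> < e"
    using cont unfolding continuous_at_eps_delta real_norm_def dist_real_def by metis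
  have *: "\<bar>prim u y - prim u x - u s * (y - x)\<bar> \<le> e * (y - x)"
    if "x \<le> y" "\<bar>x - s\<bar> < d" "\<bar>y - s\<bar> < d" for x y
  proof -
    have i: "integrable lborel (\<lambda>r. indicator {x<..y} r * (u r - u s))"
      unfolding right_diff_distrib by (intro Bochner_Integration.integrable_diff integrable_indicator_mult u integrable_mult_left) auto
    have "prim u y - prim u x - u s * (y - x)
        = (LBINT r. indicator {x<..y} r * u r) - (LBINT r. indicator {x<..y} r * u s)"
      using prim_diff[OF u that(1)] that(1) by simp
    also have "\<dots> = (LBINT r. indicator {x<..y} r * (u r - u s))"
      by (subst Bochner_Integration.integral_diff[symmetric])
        (auto simp: right_diff_distrib intro: integrable_indicator_mult u)
    finally have "\<bar>prim u y - prim u x - u s * (y - x)\<bar> \<le> (LBINT r. \<bar>indicator {x<..y} r * (u r - u s)\<bar>)"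
      using integral_abs_bound by metis
    also have "\<dots> \<le> (LBINT r. e * indicator {x<..y} r)"
    proof (intro integral_mono integrable_abs i)
      fix r show "\<bar>indicator {x<..y} r * (u r - u s)\<bar> \<le> e * indicator {x<..y} r"
      proof (cases "r \<in> {x<..y}")
        case True
        then have "\<bar>r - s\<bar> < d" using that by auto
        then show ?thesis using d(2)[of r] True by simp
      qed simp
    qed auto
    also have "\<dots> = e * (y - x)" using that by simp
    finally show ?thesis .
  qed
  show "\<exists>d>0. \<forall>y. norm (y - s) < d \<longrightarrow> norm (prim u y - prim u s - u s * (y - s)) \<le> e * norm (y - s)"
  proof (intro exI[of _ d] conjI d(1) allI impI)
    fix y assume y: "norm (y - s) < d"
    show "norm (prim u y - prim u s - u s * (y - s)) \<le> e * norm (y - s)"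
    proof (cases "s \<le> y")
      case True
      then show ?thesis using *[of s y] y d(1) by simp
    next
      case False
      then have "\<bar>prim u s - prim u y - u s * (s - y)\<bar> \<le> e * (s - y)" using *[of y s] y d(1) by simp
      moreover have "prim u y - prim u s - u s * (y - s) = - (prim u s - prim u y - u s * (s - y))"
        by (simp add: algebra_simps)
      ultimately show ?thesis using False by simp
    qed
  qed
qed

lemma prim_measurable [measurable]:
  assumes [measurable]: "u \<in> borel_measurable borel"
  shows "prim u \<in> borel_measurable borel"
proof -
  have "(\<lambda>s. LBINT t. (if t \<le> s then u t else 0)) \<in> borel_measurable borel"
    by (rule lborel.borel_measurable_lebesgue_integral) measurable
  moreover have "prim u = (\<lambda>s. LBINT t. (if t \<le> s then u t else 0))"
    unfolding prim_def by (intro ext Bochner_Integration.integral_cong) (auto simp: indicator_def)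
  ultimately show ?thesis by simp
qed

lemma avg_measurable [measurable]:
  assumes [measurable]: "u \<in> borel_measurable borel"
  shows "avg \<delta> u \<in> borel_measurable borel"
  unfolding avg_def by measurable

lemma avg_eq:
  assumes "integrable lborel u" "0 < \<delta>"
  shows "avg \<delta> u s = (LBINT r. indicator {s<..s + \<delta>} r * u r) / \<delta>"
  unfolding avg_def using prim_diff[OF assms(1), of s "s + \<delta>"] assms(2) by simp

lemma avg_bound:
  assumes "integrable lborel u" "0 < \<delta>" "\<And>r. s < r \<Longrightarrow> r \<le> s + \<delta> \<Longrightarrow> \<bar>u r\<bar> \<le> B"
  shows "\<bar>avg \<delta> u s\<bar> \<le> B"
  using integral_indicator_bound[OF assms(1), of s "s + \<delta>" B] assms(2,3)
  by (simp add: avg_eq[OF assms(1,2)] field_simps)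

lemma prim_add:
  assumes "integrable lborel u" "integrable lborel v"
  shows "prim (\<lambda>s. u s + c * v s) r = prim u r + c * prim v r"
proof -
  have "prim (\<lambda>s. u s + c * v s) r = (LBINT t. indicator {..r} t * u t + c * (indicator {..r} t * v t))"
    unfolding prim_def by (simp add: algebra_simps)
  then show ?thesis
    unfolding prim_def using assms
    by (simp add: integrable_indicator_mult)
qed

lemma avg_add:
  assumes "integrable lborel u" "integrable lborel v"
  shows "avg \<delta> (\<lambda>s. u s + c * v s) r = avg \<delta> u r + c * avg \<delta> v r"
  unfolding avg_def prim_add[OF assms] by (simp add: add_divide_distrib diff_divide_distrib algebra_simps)

lemma avg_nonneg:
  assumes u: "integrable lborel u" and d: "0 < \<delta>" and "\<And>r. 0 \<le> u r"
  shows "0 \<le> avg \<delta> u s"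
  unfolding avg_eq[OF u d] using d assms(3) by (intro divide_nonneg_pos Bochner_Integration.integral_nonneg) auto

lemma avg_near:
  assumes u: "integrable lborel u" and d: "0 < \<delta>"
    and near: "\<And>r. s < r \<Longrightarrow> r \<le> s + \<delta> \<Longrightarrow> \<bar>u r - c\<bar> \<le> e"
  shows "\<bar>avg \<delta> u s - c\<bar> \<le> e"
proof -
  have i: "integrable lborel (\<lambda>r. indicator {s<..s+\<delta>} r * (u r - c))"
    unfolding right_diff_distrib by (intro Bochner_Integration.integrable_diff integrable_indicator_mult u integrable_mult_left) auto
  have "(LBINT r. indicator {s<..s + \<delta>} r * (u r - c))
      = (LBINT r. indicator {s<..s + \<delta>} r * u r - indicator {s<..s + \<delta>} r * c)"
    by (simp add: right_diff_distrib)
  also have "\<dots> = (LBINT r. indicator {s<..s + \<delta>} r * u r) - \<delta> * c"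
    by (subst Bochner_Integration.integral_diff) (use d in \<open>auto intro: integrable_indicator_mult u\<close>)
  finally have "avg \<delta> u s - c = (LBINT r. indicator {s<..s + \<delta>} r * (u r - c)) / \<delta>"
    using d by (simp add: avg_eq[OF u d] field_simps)
  moreover have "\<bar>LBINT r. indicator {s<..s + \<delta>} r * (u r - c)\<bar> \<le> (LBINT r. e * indicator {s<..s + \<delta>} r)"
    using near by (intro order_trans[OF integral_abs_bound] integral_mono integrable_abs i)
      (auto split: split_indicator)
  ultimately show ?thesis using d by (simp add: abs_divide pos_divide_le_eq mult.commute)
qed

text \<open>
  Every value \<open>u r\<close> enters the averages at points \<open>s\<close> of an interval of length \<open>\<delta>\<close>, with weight
  \<open>1 / \<delta>\<close>; exchanging the two integrations gives the bound.
\<close>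
lemma avg_L1_contraction:
  assumes u: "integrable lborel u" and d: "0 < \<delta>"
  shows "integrable lborel (avg \<delta> u)" "(LBINT s. \<bar>avg \<delta> u s\<bar>) \<le> (LBINT s. \<bar>u s\<bar>)"
proof -
  have [measurable]: "u \<in> borel_measurable borel" using u by auto
  have "(\<integral>\<^sup>+s. ennreal (norm (avg \<delta> u s)) \<partial>lborel)
      \<le> (\<integral>\<^sup>+s. (\<integral>\<^sup>+r. ennreal (1 / \<delta>) * (if s < r \<and> r \<le> s + \<delta> then ennreal \<bar>u r\<bar> else 0) \<partial>lborel) \<partial>lborel)"
  proof (rule nn_integral_mono)
    fix s :: real
    have i: "integrable lborel (\<lambda>r. (1 / \<delta>) * (indicator {s<..s + \<delta>} r * u r))"
      by (intro integrable_mult_right integrable_indicator_mult u) auto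
    have "norm (avg \<delta> u s) \<le> (LBINT r. norm ((1 / \<delta>) * (indicator {s<..s + \<delta>} r * u r)))"
      using integral_norm_bound[of lborel "\<lambda>r. (1 / \<delta>) * (indicator {s<..s + \<delta>} r * u r)"]
      by (simp add: avg_eq[OF u d])
    then have "ennreal (norm (avg \<delta> u s)) \<le> ennreal (LBINT r. norm ((1 / \<delta>) * (indicator {s<..s + \<delta>} r * u r)))"
      by (rule ennreal_leI)
    also have "\<dots> = (\<integral>\<^sup>+r. norm ((1 / \<delta>) * (indicator {s<..s + \<delta>} r * u r)) \<partial>lborel)"
      by (rule nn_integral_eq_integral[symmetric]) (use integrable_norm[OF i] in auto)
    also have "\<dots> = (\<integral>\<^sup>+r. ennreal (1 / \<delta>) * (if s < r \<and> r \<le> s + \<delta> then ennreal \<bar>u r\<bar> else 0) \<partial>lborel)"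
      using d by (intro nn_integral_cong) (auto simp: indicator_def abs_mult ennreal_mult[symmetric])
    finally show "ennreal (norm (avg \<delta> u s)) \<le> \<dots>" .
  qed
  also have "\<dots> = (\<integral>\<^sup>+r. (\<integral>\<^sup>+s. ennreal (1 / \<delta>) * (if s < r \<and> r \<le> s + \<delta> then ennreal \<bar>u r\<bar> else 0) \<partial>lborel) \<partial>lborel)"
    by (rule lborel_pair.Fubini') measurable
  also have "\<dots> = (\<integral>\<^sup>+r. ennreal \<bar>u r\<bar> \<partial>lborel)"
  proof (rule nn_integral_cong)
    fix r :: real
    have "(\<integral>\<^sup>+s. ennreal (1 / \<delta>) * (if s < r \<and> r \<le> s + \<delta> then ennreal \<bar>u r\<bar> else 0) \<partial>lborel)
        = (\<integral>\<^sup>+s. (ennreal (1 / \<delta>) * ennreal \<bar>u r\<bar>) * indicator {r - \<delta>..<r} s \<partial>lborel)"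
      by (intro nn_integral_cong) (auto simp: indicator_def)
    also have "\<dots> = (ennreal (1 / \<delta>) * ennreal \<bar>u r\<bar>) * ennreal \<delta>"
      using d by (subst nn_integral_cmult_indicator) auto
    also have "\<dots> = ennreal \<bar>u r\<bar>" using d by (simp flip: ennreal_mult)
    finally show "(\<integral>\<^sup>+s. ennreal (1 / \<delta>) * (if s < r \<and> r \<le> s + \<delta> then ennreal \<bar>u r\<bar> else 0) \<partial>lborel) = ennreal \<bar>u r\<bar>" .
  qed
  finally have le: "(\<integral>\<^sup>+s. ennreal (norm (avg \<delta> u s)) \<partial>lborel) \<le> (\<integral>\<^sup>+r. ennreal \<bar>u r\<bar> \<partial>lborel)" .
  have fin: "(\<integral>\<^sup>+r. ennreal \<bar>u r\<bar> \<partial>lborel) = ennreal (LBINT r. \<bar>u r\<bar>)"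
    by (rule nn_integral_eq_integral) (use u in auto)
  show int: "integrable lborel (avg \<delta> u)"
    using le fin by (intro integrableI_bounded) (auto intro: le_less_trans)
  have "(\<integral>\<^sup>+s. ennreal (norm (avg \<delta> u s)) \<partial>lborel) = ennreal (LBINT s. norm (avg \<delta> u s))"
    by (rule nn_integral_eq_integral) (use int in auto)
  then have "ennreal (LBINT s. norm (avg \<delta> u s)) \<le> ennreal (LBINT r. \<bar>u r\<bar>)"
    using le fin by simp
  then show "(LBINT s. \<bar>avg \<delta> u s\<bar>) \<le> (LBINT s. \<bar>u s\<bar>)"
    by (subst (asm) ennreal_le_iff) (auto intro: Bochner_Integration.integral_nonneg)
qed

text \<open>
  First truncate \<open>u\<close> in height and in support; the truncation is an almost everywhere limit of continuous
  functions, which may be truncated in the same way, and dominated convergence applies.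
\<close>
lemma continuous_dense_L1:
  fixes u :: "real \<Rightarrow> real"
  assumes u: "integrable lborel u" and e: "0 < e"
  obtains v N B where "continuous_on UNIV v" "\<And>s. s \<notin> {- N..N} \<Longrightarrow> v s = 0" "\<And>s. \<bar>v s\<bar> \<le> B"
    "(LBINT s. \<bar>u s - v s\<bar>) < e"
proof -
  have [measurable]: "u \<in> borel_measurable borel" using u by auto
  define T where "T n s = (if \<bar>s\<bar> < real n then max (- real n) (min (real n) (u s)) else 0)" for n s
  have [measurable]: "T n \<in> borel_measurable borel" for n unfolding T_def by measurable
  have Tle: "\<bar>T n s\<bar> \<le> \<bar>u s\<bar>" "\<bar>T n s\<bar> \<le> real n" for n s by (auto simp: T_def)
  have "(\<lambda>n. LBINT s. \<bar>u s - T n s\<bar>) \<longlonglongrightarrow> (\<integral>s. 0 \<partial>(lborel :: real measure))"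
  proof (rule integral_dominated_convergence[where w="\<lambda>s. 2 * \<bar>u s\<bar>"])
    show "AE s in lborel. (\<lambda>n. \<bar>u s - T n s\<bar>) \<longlonglongrightarrow> 0"
    proof (rule AE_I2)
      fix s
      obtain n0 :: nat where "\<bar>s\<bar> + \<bar>u s\<bar> < real n0" using reals_Archimedean2 by blast
      then have "\<forall>n\<ge>n0. \<bar>u s - T n s\<bar> = 0" by (auto simp: T_def max_def min_def)
      then have "eventually (\<lambda>n. \<bar>u s - T n s\<bar> = 0) sequentially"
        unfolding eventually_sequentially by blast
      then show "(\<lambda>n. \<bar>u s - T n s\<bar>) \<longlonglongrightarrow> 0" by (rule tendsto_eventually)
    qed
    show "AE s in lborel. norm \<bar>u s - T n s\<bar> \<le> 2 * \<bar>u s\<bar>" for n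
    proof (rule AE_I2)
      fix s show "norm \<bar>u s - T n s\<bar> \<le> 2 * \<bar>u s\<bar>" using Tle(1)[of n s] by simp
    qed
    show "integrable lborel (\<lambda>s. 2 * \<bar>u s\<bar>)" using u by auto
  qed auto
  then have "eventually (\<lambda>n. (LBINT s. \<bar>u s - T n s\<bar>) < e / 2) sequentially"
    using e by (intro order_tendstoD(2)[where y=0]) auto
  then obtain n where n: "(LBINT s. \<bar>u s - T n s\<bar>) < e / 2"
    unfolding eventually_sequentially by blast
  have "T n \<in> borel_measurable lebesgue"
    using measurable_completion[of "T n" lborel borel] by simp
  then have "T n measurable_on UNIV" by (rule lebesgue_measurable_imp_measurable_on_real) auto
  then obtain Z g where Z: "negligible Z" and g: "\<And>k. continuous_on UNIV (g k)"
    and lim: "\<And>s. s \<notin> Z \<Longrightarrow> (\<lambda>k. g k s) \<longlonglongrightarrow> T n s"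
    unfolding measurable_on_def by auto
  define v where "v k s = max (- real n) (min (real n) (g k s)) * max 0 (min 1 (real k * (real n - \<bar>s\<bar>)))" for k s
  have vcont: "continuous_on UNIV (v k)" for k
    unfolding v_def by (intro continuous_intros continuous_on_max continuous_on_min g)
  have [measurable]: "v k \<in> borel_measurable borel" for k
    using vcont by (rule borel_measurable_continuous_onI)
  have vB: "\<bar>v k s\<bar> \<le> real n" for k s
  proof -
    have "\<bar>v k s\<bar> \<le> real n * 1" unfolding v_def abs_mult by (intro mult_mono) auto
    then show ?thesis by simp
  qed
  have v0: "v k s = 0" if "s \<notin> {- real n..real n}" for k s
  proof -
    have "real k * (real n - \<bar>s\<bar>) \<le> 0" using that by (intro mult_nonneg_nonpos) auto
    then show ?thesis unfolding v_def by simp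
  qed
  have T_lim: "(\<lambda>k. v k s) \<longlonglongrightarrow> T n s" if s: "s \<notin> Z" for s
  proof (cases "\<bar>s\<bar> < real n")
    case True
    obtain k0 :: nat where k0: "1 / (real n - \<bar>s\<bar>) < real k0" using reals_Archimedean2 by blast
    have "max 0 (min 1 (real k * (real n - \<bar>s\<bar>))) = 1" if "k \<ge> k0" for k
    proof -
      have "1 / (real n - \<bar>s\<bar>) < real k" using k0 that by linarith
      then have "1 < real k * (real n - \<bar>s\<bar>)" using True by (simp add: field_simps)
      then show ?thesis by simp
    qed
    then have ev: "eventually (\<lambda>k. max (- real n) (min (real n) (g k s)) = v k s) sequentially"
      unfolding eventually_sequentially v_def by (metis mult.right_neutral)
    have "(\<lambda>k. max (- real n) (min (real n) (g k s))) \<longlonglongrightarrow> max (- real n) (min (real n) (T n s))"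
      by (intro tendsto_intros lim s)
    moreover have "max (- real n) (min (real n) (T n s)) = T n s" using Tle(2)[of n s] by auto
    ultimately show ?thesis using Lim_transform_eventually[OF _ ev] by simp
  next
    case False
    have "v k s = 0" for k
    proof -
      have "real k * (real n - \<bar>s\<bar>) \<le> 0" using False by (intro mult_nonneg_nonpos) auto
      then show ?thesis unfolding v_def by simp
    qed
    then show ?thesis using False by (simp add: T_def)
  qed
  have Z0: "AE s in lborel. s \<notin> Z"
    using Z unfolding negligible_iff_null_sets
    by (metis AE_not_in AE_completion_iff)
  have intv: "integrable lborel (v k)" for k
    by (rule integrable_bounded_interval[of _ "real n" "- real n" "real n"]) (use vB v0 in auto)
  have intT: "integrable lborel (T n)"
    by (rule integrable_bounded_interval[of _ "real n" "- real n" "real n"]) (use Tle(2) in \<open>auto simp: T_def\<close>)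
  have "(\<lambda>k. LBINT s. \<bar>T n s - v k s\<bar>) \<longlonglongrightarrow> (\<integral>s. 0 \<partial>(lborel :: real measure))"
  proof (rule integral_dominated_convergence[where w="\<lambda>s. 2 * real n * indicator {- real n..real n} s"])
    show "AE s in lborel. (\<lambda>k. \<bar>T n s - v k s\<bar>) \<longlonglongrightarrow> 0"
      using Z0
    proof eventually_elim
      case (elim s)
      have "(\<lambda>k. \<bar>T n s - v k s\<bar>) \<longlonglongrightarrow> \<bar>T n s - T n s\<bar>" by (intro tendsto_intros T_lim elim)
      then show ?case by simp
    qed
    show "AE s in lborel. norm \<bar>T n s - v k s\<bar> \<le> 2 * real n * indicator {- real n..real n} s" for k
    proof (rule AE_I2)
      fix s
      show "norm \<bar>T n s - v k s\<bar> \<le> 2 * real n * indicator {- real n..real n} s"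
        using Tle(2)[of n s] vB[of k s] v0[of s k] by (cases "s \<in> {- real n..real n}") (auto simp: T_def)
    qed
  qed auto
  then have "eventually (\<lambda>k. (LBINT s. \<bar>T n s - v k s\<bar>) < e / 2) sequentially"
    using e by (intro order_tendstoD(2)[where y=0]) auto
  then obtain k where k: "(LBINT s. \<bar>T n s - v k s\<bar>) < e / 2"
    unfolding eventually_sequentially by blast
  have "(LBINT s. \<bar>u s - v k s\<bar>) \<le> (LBINT s. \<bar>u s - T n s\<bar> + \<bar>T n s - v k s\<bar>)"
    using u intT intv[of k] by (intro integral_mono) auto
  also have "\<dots> = (LBINT s. \<bar>u s - T n s\<bar>) + (LBINT s. \<bar>T n s - v k s\<bar>)"
    using u intT intv[of k] by (intro Bochner_Integration.integral_add) auto
  finally show ?thesis using that[OF vcont, of "real n" k "real n"] v0 vB n k by force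
qed

text \<open>
  For continuous \<open>u\<close> of compact support this is dominated convergence. As averaging does not increase the
  \<open>L\<^sup>1\<close> norm, the density of such functions gives the general case.
\<close>
lemma avg_tendsto_L1:
  assumes u: "integrable lborel u" and d: "\<And>n. 0 < d n" and d0: "d \<longlonglongrightarrow> 0"
  shows "(\<lambda>n. LBINT s. \<bar>avg (d n) u s - u s\<bar>) \<longlonglongrightarrow> 0"
proof (rule LIMSEQ_I)
  fix e :: real assume "0 < e"
  then have e3: "0 < e / 3" by simp
  obtain v N B where v: "continuous_on UNIV v" "\<And>s. s \<notin> {- N..N} \<Longrightarrow> v s = 0" "\<And>s. \<bar>v s\<bar> \<le> B"
    and uv: "(LBINT s. \<bar>u s - v s\<bar>) < e / 3"
    by (rule continuous_dense_L1[OF u e3]) (rule that)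
  have vm[measurable]: "v \<in> borel_measurable borel" by (rule borel_measurable_continuous_onI[OF v(1)])
  have um[measurable]: "u \<in> borel_measurable borel" using u by auto
  have vint: "integrable lborel v" by (rule integrable_bounded_interval[OF vm v(3,2)])
  have "\<forall>\<^sub>F n in sequentially. d n < 1" using d0 by (rule order_tendstoD) simp
  then obtain n1 where n1: "\<And>n. n \<ge> n1 \<Longrightarrow> d n < 1" unfolding eventually_sequentially by blast
  have "(\<lambda>n. LBINT s. \<bar>avg (d (n + n1)) v s - v s\<bar>) \<longlonglongrightarrow> (\<integral>s. 0 \<partial>(lborel :: real measure))"
  proof (rule integral_dominated_convergence[where w="\<lambda>s. 2 * B * indicator {- N - 1..N} s"])
    show "AE s in lborel. (\<lambda>n. \<bar>avg (d (n + n1)) v s - v s\<bar>) \<longlonglongrightarrow> 0"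
    proof (rule AE_I2)
      fix s
      have "(prim v has_real_derivative v s) (at s)"
        using v(1) by (intro prim_has_derivative vint) (simp add: continuous_on_eq_continuous_at)
      then have "((\<lambda>h. (prim v (s + h) - prim v s) / h) \<longlongrightarrow> v s) (at 0)" by (simp add: DERIV_def)
      moreover have "filterlim (\<lambda>n. d (n + n1)) (at 0) sequentially"
        unfolding filterlim_at
        using LIMSEQ_ignore_initial_segment[OF d0, of n1] less_imp_neq[OF d] by (intro conjI always_eventually allI) (auto dest: sym)
      ultimately have "(\<lambda>n. avg (d (n + n1)) v s) \<longlonglongrightarrow> v s"
        unfolding avg_def by (rule filterlim_compose)
      then have "(\<lambda>n. \<bar>avg (d (n + n1)) v s - v s\<bar>) \<longlonglongrightarrow> \<bar>v s - v s\<bar>" by (intro tendsto_intros)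
      then show "(\<lambda>n. \<bar>avg (d (n + n1)) v s - v s\<bar>) \<longlonglongrightarrow> 0" by simp
    qed
    show "AE s in lborel. norm \<bar>avg (d (n + n1)) v s - v s\<bar> \<le> 2 * B * indicator {- N - 1..N} s" for n
    proof (rule AE_I2)
      fix s
      have dn: "d (n + n1) < 1" "0 < d (n + n1)" using n1 d by auto
      show "norm \<bar>avg (d (n + n1)) v s - v s\<bar> \<le> 2 * B * indicator {- N - 1..N} s"
      proof (cases "s \<in> {- N - 1..N}")
        case True
        have "\<bar>avg (d (n + n1)) v s\<bar> \<le> B" by (rule avg_bound[OF vint dn(2)]) (rule v(3))
        then show ?thesis using v(3)[of s] True by simp
      next
        case False
        have "\<bar>avg (d (n + n1)) v s\<bar> \<le> 0"
        proof (rule avg_bound[OF vint dn(2)])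
          fix r assume "s < r" "r \<le> s + d (n + n1)"
          then have "r \<notin> {- N..N}" using False dn by auto
          then show "\<bar>v r\<bar> \<le> 0" using v(2) by simp
        qed
        then show ?thesis using False v(2)[of s] by auto
      qed
    qed
  qed auto
  then have "(\<lambda>n. LBINT s. \<bar>avg (d (n + n1)) v s - v s\<bar>) \<longlonglongrightarrow> 0" by simp
  then have "(\<lambda>n. LBINT s. \<bar>avg (d n) v s - v s\<bar>) \<longlonglongrightarrow> 0"
    by (rule LIMSEQ_offset)
  then have "eventually (\<lambda>n. (LBINT s. \<bar>avg (d n) v s - v s\<bar>) < e / 3) sequentially"
    using e3 by (rule order_tendstoD(2))
  then obtain n0 where n0: "\<And>n. n \<ge> n0 \<Longrightarrow> (LBINT s. \<bar>avg (d n) v s - v s\<bar>) < e / 3"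
    unfolding eventually_sequentially by blast
  show "\<exists>n0. \<forall>n\<ge>n0. norm ((LBINT s. \<bar>avg (d n) u s - u s\<bar>) - 0) < e"
  proof (intro exI[of _ n0] allI impI)
    fix n assume "n \<ge> n0"
    then have n: "(LBINT s. \<bar>avg (d n) v s - v s\<bar>) < e / 3" by (rule n0)
    have w: "integrable lborel (\<lambda>s. u s + (-1) * v s)" using u vint by auto
    have "avg (d n) (\<lambda>s. u s + (-1) * v s) = (\<lambda>s. avg (d n) u s + (-1) * avg (d n) v s)"
      using avg_add[OF u vint] by blast
    then have c: "(LBINT s. \<bar>avg (d n) u s - avg (d n) v s\<bar>) < e / 3"
      using avg_L1_contraction(2)[OF w d, of n] uv by simp
    note ints = avg_L1_contraction(1)[OF u d, of n] avg_L1_contraction(1)[OF vint d, of n] u vint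
    have "(LBINT s. \<bar>avg (d n) u s - u s\<bar>)
       \<le> (LBINT s. \<bar>avg (d n) u s - avg (d n) v s\<bar> + (\<bar>avg (d n) v s - v s\<bar> + \<bar>u s - v s\<bar>))"
      using ints by (intro integral_mono) auto
    also have "\<dots> = (LBINT s. \<bar>avg (d n) u s - avg (d n) v s\<bar>)
       + ((LBINT s. \<bar>avg (d n) v s - v s\<bar>) + (LBINT s. \<bar>u s - v s\<bar>))"
      using ints by simp
    also have "\<dots> < e" using n c uv by linarith
    moreover have "0 \<le> (LBINT s. \<bar>avg (d n) u s - u s\<bar>)" by (rule Bochner_Integration.integral_nonneg) auto
    ultimately show "norm ((LBINT s. \<bar>avg (d n) u s - u s\<bar>) - 0) < e" by simp
  qed
qed

text \<open>
  A weak form of Lebesgue's differentiation theorem. It suffices here because all estimates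
  on \<open>u\<close> are first proved for the averages, with constants that do not depend on \<open>\<delta>\<close>.
\<close>
lemma avg_AE_subsequence:
  assumes u: "integrable lborel u"
  obtains d :: "nat \<Rightarrow> real" where "\<And>n. 0 < d n" "d \<longlonglongrightarrow> 0" "AE s in lborel. (\<lambda>n. avg (d n) u s) \<longlonglongrightarrow> u s"
proof -
  define d where "d n = inverse (real (Suc n))" for n
  have d: "\<And>n. 0 < d n" "d \<longlonglongrightarrow> 0" unfolding d_def using LIMSEQ_inverse_real_of_nat by auto
  have "\<exists>r::nat\<Rightarrow>nat. strict_mono r \<and> (AE s in lborel. (\<lambda>n. avg (d (r n)) u s - u s) \<longlonglongrightarrow> 0)"
    by (rule tendsto_L1_AE_subseq) (use avg_tendsto_L1[OF u d] avg_L1_contraction(1)[OF u d(1)] u in auto)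
  then obtain r :: "nat \<Rightarrow> nat" where r: "strict_mono r" "AE s in lborel. (\<lambda>n. avg (d (r n)) u s - u s) \<longlonglongrightarrow> 0" by blast
  show ?thesis
    by (rule that[of "d \<circ> r"]) (use d(1) r(2) LIMSEQ_subseq_LIMSEQ[OF d(2) r(1)] in \<open>simp_all add: LIM_zero_iff\<close>)
qed

section \<open>The profile of a symmetric anisotropy\<close>

locale symmetric_anisotropy =
  fixes \<phi> :: "real \<times> real \<Rightarrow> real"
  assumes aniso: "anisotropy \<phi>"
    and sym: "axis_symmetric (aniso_ball \<phi>)"
    and no_facets: "no_vertical_facets (aniso_ball \<phi>)"
begin

definition halfwidth :: real where "halfwidth = 1 / \<phi> (1, 0)"

text \<open>
  The unit ball is the region between the graphs of \<open>profile\<close> and \<open>- profile\<close> over the interval from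
  \<open>- halfwidth\<close> to \<open>halfwidth\<close>. For a Lipschitz function \<open>v\<close> the integrand \<open>\<phi>\<^sup>o (- v', 1)\<close> is the maximum of
  \<open>profile x - v' * x\<close> over that interval.
\<close>
definition profile :: "real \<Rightarrow> real" where "profile x = Sup {y. \<phi> (x, y) \<le> 1}"

text \<open>
  Some supergradient of the concave profile. Any choice is antimonotone, hence Borel measurable.
\<close>
definition slope :: "real \<Rightarrow> real" where
  "slope y = (SOME G. \<forall>z\<in>{- halfwidth..halfwidth}. profile z \<le> profile y + G * (z - y))"

lemma phi_nonneg: "0 \<le> \<phi> z"
  using aniso unfolding anisotropy_def by blast

lemma phi_minus: "\<phi> (- z) = \<phi> z"
  using aniso unfolding anisotropy_def by blast

lemma phi_convex: "convex_on UNIV \<phi>"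
  using aniso unfolding anisotropy_def by blast

lemma phi_zero: "\<phi> 0 = 0"
proof -
  have "\<phi> ((2::real) *\<^sub>R 0) = 2 * \<phi> 0" using aniso unfolding anisotropy_def by (metis zero_less_numeral)
  then show ?thesis by simp
qed

lemma phi_scale: "\<phi> (t *\<^sub>R z) = \<bar>t\<bar> * \<phi> z"
proof -
  have pos: "\<phi> (s *\<^sub>R z) = s * \<phi> z" if "s > 0" for s
    using aniso that unfolding anisotropy_def by blast
  consider "t > 0" | "t = 0" | "t < 0" by linarith
  then show ?thesis
  proof cases
    case 3
    then have "\<phi> (- ((- t) *\<^sub>R z)) = - t * \<phi> z" using pos[of "- t"] by (subst phi_minus) simp
    then show ?thesis using 3 by simp
  qed (use pos phi_zero in auto)
qed

lemma phi_pos: "z \<noteq> 0 \<Longrightarrow> 0 < \<phi> z"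
proof -
  assume z: "z \<noteq> 0"
  obtain c where c: "0 < c" "\<And>x. x \<in> sphere 0 1 \<Longrightarrow> c \<le> \<phi> x"
    using aniso unfolding anisotropy_def by blast
  have "c \<le> \<phi> ((1 / norm z) *\<^sub>R z)" using z by (intro c) auto
  then have "c \<le> \<phi> z / norm z" by (simp add: phi_scale)
  then have "0 < \<phi> z / norm z" using c(1) by linarith
  then show ?thesis using z by (simp add: zero_less_divide_iff)
qed

lemma phi_triangle: "\<phi> (z + w) \<le> \<phi> z + \<phi> w"
proof -
  have "\<phi> ((1 - 1/2) *\<^sub>R (2 *\<^sub>R z) + (1/2) *\<^sub>R (2 *\<^sub>R w)) \<le> (1 - 1/2) * \<phi> (2 *\<^sub>R z) + (1/2) * \<phi> (2 *\<^sub>R w)"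
    by (rule convex_onD[OF phi_convex]) auto
  then show ?thesis by (simp add: phi_scale)
qed

lemma phi_continuous: "continuous_on UNIV \<phi>"
  using convex_on_continuous[OF open_UNIV phi_convex] .

lemma ball_symmetric:
  "\<phi> (x, y) \<le> 1 \<longleftrightarrow> \<phi> (- x, y) \<le> 1" "\<phi> (x, y) \<le> 1 \<longleftrightarrow> \<phi> (x, - y) \<le> 1"
proof -
  have s: "(\<lambda>(x, y). (- x, y)) ` {z. \<phi> z \<le> 1} = {z. \<phi> z \<le> 1}"
    "(\<lambda>(x, y). (x, - y)) ` {z. \<phi> z \<le> 1} = {z. \<phi> z \<le> 1}"
    using sym by (auto simp: axis_symmetric_def aniso_ball_def)
  have "\<phi> (- x, y) \<le> 1" if "\<phi> (x, y) \<le> 1" for x y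
    using imageI[of "(x, y)" "{z. \<phi> z \<le> 1}" "\<lambda>(x, y). (- x, y)"] that s(1) by auto
  from this[of x y] this[of "- x" y] show "\<phi> (x, y) \<le> 1 \<longleftrightarrow> \<phi> (- x, y) \<le> 1" by auto
  have "\<phi> (x, - y) \<le> 1" if "\<phi> (x, y) \<le> 1" for x y
    using imageI[of "(x, y)" "{z. \<phi> z \<le> 1}" "\<lambda>(x, y). (x, - y)"] that s(2) by auto
  from this[of x y] this[of x "- y"] show "\<phi> (x, y) \<le> 1 \<longleftrightarrow> \<phi> (x, - y) \<le> 1" by auto
qed

lemma phi_reflect: "\<phi> (- x, y) = \<phi> (x, y)" "\<phi> (x, - y) = \<phi> (x, y)"
proof -
  have le: "\<phi> (- x, y) \<le> \<phi> (x, y) \<and> \<phi> (x, - y) \<le> \<phi> (x, y)" for x y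
  proof (cases "(x, y) = 0")
    case True
    then show ?thesis by (simp add: zero_prod_def)
  next
    case False
    define t where "t = \<phi> (x, y)"
    have t: "t > 0" using phi_pos[OF False] by (simp add: t_def)
    have "\<phi> (x / t, y / t) = 1" using phi_scale[of "1 / t" "(x, y)"] t by (simp add: t_def)
    then have "\<phi> (- (x / t), y / t) \<le> 1" "\<phi> (x / t, - (y / t)) \<le> 1"
      using ball_symmetric[of "x / t" "y / t"] by auto
    moreover have "\<phi> (- x, y) = t * \<phi> (- (x / t), y / t)" "\<phi> (x, - y) = t * \<phi> (x / t, - (y / t))"
      using phi_scale[of t "(- (x / t), y / t)"] phi_scale[of t "(x / t, - (y / t))"] t by auto
    moreover have "t * \<phi> (- (x / t), y / t) \<le> t * 1" "t * \<phi> (x / t, - (y / t)) \<le> t * 1"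
      using calculation(1,2) t by (intro mult_left_mono; simp)+
    ultimately show ?thesis by (simp add: t_def)
  qed
  show "\<phi> (- x, y) = \<phi> (x, y)" using le[of x y] le[of "- x" y] by simp
  show "\<phi> (x, - y) = \<phi> (x, y)" using le[of x y] le[of x "- y"] by simp
qed

lemma phi_mono_snd: "\<bar>y'\<bar> \<le> y \<Longrightarrow> \<phi> (x, y') \<le> \<phi> (x, y)"
proof -
  assume y: "\<bar>y'\<bar> \<le> y"
  show ?thesis
  proof (cases "y = 0")
    case False
    then have y0: "y > 0" using y by linarith
    define c where "c = (1 + y' / y) / 2"
    have c: "0 \<le> c" "c \<le> 1" using y y0 by (auto simp: c_def abs_le_iff field_simps)
    have "\<phi> ((1 - c) *\<^sub>R (x, - y) + c *\<^sub>R (x, y)) \<le> (1 - c) * \<phi> (x, - y) + c * \<phi> (x, y)"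
      by (rule convex_onD[OF phi_convex]) (use c in auto)
    moreover have "(1 - c) *\<^sub>R (x, - y) + c *\<^sub>R (x, y) = (x, y')"
    proof -
      have "(1 - c) * (- y) + c * y = (2 * c - 1) * y" by (simp add: algebra_simps)
      also have "2 * c - 1 = y' / y" unfolding c_def by (simp only: nonzero_mult_div_cancel_left times_divide_eq_right)
      also have "y' / y * y = y'" using y0 by simp
      finally show ?thesis by (simp add: algebra_simps)
    qed
    ultimately show ?thesis by (simp add: phi_reflect algebra_simps)
  qed (use y in auto)
qed

lemma phi_mono_fst: "\<bar>x'\<bar> \<le> x \<Longrightarrow> \<phi> (x', y) \<le> \<phi> (x, y)"
proof -
  assume x: "\<bar>x'\<bar> \<le> x"
  show ?thesis
  proof (cases "x = 0")
    case False
    then have x0: "x > 0" using x by linarith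
    define c where "c = (1 + x' / x) / 2"
    have c: "0 \<le> c" "c \<le> 1" using x x0 by (auto simp: c_def abs_le_iff field_simps)
    have "\<phi> ((1 - c) *\<^sub>R (- x, y) + c *\<^sub>R (x, y)) \<le> (1 - c) * \<phi> (- x, y) + c * \<phi> (x, y)"
      by (rule convex_onD[OF phi_convex]) (use c in auto)
    moreover have "(1 - c) *\<^sub>R (- x, y) + c *\<^sub>R (x, y) = (x', y)"
    proof -
      have "(1 - c) * (- x) + c * x = (2 * c - 1) * x" by (simp add: algebra_simps)
      also have "2 * c - 1 = x' / x" unfolding c_def by (simp only: nonzero_mult_div_cancel_left times_divide_eq_right)
      also have "x' / x * x = x'" using x0 by simp
      finally show ?thesis by (simp add: algebra_simps)
    qed
    ultimately show ?thesis by (simp add: phi_reflect algebra_simps)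
  qed (use x in auto)
qed

lemma halfwidth_pos: "0 < halfwidth"
  using phi_pos[of "(1, 0)"] by (simp add: halfwidth_def zero_prod_def)

lemma phi_horizontal: "\<phi> (x, 0) = \<bar>x\<bar> / halfwidth"
  using phi_scale[of x "(1, 0)"] by (simp add: halfwidth_def)

lemma phi_vertical: "\<phi> (0, y) = \<bar>y\<bar> * \<phi> (0, 1)" "0 < \<phi> (0, 1)"
  using phi_scale[of y "(0, 1)"] phi_pos[of "(0, 1)"] by (auto simp: zero_prod_def)

lemma phi_abs: "\<phi> (\<bar>x\<bar>, y) = \<phi> (x, y)" "\<phi> (x, \<bar>y\<bar>) = \<phi> (x, y)"
  by (auto simp: abs_if phi_reflect)

lemma ball_fst: "\<phi> (x, y) \<le> 1 \<Longrightarrow> \<bar>x\<bar> \<le> halfwidth"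
proof -
  assume "\<phi> (x, y) \<le> 1"
  then have "\<phi> (x, 0) \<le> 1" using phi_mono_snd[of 0 "\<bar>y\<bar>" x] phi_abs(2)[of x y] by simp
  then show ?thesis using halfwidth_pos by (simp add: phi_horizontal)
qed

lemma ball_snd: "\<phi> (x, y) \<le> 1 \<Longrightarrow> y \<le> 1 / \<phi> (0, 1)"
proof -
  assume "\<phi> (x, y) \<le> 1"
  then have "\<phi> (0, y) \<le> 1" using phi_mono_fst[of 0 "\<bar>x\<bar>" y] phi_abs(1)[of x y] by simp
  then have "\<bar>y\<bar> * \<phi> (0, 1) \<le> 1" by (subst (asm) phi_vertical(1))
  moreover have "y * \<phi> (0, 1) \<le> \<bar>y\<bar> * \<phi> (0, 1)" using phi_vertical(2) by (intro mult_right_mono) auto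
  ultimately have "y * \<phi> (0, 1) \<le> 1" by linarith
  then show ?thesis using phi_vertical(2) by (simp add: pos_le_divide_eq)
qed

lemma profile_upper: "\<phi> (x, y) \<le> 1 \<Longrightarrow> y \<le> profile x"
  unfolding profile_def using ball_snd[of x] by (intro cSup_upper bdd_aboveI[of _ "1 / \<phi> (0, 1)"]) auto

lemma profile_in_ball:
  assumes "\<bar>x\<bar> \<le> halfwidth"
  shows "\<phi> (x, profile x) \<le> 1"
proof -
  have "closed {y. \<phi> (x, y) \<le> 1}"
    by (intro closed_Collect_le continuous_intros continuous_on_compose2[OF phi_continuous]) auto
  moreover have "0 \<in> {y. \<phi> (x, y) \<le> 1}"
    using assms halfwidth_pos by (simp add: phi_horizontal)
  moreover have "bdd_above {y. \<phi> (x, y) \<le> 1}"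
    using ball_snd[of x] by (intro bdd_aboveI[of _ "1 / \<phi> (0, 1)"]) auto
  ultimately have "profile x \<in> {y. \<phi> (x, y) \<le> 1}"
    unfolding profile_def by (intro closed_contains_Sup) auto
  then show ?thesis by simp
qed

lemma profile_nonneg: "\<bar>x\<bar> \<le> halfwidth \<Longrightarrow> 0 \<le> profile x"
  using profile_upper[of x 0] phi_horizontal[of x] halfwidth_pos by simp

lemma profile_le_max: "\<bar>x\<bar> \<le> halfwidth \<Longrightarrow> profile x \<le> profile 0"
proof -
  assume x: "\<bar>x\<bar> \<le> halfwidth"
  have "\<phi> (0, profile x) \<le> \<phi> (\<bar>x\<bar>, profile x)" by (rule phi_mono_fst) simp
  also have "\<dots> = \<phi> (x, profile x)" by (auto simp: abs_if phi_reflect)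
  also have "\<dots> \<le> 1" by (rule profile_in_ball[OF x])
  finally show ?thesis by (rule profile_upper)
qed

lemma profile_antimono: "\<bar>x\<bar> \<le> r \<Longrightarrow> r \<le> halfwidth \<Longrightarrow> profile r \<le> profile x"
  using profile_upper[of x "profile r"] phi_mono_fst[of x r "profile r"] profile_in_ball[of r] by linarith

lemma profile_in_ball_below:
  assumes "\<bar>x\<bar> \<le> halfwidth" "0 \<le> y" "y \<le> profile x"
  shows "\<phi> (x, y) \<le> 1"
  using phi_mono_snd[of y "profile x" x] profile_in_ball[OF assms(1)] assms by simp

lemma profile_concave:
  assumes "\<bar>x\<bar> \<le> halfwidth" "\<bar>z\<bar> \<le> halfwidth" "0 \<le> t" "t \<le> 1"
  shows "(1 - t) * profile x + t * profile z \<le> profile ((1 - t) * x + t * z)"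
proof (rule profile_upper)
  have "\<phi> ((1 - t) *\<^sub>R (x, profile x) + t *\<^sub>R (z, profile z)) \<le> (1 - t) * \<phi> (x, profile x) + t * \<phi> (z, profile z)"
    by (rule convex_onD[OF phi_convex]) (use assms in auto)
  also have "\<dots> \<le> (1 - t) * 1 + t * 1"
    using assms profile_in_ball by (intro add_mono mult_left_mono) auto
  finally show "\<phi> ((1 - t) * x + t * z, (1 - t) * profile x + t * profile z) \<le> 1" by simp
qed

lemma profile_zero_pos: "0 < profile 0"
proof -
  have "1 / \<phi> (0, 1) \<le> profile 0"
    by (rule profile_upper) (use phi_vertical(1)[of "1 / \<phi> (0, 1)"] phi_vertical(2) in simp)
  moreover have "0 < 1 / \<phi> (0, 1)" using phi_vertical(2) by simp
  ultimately show ?thesis by linarith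
qed

lemma profile_pos: "\<bar>x\<bar> < halfwidth \<Longrightarrow> 0 < profile x"
proof -
  assume x: "\<bar>x\<bar> < halfwidth"
  define t where "t = \<bar>x\<bar> / halfwidth"
  have t: "0 \<le> t" "t < 1" using x halfwidth_pos by (auto simp: t_def)
  have "0 < (1 - t) * profile 0" using t profile_zero_pos by simp
  also have "\<dots> \<le> (1 - t) * profile 0 + t * profile halfwidth"
    using t profile_nonneg[of halfwidth] halfwidth_pos by simp
  also have "\<dots> \<le> profile ((1 - t) * 0 + t * halfwidth)"
    using t halfwidth_pos by (intro profile_concave) auto
  also have "(1 - t) * 0 + t * halfwidth = \<bar>x\<bar>" using halfwidth_pos by (simp add: t_def)
  also have "profile \<bar>x\<bar> = profile x" by (auto simp: abs_if profile_def phi_reflect)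
  finally show ?thesis .
qed

lemma phi_on_profile: "\<bar>x\<bar> \<le> halfwidth \<Longrightarrow> \<phi> (x, profile x) = 1"
proof (rule ccontr)
  assume x: "\<bar>x\<bar> \<le> halfwidth" and "\<phi> (x, profile x) \<noteq> 1"
  then have lt: "\<phi> (x, profile x) < 1" using profile_in_ball[OF x] by simp
  define e where "e = (1 - \<phi> (x, profile x)) / \<phi> (0, 1)"
  have e: "e > 0" "e * \<phi> (0, 1) = 1 - \<phi> (x, profile x)" using lt phi_vertical(2) by (auto simp: e_def)
  have "\<phi> (x, profile x + e) \<le> \<phi> (x, profile x) + \<phi> (0, e)"
    using phi_triangle[of "(x, profile x)" "(0, e)"] by simp
  also have "\<dots> = 1" using e phi_vertical(1)[of e] by simp
  finally show False using profile_upper[of x "profile x + e"] e by simp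
qed

text \<open>
  Otherwise the ball would contain the vertical segment from \<open>(halfwidth, - profile halfwidth)\<close> to
  \<open>(halfwidth, profile halfwidth)\<close>, which lies on its boundary.
\<close>
lemma profile_halfwidth: "profile halfwidth = 0"
proof (rule ccontr)
  assume "profile halfwidth \<noteq> 0"
  then have pos: "0 < profile halfwidth" using profile_nonneg[of halfwidth] halfwidth_pos by simp
  have "closed_segment (halfwidth, - profile halfwidth) (halfwidth, profile halfwidth) \<subseteq> frontier (aniso_ball \<phi>)"
  proof
    fix z assume "z \<in> closed_segment (halfwidth, - profile halfwidth) (halfwidth, profile halfwidth)"
    then obtain y where z: "z = (halfwidth, y)" "\<bar>y\<bar> \<le> profile halfwidth"
      using pos by (auto simp: closed_segment_same_fst closed_segment_eq_real_ivl split: if_splits)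
    have "\<phi> z \<le> 1"
      using phi_mono_snd[of y "profile halfwidth" halfwidth] profile_in_ball[of halfwidth] z halfwidth_pos by simp
    then have "z \<in> closure (aniso_ball \<phi>)"
      using closure_subset[of "aniso_ball \<phi>"] by (auto simp: aniso_ball_def)
    moreover have "z \<notin> interior (aniso_ball \<phi>)"
    proof
      assume "z \<in> interior (aniso_ball \<phi>)"
      then obtain e where e: "e > 0" "ball z e \<subseteq> aniso_ball \<phi>" by (auto simp: mem_interior)
      have "dist z (halfwidth + e / 2, y) < e" using e(1) z by (simp add: dist_Pair_Pair dist_real_def)
      then have "\<phi> (halfwidth + e / 2, y) \<le> 1" using e(2) by (auto simp: aniso_ball_def)
      then show False using ball_fst[of "halfwidth + e / 2" y] e(1) halfwidth_pos by simp
    qed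
    ultimately show "z \<in> frontier (aniso_ball \<phi>)" by (simp add: frontier_def)
  qed
  moreover have "- profile halfwidth < profile halfwidth" using pos by simp
  ultimately show False using no_facets unfolding no_vertical_facets_def by blast
qed

text \<open>
  The profile is upper semicontinuous and vanishes at \<open>halfwidth\<close>, so it must drop before reaching it. This
  drop is what bounds the dual potential away from \<open>halfwidth\<close> when the datum is small.
\<close>
lemma profile_below_max: obtains r where "0 < r" "r < halfwidth" "profile r < profile 0"
proof -
  have "\<exists>r. 0 < r \<and> r < halfwidth \<and> profile r < profile 0"
  proof (rule ccontr)
    assume "\<not> ?thesis"
    then have *: "profile 0 \<le> profile r" if "0 < r" "r < halfwidth" for r using that by force
    define r where "r n = halfwidth * (1 - inverse (real (n + 2)))" for n
    have r: "0 < r n" "r n < halfwidth" for n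
    proof -
      have "inverse (real (n + 2)) < 1" "0 < inverse (real (n + 2))" by (auto simp: field_simps)
      then show "0 < r n" "r n < halfwidth" unfolding r_def using halfwidth_pos by auto
    qed
    have "(\<lambda>n. inverse (real (n + 2))) \<longlonglongrightarrow> 0"
      using LIMSEQ_ignore_initial_segment[OF lim_inverse_n, of 2] by simp
    then have "r \<longlonglongrightarrow> halfwidth * (1 - 0)" unfolding r_def by (intro tendsto_intros)
    then have "(\<lambda>n. (r n, profile 0)) \<longlonglongrightarrow> (halfwidth, profile 0)" by (auto intro: tendsto_Pair)
    moreover have "isCont \<phi> (halfwidth, profile 0)"
      using phi_continuous by (simp add: continuous_on_eq_continuous_at)
    ultimately have lim: "(\<lambda>n. \<phi> (r n, profile 0)) \<longlonglongrightarrow> \<phi> (halfwidth, profile 0)"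
      by (rule isCont_tendsto_compose[rotated])
    have "\<phi> (halfwidth, profile 0) \<le> 1"
    proof (rule LIMSEQ_le_const2[OF lim], intro exI[of _ 0] allI impI)
      fix n show "\<phi> (r n, profile 0) \<le> 1"
        using *[OF r] r[of n] profile_zero_pos by (intro profile_in_ball_below) auto
    qed
    from profile_upper[OF this] show False using profile_halfwidth profile_zero_pos by simp
  qed
  then show ?thesis using that by blast
qed

lemma profile_le_slope:
  assumes y: "\<bar>y\<bar> < halfwidth" and z: "\<bar>z\<bar> \<le> halfwidth"
  shows "profile z \<le> profile y + slope y * (z - y)"
proof -
  let ?S = "{- halfwidth..halfwidth}"
  have conv: "convex_on ?S (\<lambda>x. - profile x)"
  proof (rule convex_onI)
    fix t x z :: real assume "0 < t" "t < 1" "x \<in> ?S" "z \<in> ?S"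
    then show "- profile ((1 - t) *\<^sub>R x + t *\<^sub>R z) \<le> (1 - t) * - profile x + t * - profile z"
      using profile_concave[of x z t] by (auto simp: abs_le_iff)
  qed simp
  define D where "D = Inf ((\<lambda>t. (- profile y - - profile t) / (y - t)) ` ({y<..} \<inter> ?S))"
  have D: "- profile z \<ge> - profile y + D * (z - y)" if "z \<in> ?S" for z
    unfolding D_def by (rule convex_le_Inf_differential[OF conv _ that]) (use y in \<open>auto simp: interior_atLeastAtMost_real\<close>)
  have "\<exists>G. \<forall>z\<in>?S. profile z \<le> profile y + G * (z - y)"
    by (rule exI[of _ "- D"]) (use D in \<open>auto simp: algebra_simps\<close>)
  from someI_ex[OF this, folded slope_def] have "\<forall>z\<in>?S. profile z \<le> profile y + slope y * (z - y)" .
  moreover have "z \<in> ?S" using z by auto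
  ultimately show ?thesis by blast
qed

lemma slope_antimono:
  assumes "\<bar>y\<bar> < halfwidth" "\<bar>z\<bar> < halfwidth" "y \<le> z"
  shows "slope z \<le> slope y"
proof (cases "y = z")
  case False
  then have lt: "y < z" using assms by simp
  have "profile z \<le> profile y + slope y * (z - y)" "profile y \<le> profile z + slope z * (y - z)"
    using assms by (auto intro!: profile_le_slope)
  then have "0 \<le> (slope y - slope z) * (z - y)" by (simp add: algebra_simps)
  then show ?thesis using lt by (simp add: zero_le_mult_iff)
qed simp

lemma slope_sign:
  assumes "\<bar>y\<bar> < halfwidth"
  shows "0 < y \<Longrightarrow> slope y \<le> 0" "y < 0 \<Longrightarrow> 0 \<le> slope y"
proof -
  have "profile 0 \<le> profile y + slope y * (0 - y)" by (rule profile_le_slope) (use assms halfwidth_pos in auto)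
  moreover have "profile y \<le> profile 0" using assms by (intro profile_le_max) simp
  ultimately have *: "slope y * y \<le> 0" by simp
  show "0 < y \<Longrightarrow> slope y \<le> 0" "y < 0 \<Longrightarrow> 0 \<le> slope y"
    using * by (auto simp: mult_le_0_iff)
qed

definition slope_bound :: "real \<Rightarrow> real" where "slope_bound r = max \<bar>slope r\<bar> \<bar>slope (- r)\<bar>"

lemma slope_bounded: "r < halfwidth \<Longrightarrow> \<bar>y\<bar> \<le> r \<Longrightarrow> \<bar>slope y\<bar> \<le> slope_bound r"
  using slope_antimono[of y r] slope_antimono[of "- r" y] unfolding slope_bound_def by linarith

lemma slope_bound_nonneg: "0 \<le> slope_bound r" by (simp add: slope_bound_def)

lemma profile_lipschitz:
  assumes "r < halfwidth" "\<bar>y\<bar> \<le> r" "\<bar>z\<bar> \<le> r"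
  shows "\<bar>profile y - profile z\<bar> \<le> slope_bound r * \<bar>y - z\<bar>"
proof -
  have *: "profile y - profile z \<le> slope_bound r * \<bar>y - z\<bar>" if "\<bar>y\<bar> \<le> r" "\<bar>z\<bar> \<le> r" for y z
  proof -
    have "profile y - profile z \<le> slope z * (y - z)" using profile_le_slope[of z y] that assms(1) by simp
    also have "\<dots> \<le> \<bar>slope z\<bar> * \<bar>y - z\<bar>" by (metis abs_ge_self abs_mult)
    also have "\<dots> \<le> slope_bound r * \<bar>y - z\<bar>" using slope_bounded that assms(1) by (intro mult_right_mono) auto
    finally show ?thesis .
  qed
  show ?thesis using *[OF assms(2,3)] *[OF assms(3,2)] by (simp add: abs_le_iff abs_minus_commute)
qed

lemma clamped_slope_measurable:
  assumes "0 \<le> r" "r < halfwidth"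
  shows "(\<lambda>y. slope (max (- r) (min r y))) \<in> borel_measurable borel"
proof -
  have "(\<lambda>y. - slope (max (- r) (min r y))) \<in> borel_measurable borel"
    by (rule borel_measurable_mono, rule monoI) (use assms in \<open>auto intro!: slope_antimono\<close>)
  then show ?thesis by simp
qed

lemma clamped_profile_continuous:
  assumes "0 \<le> r" "r < halfwidth"
  shows "continuous_on UNIV (\<lambda>y. profile (max (- r) (min r y)))"
proof -
  have "(slope_bound r)-lipschitz_on UNIV (\<lambda>y. profile (max (- r) (min r y)))"
  proof (rule lipschitz_onI[OF _ slope_bound_nonneg])
    fix y z :: real
    have "\<bar>profile (max (- r) (min r y)) - profile (max (- r) (min r z))\<bar>
        \<le> slope_bound r * \<bar>max (- r) (min r y) - max (- r) (min r z)\<bar>"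
      by (rule profile_lipschitz[OF assms(2)]) (use assms in auto)
    also have "\<dots> \<le> slope_bound r * \<bar>y - z\<bar>"
      by (intro mult_left_mono slope_bound_nonneg) auto
    finally show "dist (profile (max (- r) (min r y))) (profile (max (- r) (min r z))) \<le> slope_bound r * dist y z"
      by (simp add: dist_real_def)
  qed
  then show ?thesis by (rule lipschitz_on_continuous_on)
qed

text \<open>
  By implicit differentiation of \<open>\<phi> (y, profile y) = 1\<close> the slope is \<open>- P / Q\<close>, where \<open>P\<close> and \<open>Q\<close> are the
  partial derivatives of \<open>\<phi>\<close> at \<open>(y, profile y)\<close>. Both are Lipschitz in \<open>y\<close>, and \<open>Q\<close> is bounded below:
  \<open>\<phi> (y, _)\<close> is convex and increases from \<open>\<bar>y\<bar> / halfwidth < 1\<close> at \<open>0\<close> to \<open>1\<close> at \<open>profile y\<close>.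
\<close>
lemma slope_lipschitz:
  assumes C2: "C2_on (- {0}) \<phi>" and r: "0 \<le> r" "r < halfwidth"
  obtains K where "0 \<le> K" "\<And>y z. \<bar>y\<bar> \<le> r \<Longrightarrow> \<bar>z\<bar> \<le> r \<Longrightarrow> \<bar>slope y - slope z\<bar> \<le> K * \<bar>y - z\<bar>"
proof -
  obtain f' :: "real \<times> real \<Rightarrow> (real \<times> real) \<Rightarrow>\<^sub>L real" and f''
    where f': "\<And>z. z \<noteq> 0 \<Longrightarrow> (\<phi> has_derivative blinfun_apply (f' z)) (at z)"
      and f'': "\<And>z. z \<noteq> 0 \<Longrightarrow> (f' has_derivative blinfun_apply (f'' z)) (at z)"
      and cont: "continuous_on (- {0}) f''"
    using C2 unfolding C2_on_def by auto
  define P where "P y = f' (y, profile y) (1, 0)" for y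
  define Q where "Q y = f' (y, profile y) (0, 1)" for y
  have ne: "(y, profile y) \<noteq> 0" if "\<bar>y\<bar> \<le> r" for y
    using profile_pos[of y] that r by (auto simp: zero_prod_def)
  \<comment> \<open>A compact convex set that contains the arc of the boundary over \<open>[- r, r]\<close> and misses the origin.\<close>
  define R where "R = {- r..r} \<times> {profile r..profile 0}"
  have R0: "z \<noteq> 0" if "z \<in> R" for z
    using that profile_pos[of r] r by (auto simp: R_def zero_prod_def)
  have inR: "(y, profile y) \<in> R" if "\<bar>y\<bar> \<le> r" for y
    using that r profile_le_max[of y] profile_antimono[of y r] by (auto simp: R_def)
  have "compact (f'' ` R)"
    using R0 by (intro compact_continuous_image continuous_on_subset[OF cont]) (auto simp: R_def intro: compact_Times)
  then obtain B where B: "\<And>z. z \<in> R \<Longrightarrow> norm (f'' z) \<le> B"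
    using compact_imp_bounded[of "f'' ` R"] unfolding bounded_iff by auto
  have B0: "0 \<le> B" using order_trans[OF norm_ge_zero B[OF inR[of 0]]] r by simp
  have lip: "norm (f' z - f' w) \<le> B * norm (z - w)" if "z \<in> R" "w \<in> R" for z w
  proof (rule differentiable_bound[where S=R and f'="\<lambda>z. blinfun_apply (f'' z)"])
    show "convex R" by (auto simp: R_def intro: convex_Times)
    show "(f' has_derivative blinfun_apply (f'' x)) (at x within R)" if "x \<in> R" for x
      by (rule has_derivative_at_withinI[OF f''[OF R0[OF that]]])
    show "onorm (blinfun_apply (f'' x)) \<le> B" if "x \<in> R" for x
      using B[OF that] by (simp add: norm_blinfun.rep_eq)
  qed (use that in auto)
  define K1 where "K1 = B * (1 + slope_bound r)"
  have K1: "0 \<le> K1" using B0 slope_bound_nonneg by (simp add: K1_def)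
  have lipf: "norm (f' (y, profile y) - f' (z, profile z)) \<le> K1 * \<bar>y - z\<bar>" if "\<bar>y\<bar> \<le> r" "\<bar>z\<bar> \<le> r" for y z
  proof -
    have "norm (f' (y, profile y) - f' (z, profile z)) \<le> B * norm ((y, profile y) - (z, profile z))"
      using inR that by (intro lip) auto
    also have "\<dots> \<le> B * (\<bar>y - z\<bar> + \<bar>profile y - profile z\<bar>)"
      using norm_Pair_le[of "y - z" "profile y - profile z"] B0 by (intro mult_left_mono) auto
    also have "\<dots> \<le> B * (\<bar>y - z\<bar> + slope_bound r * \<bar>y - z\<bar>)"
      using that r B0 by (intro mult_left_mono add_left_mono profile_lipschitz) auto
    finally show ?thesis by (simp add: K1_def algebra_simps)
  qed
  have apply_le: "\<bar>(f' (y, profile y)) v - (f' (z, profile z)) v\<bar> \<le> K1 * \<bar>y - z\<bar>"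
    if "\<bar>y\<bar> \<le> r" "\<bar>z\<bar> \<le> r" "norm v \<le> 1" for y z v
  proof -
    have "\<bar>(f' (y, profile y)) v - (f' (z, profile z)) v\<bar> = norm (blinfun_apply (f' (y, profile y) - f' (z, profile z)) v)"
      by (simp add: minus_blinfun.rep_eq)
    also have "\<dots> \<le> norm (f' (y, profile y) - f' (z, profile z)) * norm v" by (rule norm_blinfun)
    also have "\<dots> \<le> norm (f' (y, profile y) - f' (z, profile z)) * 1" using that by (intro mult_left_mono) auto
    also have "\<dots> \<le> K1 * \<bar>y - z\<bar>" using lipf[OF that(1,2)] by simp
    finally show ?thesis .
  qed
  define q where "q = (1 - r / halfwidth) / profile 0"
  have q: "0 < q" using r halfwidth_pos profile_zero_pos by (simp add: q_def)
  have Q: "q \<le> Q y" if y: "\<bar>y\<bar> \<le> r" for y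
  proof -
    have "((\<lambda>t. \<phi> (y, t)) has_derivative (\<lambda>t. f' (y, profile y) (0, t))) (at (profile y))"
      by (rule has_derivative_compose[where f="\<lambda>t. (y, t)" and g=\<phi>, OF _ f'[OF ne[OF y]]])
        (auto intro!: derivative_eq_intros)
    moreover have "(\<lambda>t. f' (y, profile y) (0, t)) = (\<lambda>t. Q y * t)"
    proof
      fix t
      have "f' (y, profile y) (t *\<^sub>R (0, 1)) = t *\<^sub>R Q y" unfolding Q_def by (rule blinfun.scaleR_right)
      then show "f' (y, profile y) (0, t) = Q y * t" by simp
    qed
    ultimately have der: "((\<lambda>t. \<phi> (y, t)) has_real_derivative Q y) (at (profile y))"
      by (simp add: has_field_derivative_def)
    have "convex_on UNIV (\<lambda>t. \<phi> (y, t))"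
    proof (rule convex_onI)
      fix t x z :: real assume "0 < t" "t < 1"
      then have "\<phi> ((1 - t) *\<^sub>R (y, x) + t *\<^sub>R (y, z)) \<le> (1 - t) * \<phi> (y, x) + t * \<phi> (y, z)"
        by (intro convex_onD[OF phi_convex]) auto
      then show "\<phi> (y, (1 - t) *\<^sub>R x + t *\<^sub>R z) \<le> (1 - t) * \<phi> (y, x) + t * \<phi> (y, z)"
        by (simp add: algebra_simps)
    qed simp
    then have "\<phi> (y, 0) - \<phi> (y, profile y) \<ge> Q y * (0 - profile y)"
      using der by (intro convex_on_imp_above_tangent[of UNIV]) auto
    then have "1 - \<bar>y\<bar> / halfwidth \<le> Q y * profile y"
      using phi_on_profile[of y] y r by (simp add: phi_horizontal)
    moreover have "1 - r / halfwidth \<le> 1 - \<bar>y\<bar> / halfwidth"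
      using y halfwidth_pos by (simp add: divide_right_mono)
    moreover have py: "0 < profile y" "profile y \<le> profile 0"
      using profile_pos[of y] profile_le_max[of y] y r by auto
    ultimately have *: "1 - r / halfwidth \<le> Q y * profile y" by linarith
    moreover have "0 < 1 - r / halfwidth" using r halfwidth_pos by simp
    ultimately have "0 < Q y" using py by (metis less_le_trans zero_less_mult_pos2)
    then have "Q y * profile y \<le> Q y * profile 0" using py by simp
    then have "1 - r / halfwidth \<le> Q y * profile 0" using * by linarith
    then show ?thesis using profile_zero_pos by (simp add: q_def field_simps)
  qed
  \<comment> \<open>The supporting line at \<open>y\<close> runs above the graph of the profile, where \<open>\<phi> = 1\<close>. Hence along it \<open>\<phi>\<close> has a
    minimum at the point of contact.\<close>
  have PQ: "P y + slope y * Q y = 0" if y: "\<bar>y\<bar> \<le> r" for y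
  proof -
    let ?H = "\<lambda>t. \<phi> (y + t, profile y + slope y * t)"
    have "(?H has_derivative (\<lambda>t. f' (y, profile y) (t, slope y * t))) (at 0)"
    proof (rule has_derivative_compose[where f="\<lambda>t. (y + t, profile y + slope y * t)" and g=\<phi>])
      show "(\<phi> has_derivative blinfun_apply (f' (y, profile y))) (at (y + 0, profile y + slope y * 0))"
        using f'[OF ne[OF y]] by simp
    qed (auto intro!: derivative_eq_intros)
    moreover have "(\<lambda>t. f' (y, profile y) (t, slope y * t)) = (\<lambda>t. (P y + slope y * Q y) * t)"
    proof
      fix t
      have "f' (y, profile y) (t *\<^sub>R (1, 0) + (slope y * t) *\<^sub>R (0, 1)) = t *\<^sub>R P y + (slope y * t) *\<^sub>R Q y"
        unfolding P_def Q_def by (simp only: blinfun.add_right blinfun.scaleR_right)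
      then show "f' (y, profile y) (t, slope y * t) = (P y + slope y * Q y) * t" by (simp add: algebra_simps)
    qed
    ultimately have der: "DERIV ?H 0 :> P y + slope y * Q y" by (simp add: has_field_derivative_def)
    show ?thesis
    proof (rule DERIV_local_min[OF der, of "halfwidth - r"])
      show "0 < halfwidth - r" using r by simp
      show "\<forall>t. \<bar>0 - t\<bar> < halfwidth - r \<longrightarrow> ?H 0 \<le> ?H t"
      proof (intro allI impI)
        fix t assume "\<bar>0 - t\<bar> < halfwidth - r"
        then have t: "\<bar>y + t\<bar> \<le> halfwidth" using y by linarith
        have "profile (y + t) \<le> profile y + slope y * t"
          using profile_le_slope[of y "y + t"] y r t by simp
        then have "\<phi> (y + t, profile (y + t)) \<le> ?H t"
          using profile_nonneg[OF t] by (intro phi_mono_snd) simp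
        then show "?H 0 \<le> ?H t" using phi_on_profile[OF t] phi_on_profile[of y] y r by simp
      qed
    qed
  qed
  show ?thesis
  proof (rule that[of "K1 * (1 + slope_bound r) / q"])
    show "0 \<le> K1 * (1 + slope_bound r) / q" using K1 q slope_bound_nonneg by simp
    fix y z assume y: "\<bar>y\<bar> \<le> r" and z: "\<bar>z\<bar> \<le> r"
    have "(slope y - slope z) * Q y = - (P y - P z) - slope z * (Q y - Q z)"
      using PQ[OF y] PQ[OF z] by (simp add: algebra_simps)
    then have "\<bar>(slope y - slope z) * Q y\<bar> \<le> \<bar>P y - P z\<bar> + \<bar>slope z * (Q y - Q z)\<bar>" by linarith
    then have "\<bar>slope y - slope z\<bar> * Q y \<le> \<bar>P y - P z\<bar> + \<bar>slope z\<bar> * \<bar>Q y - Q z\<bar>"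
      using Q[OF y] q by (simp add: abs_mult)
    also have "\<dots> \<le> K1 * \<bar>y - z\<bar> + slope_bound r * (K1 * \<bar>y - z\<bar>)"
      using apply_le[OF y z] slope_bounded[OF r(2) z] K1 unfolding P_def Q_def
      by (intro add_mono mult_mono) (auto simp: slope_bound_nonneg)
    finally have "\<bar>slope y - slope z\<bar> * Q y \<le> K1 * (1 + slope_bound r) * \<bar>y - z\<bar>" by (simp add: algebra_simps)
    moreover have "\<bar>slope y - slope z\<bar> * q \<le> \<bar>slope y - slope z\<bar> * Q y"
      using Q[OF y] by (intro mult_left_mono) auto
    ultimately show "\<bar>slope y - slope z\<bar> \<le> K1 * (1 + slope_bound r) / q * \<bar>y - z\<bar>"
      using q by (simp add: field_simps)
  qed
qed

end

section \<open>Bounded Borel functions supported in an interval\<close>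

text \<open>
  The values outside the interval are fixed to be \<open>0\<close>, so that integrals over the interval are integrals
  over the line, without indicator functions.
\<close>
definition bounded_borel :: "real \<Rightarrow> real \<Rightarrow> (real \<Rightarrow> real) set" where
  "bounded_borel a b =
     {w \<in> borel_measurable borel. (\<exists>B. \<forall>s. \<bar>w s\<bar> \<le> B) \<and> (\<forall>s. s \<notin> {a<..<b} \<longrightarrow> w s = 0)}"

lemma bounded_borelI:
  assumes "w \<in> borel_measurable borel" "\<And>s. \<bar>w s\<bar> \<le> B" "\<And>s. s \<notin> {a<..<b} \<Longrightarrow> w s = 0"
  shows "w \<in> bounded_borel a b"
  using assms by (auto simp: bounded_borel_def)

lemma bounded_borel_measurable: "w \<in> bounded_borel a b \<Longrightarrow> w \<in> borel_measurable borel"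
  by (auto simp: bounded_borel_def)

lemma bounded_borel_bound: "w \<in> bounded_borel a b \<Longrightarrow> \<exists>B\<ge>0. \<forall>s. \<bar>w s\<bar> \<le> B"
  unfolding bounded_borel_def using abs_ge_zero order_trans by blast

lemma bounded_borel_zero: "w \<in> bounded_borel a b \<Longrightarrow> s \<notin> {a<..<b} \<Longrightarrow> w s = 0"
  by (auto simp: bounded_borel_def)

lemma bounded_borel_integrable: "w \<in> bounded_borel a b \<Longrightarrow> integrable lborel w"
proof -
  assume w: "w \<in> bounded_borel a b"
  then obtain B where "\<And>s. \<bar>w s\<bar> \<le> B" using bounded_borel_bound by blast
  then show ?thesis
    using bounded_borel_measurable[OF w] bounded_borel_zero[OF w]
    by (intro integrable_bounded_interval[of w B a b]) auto
qed

lemma subspace_bounded_borel: "subspace (bounded_borel a b)"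
proof (rule subspaceI)
  show "0 \<in> bounded_borel a b"
    by (rule bounded_borelI[of _ 0]) (auto simp: zero_fun_def)
next
  fix v w assume v: "v \<in> bounded_borel a b" and w: "w \<in> bounded_borel a b"
  obtain B C where B: "\<And>s. \<bar>v s\<bar> \<le> B" and C: "\<And>s. \<bar>w s\<bar> \<le> C"
    using bounded_borel_bound v w by metis
  show "v + w \<in> bounded_borel a b"
  proof (rule bounded_borelI[of _ "B + C"])
    show "v + w \<in> borel_measurable borel"
      using bounded_borel_measurable v w by (auto simp: plus_fun_def)
    show "\<bar>(v + w) s\<bar> \<le> B + C" for s using B[of s] C[of s] by simp
  qed (use bounded_borel_zero[OF v] bounded_borel_zero[OF w] in auto)
next
  fix c :: real and v assume v: "v \<in> bounded_borel a b"
  obtain B where B: "\<And>s. \<bar>v s\<bar> \<le> B" using bounded_borel_bound[OF v] by blast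
  show "c *\<^sub>R v \<in> bounded_borel a b"
  proof (rule bounded_borelI[of _ "\<bar>c\<bar> * B"])
    show "c *\<^sub>R v \<in> borel_measurable borel"
      using bounded_borel_measurable[OF v] by (auto simp: scaleR_fun_def)
    show "\<bar>(c *\<^sub>R v) s\<bar> \<le> \<bar>c\<bar> * B" for s
      using B[of s] by (auto simp: scaleR_fun_def abs_mult intro: mult_left_mono)
  qed (use bounded_borel_zero[OF v] in \<open>auto simp: scaleR_fun_def\<close>)
qed

lemma bounded_borel_mult:
  assumes v: "v \<in> bounded_borel a b" and f: "f \<in> borel_measurable borel" "\<And>s. s \<in> {a<..<b} \<Longrightarrow> \<bar>f s\<bar> \<le> B"
  shows "(\<lambda>s. f s * v s) \<in> bounded_borel a b"
proof -
  obtain C where C: "C \<ge> 0" "\<And>s. \<bar>v s\<bar> \<le> C" using bounded_borel_bound[OF v] by blast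
  show ?thesis
  proof (rule bounded_borelI[of _ "\<bar>B\<bar> * C"])
    show "(\<lambda>s. f s * v s) \<in> borel_measurable borel" using bounded_borel_measurable[OF v] f by auto
    show "\<bar>f s * v s\<bar> \<le> \<bar>B\<bar> * C" for s
    proof (cases "s \<in> {a<..<b}")
      case True
      then show ?thesis unfolding abs_mult using f(2)[OF True] C by (intro mult_mono) auto
    next
      case False
      then show ?thesis using bounded_borel_zero[OF v False] C by simp
    qed
    show "f s * v s = 0" if "s \<notin> {a<..<b}" for s using bounded_borel_zero[OF v that] by simp
  qed
qed

lemma bounded_borel_indicator: "A \<in> sets borel \<Longrightarrow> indicator (A \<inter> {a<..<b}) \<in> bounded_borel a b"
  by (rule bounded_borelI[of _ 1]) (auto split: split_indicator)

lemma bounded_borel_restrict: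
  assumes "f \<in> borel_measurable borel" "\<And>s. s \<in> {a<..<b} \<Longrightarrow> \<bar>f s\<bar> \<le> B"
  shows "(\<lambda>s. indicator {a<..<b} s * f s) \<in> bounded_borel a b"
proof -
  have "(\<lambda>s. f s * indicator (UNIV \<inter> {a<..<b}) s) \<in> bounded_borel a b"
    by (rule bounded_borel_mult[OF bounded_borel_indicator assms]) auto
  then show ?thesis by (simp add: mult.commute)
qed

lemma prim_full:
  assumes "\<And>s. s \<notin> {a<..<b} \<Longrightarrow> f s = 0"
  shows "b \<le> r \<Longrightarrow> prim f r = (LBINT s. f s)" "r \<le> a \<Longrightarrow> prim f r = 0"
proof -
  show "prim f r = (LBINT s. f s)" if "b \<le> r"
    unfolding prim_def by (intro Bochner_Integration.integral_cong) (use assms that in \<open>auto split: split_indicator\<close>)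
  have "prim f r = (\<integral>s. 0 \<partial>(lborel :: real measure))" if "r \<le> a"
    unfolding prim_def by (intro Bochner_Integration.integral_cong) (use assms that in \<open>auto split: split_indicator\<close>)
  then show "prim f r = 0" if "r \<le> a" using that by simp
qed

section \<open>Test functions\<close>

lemma Cc1_onI:
  assumes D: "\<And>s. (h has_real_derivative D s) (at s)" "continuous_on UNIV D"
    and supp: "\<And>s. s \<notin> {c..d} \<Longrightarrow> h s = 0" and "a < c" "d < b"
  shows "h \<in> Cc1_on {a<..<b}" "deriv h = D"
proof -
  have "closure {s. h s \<noteq> 0} \<subseteq> {c..d}"
    by (intro closure_minimal) (use supp in \<open>blast, auto\<close>)
  moreover have "compact (closure {s. h s \<noteq> 0})"
    using calculation by (metis bounded_closed_interval bounded_subset closed_closure compact_eq_bounded_closed)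
  moreover have "h C1_differentiable_on {a<..<b}"
    unfolding C1_differentiable_on_def
    using D(1) continuous_on_subset[OF D(2) subset_UNIV, of "{a<..<b}"]
    by (auto simp: has_real_derivative_iff_has_vector_derivative intro!: exI[of _ D])
  ultimately show "h \<in> Cc1_on {a<..<b}"
    unfolding Cc1_on_def using assms(4,5) by auto
  show "deriv h = D" using D(1) DERIV_imp_deriv by blast
qed

text \<open>
  A test function is differentiable on the whole line, since it vanishes on the complement of its closed support,
  which together with the interval covers the line.
\<close>
lemma Cc1_onE:
  assumes h: "h \<in> Cc1_on {a<..<b}" and ab: "a < b"
  obtains c d where "a < c" "c \<le> d" "d < b" "\<And>s. s \<notin> {c..d} \<Longrightarrow> h s = 0"
    "\<And>s. (h has_real_derivative deriv h s) (at s)" "continuous_on UNIV (deriv h)"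
proof -
  define K where "K = closure {s. h s \<noteq> 0}"
  have K: "compact K" "K \<subseteq> {a<..<b}" using h by (simp_all add: Cc1_on_def K_def)
  have Kc: "closed K" by (simp add: K_def)
  have "h C1_differentiable_on {a<..<b}" using h by (simp add: Cc1_on_def)
  then obtain D where "\<forall>s\<in>{a<..<b}. (h has_vector_derivative D s) (at s)" and D2: "continuous_on {a<..<b} D"
    unfolding C1_differentiable_on_def by (elim exE conjE)
  then have D: "(h has_real_derivative D s) (at s)" if "s \<in> {a<..<b}" for s
    using that by (simp add: has_real_derivative_iff_has_vector_derivative)
  have z: "h s = 0" if "s \<notin> K" for s using that closure_subset[of "{s. h s \<noteq> 0}"] unfolding K_def by blast
  have out: "(h has_real_derivative 0) (at s)" if "s \<in> - K" for s
  proof (rule has_field_derivative_transform_within_open[OF DERIV_const])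
    show "open (- K)" by (rule open_Compl[OF Kc])
    show "s \<in> - K" by (rule that)
    show "0 = h r" if "r \<in> - K" for r using z[of r] that by simp
  qed
  have dD: "deriv h s = D s" if "s \<in> {a<..<b}" for s using D[OF that] by (rule DERIV_imp_deriv)
  have d0: "deriv h s = 0" if "s \<in> - K" for s using out[OF that] by (rule DERIV_imp_deriv)
  have der: "(h has_real_derivative deriv h s) (at s)" for s
    using D[of s] dD[of s] out[of s] d0[of s] K(2) by (cases "s \<in> K") (simp_all add: subset_iff)
  have "continuous_on {a<..<b} (deriv h)" by (rule iffD2[OF continuous_on_cong[OF refl dD] D2])
  moreover have "continuous_on (- K) (deriv h)" by (rule iffD2[OF continuous_on_cong[OF refl d0] continuous_on_const])
  ultimately have "continuous_on ({a<..<b} \<union> - K) (deriv h)"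
    by (intro continuous_on_open_Un open_Compl Kc open_greaterThanLessThan)
  moreover have "{a<..<b} \<union> - K = UNIV" using K(2) by blast
  ultimately have cont: "continuous_on UNIV (deriv h)" by simp
  show ?thesis
  proof (cases "K = {}")
    case True
    then show ?thesis using that[of "(a + b) / 2" "(a + b) / 2"] z der cont ab by simp
  next
    case False
    obtain c where c: "c \<in> K" "\<And>s. s \<in> K \<Longrightarrow> c \<le> s" using compact_attains_inf[OF K(1) False] by blast
    obtain d where d: "d \<in> K" "\<And>s. s \<in> K \<Longrightarrow> s \<le> d" using compact_attains_sup[OF K(1) False] by blast
    show ?thesis
    proof (rule that[of c d])
      show "a < c" "d < b" using subsetD[OF K(2) c(1)] subsetD[OF K(2) d(1)] by simp_all
      show "c \<le> d" by (rule c(2)[OF d(1)])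
      show "h s = 0" if "s \<notin> {c..d}" for s
      proof (rule z)
        show "s \<notin> K" using that c(2)[of s] d(2)[of s] by (simp only: atLeastAtMost_iff) blast
      qed
    qed (fact der cont)+
  qed
qed

lemma Cc1_on_derivative:
  assumes "h \<in> Cc1_on {a<..<b}" "a < b"
  shows "(h has_real_derivative deriv h s) (at s)"
  by (rule Cc1_onE[OF assms])

lemma Cc1_on_bounded_borel:
  assumes h: "h \<in> Cc1_on {a<..<b}" and ab: "a < b"
  shows "h \<in> bounded_borel a b" "deriv h \<in> bounded_borel a b"
    "continuous_on UNIV h" "continuous_on UNIV (deriv h)"
proof -
  obtain c d where cd: "a < c" "c \<le> d" "d < b" "\<And>s. s \<notin> {c..d} \<Longrightarrow> h s = 0"
    and der: "\<And>s. (h has_real_derivative deriv h s) (at s)" and cont: "continuous_on UNIV (deriv h)"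
    by (rule Cc1_onE[OF h ab]) (rule that)
  have hc: "continuous_on UNIV h" using der by (meson DERIV_isCont continuous_at_imp_continuous_on)
  have dz: "deriv h s = 0" if "s \<notin> {c..d}" for s
  proof -
    have "(h has_real_derivative 0) (at s)"
    proof (rule has_field_derivative_transform_within_open[OF DERIV_const])
      show "open (- {c..d})" by (rule open_Compl[OF closed_atLeastAtMost])
      show "s \<in> - {c..d}" using that by simp
      show "0 = h r" if "r \<in> - {c..d}" for r using cd(4)[of r] that by simp
    qed
    then show ?thesis by (rule DERIV_imp_deriv)
  qed
  have *: "f \<in> bounded_borel a b" if f: "continuous_on UNIV f" and z: "\<And>s. s \<notin> {c..d} \<Longrightarrow> f s = 0" for f :: "real \<Rightarrow> real"
  proof -
    have "bounded (f ` {c..d})" using f by (intro compact_imp_bounded compact_continuous_image continuous_on_subset[OF f]) auto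
    then obtain B where "\<forall>y\<in>f ` {c..d}. norm y \<le> B" unfolding bounded_iff by blast
    then have B: "\<bar>f s\<bar> \<le> B" if "s \<in> {c..d}" for s using that by auto
    show ?thesis
    proof (rule bounded_borelI[of _ "\<bar>B\<bar>"])
      show "\<bar>f s\<bar> \<le> \<bar>B\<bar>" for s using B[of s] z[of s] by (cases "s \<in> {c..d}") auto
      show "f s = 0" if "s \<notin> {a<..<b}" for s using z[of s] that cd by auto
    qed (use f in \<open>auto intro: borel_measurable_continuous_onI\<close>)
  qed
  show "h \<in> bounded_borel a b" by (rule *[OF hc cd(4)])
  show "deriv h \<in> bounded_borel a b" by (rule *[OF cont dz])
  show "continuous_on UNIV h" "continuous_on UNIV (deriv h)" by fact+
qed

lemma Cc1_on_lincomb: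
  assumes h: "h \<in> Cc1_on {a<..<b}" and g: "g \<in> Cc1_on {a<..<b}" and ab: "a < b"
  shows "(\<lambda>s. h s + t * g s) \<in> Cc1_on {a<..<b}" "deriv (\<lambda>s. h s + t * g s) = (\<lambda>s. deriv h s + t * deriv g s)"
proof -
  obtain c d where 1: "a < c" "c \<le> d" "d < b" "\<And>s. s \<notin> {c..d} \<Longrightarrow> h s = 0"
    "\<And>s. (h has_real_derivative deriv h s) (at s)" "continuous_on UNIV (deriv h)"
    by (rule Cc1_onE[OF h ab]) (rule that)
  obtain c' d' where 2: "a < c'" "c' \<le> d'" "d' < b" "\<And>s. s \<notin> {c'..d'} \<Longrightarrow> g s = 0"
    "\<And>s. (g has_real_derivative deriv g s) (at s)" "continuous_on UNIV (deriv g)"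
    by (rule Cc1_onE[OF g ab]) (rule that)
  have D: "((\<lambda>s. h s + t * g s) has_real_derivative deriv h s + t * deriv g s) (at s)" for s
    by (intro derivative_intros 1 2 DERIV_cmult)
  have C: "continuous_on UNIV (\<lambda>s. deriv h s + t * deriv g s)" by (intro continuous_intros 1 2)
  have Z: "h s + t * g s = 0" if "s \<notin> {min c c'..max d d'}" for s using 1(4)[of s] 2(4)[of s] that by (auto simp: min_def max_def split: if_splits)
  show "(\<lambda>s. h s + t * g s) \<in> Cc1_on {a<..<b}" "deriv (\<lambda>s. h s + t * g s) = (\<lambda>s. deriv h s + t * deriv g s)"
  proof -
    have "a < min c c'" "max d d' < b" using 1 2 by auto
    note Cc1_onI[OF D C Z this]
    then show "(\<lambda>s. h s + t * g s) \<in> Cc1_on {a<..<b}" "deriv (\<lambda>s. h s + t * g s) = (\<lambda>s. deriv h s + t * deriv g s)" by blast+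
  qed
qed

lemma Cc1_on_avg:
  assumes v: "continuous_on UNIV v" "\<And>s. s \<notin> {c..d} \<Longrightarrow> v s = 0"
    and \<delta>: "0 < \<delta>" "a < c - \<delta>" "d < b"
  shows "integrable lborel v" "avg \<delta> v \<in> Cc1_on {a<..<b}" "deriv (avg \<delta> v) = (\<lambda>s. (v (s + \<delta>) - v s) / \<delta>)"
    "\<And>s. s \<notin> {c - \<delta>..d} \<Longrightarrow> avg \<delta> v s = 0"
proof -
  have "compact (v ` {c..d})" by (intro compact_continuous_image continuous_on_subset[OF v(1)]) auto
  then obtain B where "\<forall>y\<in>v ` {c..d}. norm y \<le> B"
    using compact_imp_bounded[of "v ` {c..d}"] unfolding bounded_iff by blast
  then have "\<bar>v s\<bar> \<le> B" if "s \<in> {c..d}" for s using that by auto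
  then have B: "\<bar>v s\<bar> \<le> \<bar>B\<bar>" for s using v(2)[of s] by (cases "s \<in> {c..d}") force+
  show i: "integrable lborel v"
    by (rule integrable_bounded_interval[OF _ B v(2)]) (use v(1) in \<open>auto intro: borel_measurable_continuous_onI\<close>)
  have der: "(prim v has_real_derivative v s) (at s)" for s
    by (rule prim_has_derivative[OF i]) (use v(1) in \<open>simp add: continuous_on_eq_continuous_at\<close>)
  have D: "(avg \<delta> v has_real_derivative (v (s + \<delta>) - v s) / \<delta>) (at s)" for s
  proof -
    have "((\<lambda>s. prim v (s + \<delta>)) has_real_derivative v (s + \<delta>)) (at s)"
      using der[of "s + \<delta>"] by (simp add: DERIV_shift)
    then show ?thesis unfolding avg_def[abs_def] using der[of s] by (intro DERIV_cdivide DERIV_diff)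
  qed
  have C: "continuous_on UNIV (\<lambda>s. (v (s + \<delta>) - v s) / \<delta>)"
    using \<delta> by (intro continuous_intros v(1) continuous_on_compose2[OF v(1)]) auto
  show Z: "avg \<delta> v s = 0" if "s \<notin> {c - \<delta>..d}" for s
  proof -
    have "\<bar>avg \<delta> v s\<bar> \<le> 0" by (rule avg_bound[OF i \<delta>(1)]) (use that v(2) in auto)
    then show ?thesis by simp
  qed
  show "avg \<delta> v \<in> Cc1_on {a<..<b}" "deriv (avg \<delta> v) = (\<lambda>s. (v (s + \<delta>) - v s) / \<delta>)"
    using Cc1_onI[OF D C Z \<delta>(2,3)] by auto
qed

section \<open>Integration by parts for bounded functionals\<close>

text \<open>
  A linear functional on bounded functions that is bounded in the \<open>L\<^sup>1\<close> norm. The potential takes the role of a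
  primitive of its bounded density, and being defined by values of the functional it needs no representation
  theorem. That constants are annihilated says that the potential vanishes at \<open>b\<close>.
\<close>
locale bounded_functional =
  fixes a b :: real and l :: "(real \<Rightarrow> real) \<Rightarrow> real" and M :: real
  assumes ab: "a < b"
    and add: "\<And>v w. v \<in> bounded_borel a b \<Longrightarrow> w \<in> bounded_borel a b \<Longrightarrow> l (v + w) = l v + l w"
    and scale: "\<And>c v. v \<in> bounded_borel a b \<Longrightarrow> l (c *\<^sub>R v) = c * l v"
    and bound: "\<And>v. v \<in> bounded_borel a b \<Longrightarrow> \<bar>l v\<bar> \<le> M * (LBINT s. \<bar>v s\<bar>)"
    and M_nonneg: "0 \<le> M"
    and constants: "l (indicator {a<..<b}) = 0"
begin

definition potential :: "real \<Rightarrow> real" where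
  "potential s = l (indicator ({..s} \<inter> {a<..<b}))"

lemma diff: "v \<in> bounded_borel a b \<Longrightarrow> w \<in> bounded_borel a b \<Longrightarrow> l (v - w) = l v - l w"
  using add[of v "(-1) *\<^sub>R w"] scale[of w "-1"] subspace_scale[OF subspace_bounded_borel, of w a b "-1"] by simp

lemma zero: "l 0 = 0"
  using scale[OF subspace_0[OF subspace_bounded_borel], of 0] by simp

lemma bound_sup:
  assumes v: "v \<in> bounded_borel a b" and st: "s \<le> t"
    and "\<And>r. \<bar>v r\<bar> \<le> B * indicator {s<..t} r"
  shows "\<bar>l v\<bar> \<le> M * (B * (t - s))"
proof -
  have "(LBINT r. \<bar>v r\<bar>) \<le> (LBINT r. B * indicator {s<..t} r)"
    using bounded_borel_integrable[OF v] assms(3) by (intro integral_mono) auto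
  also have "\<dots> = B * (t - s)" using st by simp
  finally show ?thesis using bound[OF v] M_nonneg by (meson mult_left_mono order_trans)
qed

lemma potential_diff:
  assumes "s \<le> t"
  shows "potential t - potential s = l (indicator ({s<..t} \<inter> {a<..<b}))"
proof -
  have "indicator ({s<..t} \<inter> {a<..<b}) = indicator ({..t} \<inter> {a<..<b}) - (indicator ({..s} \<inter> {a<..<b}) :: real \<Rightarrow> real)"
    using assms by (auto simp: fun_eq_iff split: split_indicator)
  then show ?thesis unfolding potential_def by (simp add: diff bounded_borel_indicator)
qed

lemma potential_lipschitz: "\<bar>potential t - potential s\<bar> \<le> M * \<bar>t - s\<bar>"
proof (induction s t rule: linorder_wlog)
  case (le s t)
  have "\<bar>l (indicator ({s<..t} \<inter> {a<..<b}))\<bar> \<le> M * (1 * (t - s))"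
    by (rule bound_sup[OF bounded_borel_indicator le]) (auto split: split_indicator)
  then show ?case using le by (simp add: potential_diff)
next
  case (sym s t)
  then show ?case by (simp add: abs_minus_commute)
qed

lemma potential_outside: "s \<notin> {a<..<b} \<Longrightarrow> potential s = 0"
proof -
  assume "s \<notin> {a<..<b}"
  then consider "s \<le> a" | "b \<le> s" by fastforce
  then show ?thesis
  proof cases
    case 1
    then have "indicator ({..s} \<inter> {a<..<b}) = (0 :: real \<Rightarrow> real)" by (auto simp: fun_eq_iff split: split_indicator)
    then show ?thesis unfolding potential_def using zero by simp
  next
    case 2
    then have "{..s} \<inter> {a<..<b} = {a<..<b}" by auto
    then show ?thesis unfolding potential_def using constants by simp
  qed
qed

lemma potential_continuous: "continuous_on UNIV potential"
proof (rule lipschitz_on_continuous_on)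
  show "M-lipschitz_on UNIV potential"
    using potential_lipschitz M_nonneg by (intro lipschitz_onI) (auto simp: dist_real_def)
qed

lemma potential_measurable [measurable]: "potential \<in> borel_measurable borel"
  using potential_continuous by (rule borel_measurable_continuous_onI)

lemma potential_bounded_borel: "potential \<in> bounded_borel a b"
proof (rule bounded_borelI[of _ "M * (b - a)"])
  show "\<bar>potential s\<bar> \<le> M * (b - a)" for s
  proof (cases "s \<in> {a<..<b}")
    case True
    have "\<bar>potential s\<bar> \<le> M * \<bar>s - a\<bar>" using potential_lipschitz[of s a] potential_outside[of a] by simp
    also have "\<dots> \<le> M * (b - a)" using True M_nonneg by (intro mult_left_mono) auto
    finally show ?thesis .
  qed (use potential_outside M_nonneg ab in auto)
qed (use potential_outside in auto)

text \<open>
  With \<open>V = c + prim \<xi>\<close>, the defect \<open>\<Psi>\<close> in the formula of partial integration over the part of the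
  interval to the left of \<open>s\<close> changes by at most a multiple of \<open>(t - s)\<^sup>2\<close> between \<open>s\<close> and \<open>t\<close>, so it is
  constant, and it vanishes at \<open>a\<close>.
\<close>
theorem integration_by_parts:
  assumes \<xi>: "\<xi> \<in> bounded_borel a b"
  shows "(\<lambda>s. indicator {a<..<b} s * (c + prim \<xi> s)) \<in> bounded_borel a b"
    "l (\<lambda>s. indicator {a<..<b} s * (c + prim \<xi> s)) = - (LBINT s. potential s * \<xi> s)"
proof -
  obtain R where R: "R \<ge> 0" "\<And>s. \<bar>\<xi> s\<bar> \<le> R" using bounded_borel_bound[OF \<xi>] by blast
  define V where "V s = c + prim \<xi> s" for s
  have \<xi>i: "integrable lborel \<xi>" by (rule bounded_borel_integrable[OF \<xi>])
  have Vlip: "\<bar>V t - V s\<bar> \<le> R * \<bar>t - s\<bar>" for s t using prim_lipschitz[OF \<xi>i R(2)] by (simp add: V_def)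
  have [measurable]: "V \<in> borel_measurable borel"
    unfolding V_def using prim_measurable[OF bounded_borel_measurable[OF \<xi>]] by measurable
  have Va: "V a = c" using prim_full(2)[of a b \<xi> a] bounded_borel_zero[OF \<xi>] by (simp add: V_def)
  have VB: "\<bar>V s\<bar> \<le> \<bar>c\<bar> + R * (b - a)" if "s \<in> {a<..<b}" for s
  proof -
    have "\<bar>V s - V a\<bar> \<le> R * \<bar>s - a\<bar>" by (rule Vlip)
    also have "\<dots> \<le> R * (b - a)" using that R(1) by (intro mult_left_mono) auto
    finally show ?thesis using Va by linarith
  qed
  have inE: "(\<lambda>s. V s * indicator (A \<inter> {a<..<b}) s) \<in> bounded_borel a b" if "A \<in> sets borel" for A
    by (rule bounded_borel_mult[OF bounded_borel_indicator[OF that]]) (use VB in auto)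
  have x\<xi>: "(\<lambda>s. potential s * \<xi> s) \<in> bounded_borel a b"
    using bounded_borel_bound[OF potential_bounded_borel] by (auto intro!: bounded_borel_mult[OF \<xi>])
  have x\<xi>i: "integrable lborel (\<lambda>s. potential s * \<xi> s)" by (rule bounded_borel_integrable[OF x\<xi>])
  define \<Psi> where "\<Psi> s = l (\<lambda>r. V r * indicator ({..s} \<inter> {a<..<b}) r) - V s * potential s
      + prim (\<lambda>s. potential s * \<xi> s) s" for s
  have step: "\<bar>\<Psi> t - \<Psi> s\<bar> \<le> (2 * M * R) * (t - s)\<^sup>2" if st: "s \<le> t" for s t
  proof -
    let ?J = "{s<..t} \<inter> {a<..<b}"
    have I: "l (\<lambda>r. V r * indicator ({..t} \<inter> {a<..<b}) r) - l (\<lambda>r. V r * indicator ({..s} \<inter> {a<..<b}) r)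
        = l (\<lambda>r. V r * indicator ?J r)"
    proof -
      have "(\<lambda>r. V r * indicator ?J r) = (\<lambda>r. V r * indicator ({..t} \<inter> {a<..<b}) r) - (\<lambda>r. V r * indicator ({..s} \<inter> {a<..<b}) r)"
        using st by (auto simp: fun_eq_iff split: split_indicator)
      then show ?thesis by (simp add: diff inE)
    qed
    \<comment> \<open>Subtracting the constant \<open>V t\<close> makes the integrand small on the short interval \<open>?J\<close>.\<close>
    define w where "w = (\<lambda>r. V r * indicator ?J r) - V t *\<^sub>R indicator ?J"
    have c1: "(\<lambda>r. V r * indicator ?J r) \<in> bounded_borel a b" by (rule inE) simp
    have c2: "indicator ?J \<in> bounded_borel a b" by (rule bounded_borel_indicator) simp
    have c3: "V t *\<^sub>R indicator ?J \<in> bounded_borel a b" by (rule subspace_scale[OF subspace_bounded_borel c2])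
    have wE: "w \<in> bounded_borel a b" unfolding w_def by (rule subspace_diff[OF subspace_bounded_borel c1 c3])
    have lw: "l w = l (\<lambda>r. V r * indicator ?J r) - V t * (potential t - potential s)"
      unfolding w_def diff[OF c1 c3] scale[OF c2] potential_diff[OF st] ..
    have w_le: "\<bar>l w\<bar> \<le> M * ((R * (t - s)) * (t - s))"
    proof (rule bound_sup[OF wE st])
      fix r show "\<bar>w r\<bar> \<le> R * (t - s) * indicator {s<..t} r"
      proof (cases "r \<in> ?J")
        case True
        have "\<bar>V r - V t\<bar> \<le> R * \<bar>r - t\<bar>" by (rule Vlip)
        also have "\<dots> \<le> R * (t - s)" using True R(1) by (intro mult_left_mono) auto
        finally show ?thesis using True by (simp add: w_def scaleR_fun_def)
      qed (use R(1) st in \<open>auto simp: w_def scaleR_fun_def split: split_indicator\<close>)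
    qed
    have p1: "V t - V s = (LBINT r. indicator {s<..t} r * \<xi> r)"
      unfolding V_def using prim_diff[OF \<xi>i st] by simp
    have p2: "prim (\<lambda>s. potential s * \<xi> s) t - prim (\<lambda>s. potential s * \<xi> s) s
        = (LBINT r. indicator {s<..t} r * (potential r * \<xi> r))"
      by (rule prim_diff[OF x\<xi>i st])
    have zi: "integrable lborel (\<lambda>r. (potential r - potential s) * \<xi> r)"
      using integrable_mult_right[OF \<xi>i, of "potential s"] x\<xi>i by (simp add: left_diff_distrib)
    have "(LBINT r. indicator {s<..t} r * (potential r * \<xi> r)) - potential s * (LBINT r. indicator {s<..t} r * \<xi> r)
        = (LBINT r. indicator {s<..t} r * (potential r * \<xi> r) - potential s * (indicator {s<..t} r * \<xi> r))"
      by (subst Bochner_Integration.integral_diff)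
        (auto intro!: integrable_mult_right integrable_indicator_mult x\<xi>i \<xi>i)
    also have "\<dots> = (LBINT r. indicator {s<..t} r * ((potential r - potential s) * \<xi> r))"
      by (intro Bochner_Integration.integral_cong) (auto simp: algebra_simps)
    finally have p3: "(LBINT r. indicator {s<..t} r * (potential r * \<xi> r)) - potential s * (LBINT r. indicator {s<..t} r * \<xi> r)
        = (LBINT r. indicator {s<..t} r * ((potential r - potential s) * \<xi> r))" .
    have z_le: "\<bar>LBINT r. indicator {s<..t} r * ((potential r - potential s) * \<xi> r)\<bar> \<le> (M * (t - s) * R) * (t - s)"
    proof (rule integral_indicator_bound[OF zi st])
      fix r assume r: "s < r" "r \<le> t"
      have "\<bar>potential r - potential s\<bar> \<le> M * \<bar>r - s\<bar>" by (rule potential_lipschitz)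
      also have "\<dots> \<le> M * (t - s)" using r M_nonneg by (intro mult_left_mono) auto
      finally show "\<bar>(potential r - potential s) * \<xi> r\<bar> \<le> M * (t - s) * R"
        unfolding abs_mult using R M_nonneg st by (intro mult_mono) auto
    qed
    have "\<Psi> t - \<Psi> s = l w + ((LBINT r. indicator {s<..t} r * (potential r * \<xi> r))
        - potential s * (LBINT r. indicator {s<..t} r * \<xi> r))"
      unfolding \<Psi>_def lw p1[symmetric] using I p2 by (simp add: algebra_simps)
    then have "\<bar>\<Psi> t - \<Psi> s\<bar> \<le> M * ((R * (t - s)) * (t - s)) + (M * (t - s) * R) * (t - s)"
      unfolding p3 using w_le z_le by linarith
    also have "\<dots> = (2 * M * R) * (t - s)\<^sup>2" by (simp add: power2_eq_square algebra_simps)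
    finally show ?thesis .
  qed
  have step': "\<bar>\<Psi> t - \<Psi> s\<bar> \<le> (2 * M * R) * (t - s)\<^sup>2" for s t
    using step[of s t] step[of t s] by (cases "s \<le> t") (simp_all add: abs_minus_commute power2_commute)
  have "(\<Psi> has_real_derivative 0) (at s)" for s
    unfolding has_field_derivative_iff
  proof (rule Lim_null_comparison)
    show "\<forall>\<^sub>F t in at s. norm ((\<Psi> t - \<Psi> s) / (t - s)) \<le> (2 * M * R) * \<bar>t - s\<bar>"
    proof (rule eventually_at_filter[THEN iffD2], rule always_eventually, intro allI impI)
      fix t assume "t \<noteq> s"
      then show "norm ((\<Psi> t - \<Psi> s) / (t - s)) \<le> (2 * M * R) * \<bar>t - s\<bar>"
        using step'[of t s] by (simp add: abs_divide pos_divide_le_eq power2_eq_square flip: abs_mult)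
    qed
    have "((\<lambda>t. (2 * M * R) * \<bar>t - s\<bar>) \<longlongrightarrow> (2 * M * R) * \<bar>s - s\<bar>) (at s)" by (intro tendsto_intros)
    then show "((\<lambda>t. (2 * M * R) * \<bar>t - s\<bar>) \<longlongrightarrow> 0) (at s)" by simp
  qed
  then have const: "\<Psi> a = \<Psi> b" using DERIV_isconst_all by blast
  have z: "(\<lambda>r. V r * indicator ({..a} \<inter> {a<..<b}) r) = 0" by (auto simp: fun_eq_iff split: split_indicator)
  have "\<Psi> a = 0"
    unfolding \<Psi>_def z using zero potential_outside[of a] prim_full(2)[of a b "\<lambda>s. potential s * \<xi> s" a] bounded_borel_zero[OF x\<xi>]
    by simp
  moreover have "\<Psi> b = l (\<lambda>s. indicator {a<..<b} s * (c + prim \<xi> s)) + (LBINT s. potential s * \<xi> s)"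
  proof -
    have "(\<lambda>r. V r * indicator ({..b} \<inter> {a<..<b}) r) = (\<lambda>s. indicator {a<..<b} s * (c + prim \<xi> s))"
      by (auto simp: fun_eq_iff V_def split: split_indicator)
    moreover have "prim (\<lambda>s. potential s * \<xi> s) b = (LBINT s. potential s * \<xi> s)"
      by (rule prim_full(1)[of a b]) (use bounded_borel_zero[OF x\<xi>] in auto)
    ultimately show ?thesis unfolding \<Psi>_def using potential_outside[of b] by simp
  qed
  ultimately show "l (\<lambda>s. indicator {a<..<b} s * (c + prim \<xi> s)) = - (LBINT s. potential s * \<xi> s)"
    using const by simp
  have "(\<lambda>s. indicator {a<..<b} s * (c + prim \<xi> s)) = (\<lambda>s. V s * indicator (UNIV \<inter> {a<..<b}) s)"
    by (auto simp: V_def)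
  then show "(\<lambda>s. indicator {a<..<b} s * (c + prim \<xi> s)) \<in> bounded_borel a b" using inE[of UNIV] by simp
qed

end

text \<open>
  Integration against \<open>deriv h\<close> is a bounded functional whose potential is \<open>h\<close>.
\<close>
lemma test_function_by_parts:
  assumes h: "h \<in> Cc1_on {a<..<b}" and ab: "a < b" and \<xi>: "\<xi> \<in> bounded_borel a b"
  shows "(LBINT s. (indicator {a<..<b} s * (c + prim \<xi> s)) * deriv h s) = - (LBINT s. h s * \<xi> s)"
proof -
  note hb = Cc1_on_bounded_borel[OF h ab]
  obtain B where B: "B \<ge> 0" "\<And>s. \<bar>deriv h s\<bar> \<le> B" using bounded_borel_bound[OF hb(2)] by blast
  have hi: "integrable lborel (deriv h)" by (rule bounded_borel_integrable[OF hb(2)])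
  have mi: "integrable lborel (\<lambda>s. v s * deriv h s)" if "v \<in> bounded_borel a b" for v
    using bounded_borel_integrable[OF bounded_borel_mult[OF that bounded_borel_measurable[OF hb(2)], of B]] B
    by (simp add: mult.commute)
  have prim_h: "prim (deriv h) s = h s" for s
  proof -
    have "((\<lambda>s. prim (deriv h) s - h s) has_real_derivative deriv h s - deriv h s) (at s)" for s
    proof (intro DERIV_diff prim_has_derivative[OF hi])
      show "isCont (deriv h) s" using hb(4) by (simp add: continuous_on_eq_continuous_at)
      show "(h has_real_derivative deriv h s) (at s)" by (rule Cc1_on_derivative[OF h ab])
    qed
    then have "prim (deriv h) s - h s = prim (deriv h) a - h a" using DERIV_isconst_all by force
    moreover have "prim (deriv h) a = 0" by (rule prim_full(2)[of a b]) (use bounded_borel_zero[OF hb(2)] in auto)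
    moreover have "h a = 0" using bounded_borel_zero[OF hb(1)] by auto
    ultimately show ?thesis by simp
  qed
  interpret bounded_functional a b "\<lambda>v. LBINT s. v s * deriv h s" B
  proof
    fix v assume v: "v \<in> bounded_borel a b"
    have "\<bar>LBINT s. v s * deriv h s\<bar> \<le> (LBINT s. \<bar>v s * deriv h s\<bar>)" by (rule integral_abs_bound)
    also have "\<dots> \<le> (LBINT s. B * \<bar>v s\<bar>)"
    proof (intro integral_mono)
      show "\<bar>v s * deriv h s\<bar> \<le> B * \<bar>v s\<bar>" for s
        unfolding abs_mult using B(2)[of s] by (subst mult.commute) (intro mult_right_mono; simp)
    qed (use mi[OF v] bounded_borel_integrable[OF v] in auto)
    finally show "\<bar>LBINT s. v s * deriv h s\<bar> \<le> B * (LBINT s. \<bar>v s\<bar>)" by simp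
  next
    fix v w assume "v \<in> bounded_borel a b" "w \<in> bounded_borel a b"
    then show "(LBINT s. (v + w) s * deriv h s) = (LBINT s. v s * deriv h s) + (LBINT s. w s * deriv h s)"
      using mi by (simp add: distrib_right)
  next
    have "(LBINT s. indicator {a<..<b} s * deriv h s) = (LBINT s. deriv h s)"
      using bounded_borel_zero[OF hb(2)] by (intro Bochner_Integration.integral_cong) (auto split: split_indicator)
    also have "\<dots> = prim (deriv h) b" by (rule prim_full(1)[symmetric, of a b]) (use bounded_borel_zero[OF hb(2)] in auto)
    also have "\<dots> = 0" using prim_h[of b] bounded_borel_zero[OF hb(1), of b] by simp
    finally show "(LBINT s. indicator {a<..<b} s * deriv h s) = 0" .
  qed (use B ab in \<open>auto simp: scaleR_fun_def mult.assoc\<close>)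
  have "potential s = h s" for s
  proof -
    have "potential s = prim (deriv h) s"
      unfolding potential_def prim_def using bounded_borel_zero[OF hb(2)]
      by (intro Bochner_Integration.integral_cong) (auto split: split_indicator)
    then show ?thesis using prim_h by simp
  qed
  then show ?thesis using integration_by_parts(2)[OF \<xi>, of c] by simp
qed

section \<open>Pointwise bounds from test functions\<close>

lemma integral_lebesgue_on:
  fixes f :: "real \<Rightarrow> real"
  assumes f: "f \<in> borel_measurable borel" and z: "\<And>s. s \<notin> {a<..<b} \<Longrightarrow> f s = 0"
  shows "(\<integral>s. f s \<partial>lebesgue_on {a<..<b}) = (LBINT s. f s)"
proof -
  have "(\<integral>s. f s \<partial>lebesgue_on {a<..<b}) = (\<integral>s. indicator {a<..<b} s *\<^sub>R f s \<partial>lebesgue)"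
    by (rule integral_restrict_space) simp
  also have "(\<lambda>s. indicator {a<..<b} s *\<^sub>R f s) = f" using z by (auto simp: fun_eq_iff split: split_indicator)
  also have "(\<integral>s. f s \<partial>lebesgue) = (LBINT s. f s)" by (rule integral_completion) (use f in simp)
  finally show ?thesis .
qed

lemma measurable_lebesgue_on:
  fixes f :: "real \<Rightarrow> 'b::topological_space"
  shows "f \<in> borel_measurable borel \<Longrightarrow> f \<in> borel_measurable (lebesgue_on S)"
  by (intro measurable_restrict_space1 measurable_completion) simp

text \<open>
  The set where \<open>f\<close> exceeds \<open>c\<close> is open and negligible, hence empty.
\<close>
lemma AE_le_continuous:
  fixes f :: "real \<Rightarrow> real"
  assumes ae: "AE s in lebesgue_on {a<..<b}. f s \<le> c" and f: "continuous_on UNIV f" and s: "s \<in> {a<..<b}"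
  shows "f s \<le> c"
proof -
  define S where "S = {a<..<b} \<inter> {s. c < f s}"
  have "open S" unfolding S_def by (intro open_Int open_Collect_less f continuous_on_const) auto
  have "AE s in lebesgue. s \<in> {a<..<b} \<longrightarrow> f s \<le> c" using ae by (simp add: AE_restrict_space_iff)
  then have "AE s in lebesgue. s \<notin> S" by eventually_elim (auto simp: S_def)
  moreover have "S \<in> sets lebesgue" using \<open>open S\<close> by auto
  ultimately have "S \<in> null_sets lebesgue" by (simp add: AE_iff_null_sets)
  then have "negligible S" by (simp add: negligible_iff_null_sets)
  then have "S = {}" using open_not_negligible[OF \<open>open S\<close>] by blast
  then show ?thesis using s by (force simp: S_def)
qed

lemma integrable_mult_bounded:
  assumes u: "integrable lborel u" and w: "w \<in> bounded_borel a b"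
  shows "integrable lborel (\<lambda>s. u s * w s)"
proof -
  have [measurable]: "u \<in> borel_measurable borel" "w \<in> borel_measurable borel"
    using u bounded_borel_measurable[OF w] by auto
  obtain B where B: "B \<ge> 0" "\<And>s. \<bar>w s\<bar> \<le> B" using bounded_borel_bound[OF w] by blast
  show ?thesis
  proof (rule Bochner_Integration.integrable_bound)
    show "integrable lborel (\<lambda>s. B * u s)" using u by simp
    show "AE s in lborel. norm (u s * w s) \<le> norm (B * u s)"
    proof (rule AE_I2)
      fix s show "norm (u s * w s) \<le> norm (B * u s)"
        using mult_right_mono[OF B(2)[of s], of "\<bar>u s\<bar>"] B(1) by (simp add: abs_mult mult.commute)
    qed
  qed measurable
qed

text \<open>
  Lower \<open>\<kappa>\<close> by a small amount, cut off near the end points and average over so short an interval that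
  the oscillation of \<open>\<kappa>\<close> does not exceed the amount by which it was lowered.
\<close>
lemma Cc1_approx_below:
  assumes ab: "a < b" and \<kappa>: "\<And>s. 0 \<le> \<kappa> s" "\<And>s t. \<bar>\<kappa> s - \<kappa> t\<bar> \<le> \<Lambda> * \<bar>s - t\<bar>" and e: "0 < e"
  obtains g where "g \<in> Cc1_on {a<..<b}" "\<And>s. 0 \<le> g s" "\<And>s. g s \<le> \<kappa> s"
    "(LBINT s. indicator {a<..<b} s * \<kappa> s) - e \<le> (LBINT s. g s)"
proof -
  have L0: "0 \<le> \<Lambda>" using order_trans[OF abs_ge_zero \<kappa>(2)[of 0 1]] by simp
  have cont: "continuous_on UNIV \<kappa>"
  proof (rule lipschitz_on_continuous_on)
    show "\<Lambda>-lipschitz_on UNIV \<kappa>" using \<kappa>(2) L0 by (intro lipschitz_onI) (auto simp: dist_real_def)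
  qed
  have \<kappa>m[measurable]: "\<kappa> \<in> borel_measurable borel" by (rule borel_measurable_continuous_onI[OF cont])
  define e1 where "e1 = e / (3 * (b - a))"
  have e1: "0 < e1" "e1 * (b - a) = e / 3" unfolding e1_def using e ab by (simp_all add: nonzero_divide_eq_eq)
  define C where "C = \<kappa> a + \<Lambda> * (b - a)"
  have C: "\<kappa> s \<le> C" if "s \<in> {a..b}" for s
  proof -
    have "\<Lambda> * \<bar>s - a\<bar> \<le> \<Lambda> * (b - a)" using that L0 by (intro mult_left_mono) auto
    then show ?thesis using \<kappa>(2)[of s a] unfolding C_def by linarith
  qed
  \<comment> \<open>It vanishes within distance \<open>1 / n\<close> of the end points and is \<open>1\<close> beyond distance \<open>2 / n\<close>.\<close>
  define cut where "cut n s = max 0 (min 1 (real n * min (s - a) (b - s) - 1))" for n s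
  define w where "w n s = max 0 (\<kappa> s - e1) * cut n s" for n s
  have cut: "0 \<le> cut n s" "cut n s \<le> 1" for n s by (auto simp: cut_def)
  have cut0: "cut n s = 0" if "s \<notin> {a + 1 / real n..b - 1 / real n}" "n > 0" for n s
  proof -
    have "min (s - a) (b - s) \<le> 1 / real n" using that by auto
    then have "real n * min (s - a) (b - s) \<le> real n * (1 / real n)" by (intro mult_left_mono) auto
    then show ?thesis using that(2) by (auto simp: cut_def)
  qed
  have wc: "continuous_on UNIV (w n)" for n
    unfolding w_def cut_def by (intro continuous_intros continuous_on_max continuous_on_min cont)
  have wm[measurable]: "w n \<in> borel_measurable borel" for n by (rule borel_measurable_continuous_onI[OF wc])
  have w0: "0 \<le> w n s" "w n s \<le> max 0 (\<kappa> s - e1)" for n s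
    using cut[of n s] mult_left_mono[of "cut n s" 1 "max 0 (\<kappa> s - e1)"] by (auto simp: w_def)
  have wz: "w n s = 0" if "s \<notin> {a + 1 / real n..b - 1 / real n}" "n > 0" for n s
    using cut0[OF that] by (simp add: w_def)
  define W where "W s = indicator {a<..<b} s * max 0 (\<kappa> s - e1)" for s
  have [measurable]: "W \<in> borel_measurable borel" unfolding W_def by measurable
  have W: "\<bar>W s\<bar> \<le> \<bar>C\<bar>" "s \<notin> {a..b} \<Longrightarrow> W s = 0" for s
    using C[of s] e1(1) by (auto simp: W_def split: split_indicator)
  have "(\<lambda>n. LBINT s. w (Suc n) s) \<longlonglongrightarrow> (LBINT s. W s)"
  proof (rule integral_dominated_convergence[where w="\<lambda>s. \<bar>C\<bar> * indicator {a..b} s"])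
    show "AE s in lborel. (\<lambda>n. w (Suc n) s) \<longlonglongrightarrow> W s"
    proof (rule AE_I2)
      fix s
      show "(\<lambda>n. w (Suc n) s) \<longlonglongrightarrow> W s"
      proof (cases "s \<in> {a<..<b}")
        case True
        define m where "m = min (s - a) (b - s)"
        have m: "m > 0" using True by (auto simp: m_def)
        obtain n0 :: nat where n0: "2 / m < real n0" using reals_Archimedean2 by blast
        have "w (Suc n) s = W s" if "n \<ge> n0" for n
        proof -
          have "2 / m < real (Suc n)" using n0 that by simp
          then have "2 < real (Suc n) * m" using m by (simp add: pos_divide_less_eq)
          then have "cut (Suc n) s = 1" unfolding cut_def m_def[symmetric] by simp
          then show ?thesis using True by (simp add: w_def W_def)
        qed
        then have "eventually (\<lambda>n. w (Suc n) s = W s) sequentially"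
          unfolding eventually_sequentially by blast
        then show ?thesis by (rule tendsto_eventually)
      next
        case False
        have "w (Suc n) s = 0" for n
        proof (rule wz)
          have "0 < 1 / real (Suc n)" by simp
          then show "s \<notin> {a + 1 / real (Suc n)..b - 1 / real (Suc n)}"
            using False unfolding atLeastAtMost_iff greaterThanLessThan_iff by linarith
        qed simp
        then show ?thesis using False by (simp add: W_def)
      qed
    qed
    show "AE s in lborel. norm (w (Suc n) s) \<le> \<bar>C\<bar> * indicator {a..b} s" for n
    proof (rule AE_I2)
      fix s
      show "norm (w (Suc n) s) \<le> \<bar>C\<bar> * indicator {a..b} s"
      proof (cases "s \<in> {a..b}")
        case True
        then show ?thesis using w0[of "Suc n" s] C[OF True] e1(1) by auto
      next
        case False
        have "0 < 1 / real (Suc n)" by simp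
        then have "s \<notin> {a + 1 / real (Suc n)..b - 1 / real (Suc n)}"
          using False unfolding atLeastAtMost_iff by linarith
        then show ?thesis using wz[of s "Suc n"] False by simp
      qed
    qed
  qed auto
  then have "eventually (\<lambda>n. (LBINT s. W s) - e / 3 < (LBINT s. w (Suc n) s)) sequentially"
    using e by (intro order_tendstoD(1)) auto
  then obtain n where n: "(LBINT s. W s) - e / 3 < (LBINT s. w (Suc n) s)"
    unfolding eventually_sequentially by blast
  define N where "N = Suc n"
  have N: "N > 0" by (simp add: N_def)
  have W_ge: "(LBINT s. indicator {a<..<b} s * \<kappa> s) - e / 3 \<le> (LBINT s. W s)"
  proof -
    have i1: "integrable lborel (\<lambda>s. indicator {a<..<b} s * \<kappa> s)"
    proof (rule bounded_borel_integrable[OF bounded_borel_restrict[OF \<kappa>m, of a b "\<bar>C\<bar>"]])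
      show "\<bar>\<kappa> s\<bar> \<le> \<bar>C\<bar>" if "s \<in> {a<..<b}" for s using C[of s] \<kappa>(1)[of s] that by simp
    qed
    have i2: "integrable lborel (\<lambda>s. e1 * indicator {a..b} s)" by simp
    have i3: "integrable lborel W" by (rule integrable_bounded_interval[OF _ W]) auto
    have "(LBINT s. indicator {a<..<b} s * \<kappa> s) - e / 3
        = (LBINT s. indicator {a<..<b} s * \<kappa> s - e1 * indicator {a..b} s)"
      using i1 i2 e1(2) ab by (subst Bochner_Integration.integral_diff) auto
    also have "\<dots> \<le> (LBINT s. W s)"
    proof (rule integral_mono[OF Bochner_Integration.integrable_diff[OF i1 i2] i3])
      fix s show "indicator {a<..<b} s * \<kappa> s - e1 * indicator {a..b} s \<le> W s"
        using e1(1) by (auto simp: W_def split: split_indicator)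
    qed
    finally show ?thesis .
  qed
  have wi: "integrable lborel (w N)"
  proof (rule integrable_bounded_interval[of _ "\<bar>C\<bar>" a b])
    show "w N s = 0" if "s \<notin> {a..b}" for s
    proof (rule wz[OF _ N])
      have "0 < 1 / real N" using N by simp
      then show "s \<notin> {a + 1 / real N..b - 1 / real N}"
        using that unfolding atLeastAtMost_iff by linarith
    qed
    then show "\<bar>w N s\<bar> \<le> \<bar>C\<bar>" for s
      using w0[of N s] C[of s] e1(1) by (cases "s \<in> {a..b}") auto
  qed simp
  \<comment> \<open>The first bound keeps the support inside the interval, the second one bounds the variation of \<open>\<kappa>\<close> by \<open>e1\<close>.\<close>
  define \<delta>0 where "\<delta>0 = min (1 / (2 * real N)) (e1 / (\<Lambda> + 1))"
  define \<delta> where "\<delta> k = \<delta>0 * inverse (real (Suc k))" for k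
  have \<delta>0: "0 < \<delta>0" using N e1(1) L0 by (auto simp: \<delta>0_def)
  have \<delta>: "0 < \<delta> k" "\<delta> k \<le> \<delta>0" for k
    using \<delta>0 by (auto simp: \<delta>_def field_simps)
  have "\<delta> \<longlonglongrightarrow> \<delta>0 * 0" unfolding \<delta>_def by (intro tendsto_intros LIMSEQ_inverse_real_of_nat)
  then have "(\<lambda>k. LBINT s. \<bar>avg (\<delta> k) (w N) s - w N s\<bar>) \<longlonglongrightarrow> 0"
    using avg_tendsto_L1[OF wi \<delta>(1)] by simp
  then have "eventually (\<lambda>k. (LBINT s. \<bar>avg (\<delta> k) (w N) s - w N s\<bar>) < e / 3) sequentially"
    using e by (intro order_tendstoD(2)[where y=0]) auto
  then obtain k where k: "(LBINT s. \<bar>avg (\<delta> k) (w N) s - w N s\<bar>) < e / 3"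
    unfolding eventually_sequentially by blast
  have half: "\<delta> k < 1 / real N"
  proof -
    have "\<delta> k \<le> 1 / (2 * real N)" using \<delta>(2)[of k] by (simp add: \<delta>0_def)
    also have "\<dots> < 1 / real N" using N by (simp add: field_simps)
    finally show ?thesis .
  qed
  have small: "\<Lambda> * \<delta> k \<le> e1"
  proof -
    have "\<delta> k \<le> e1 / (\<Lambda> + 1)" using \<delta>(2)[of k] by (simp add: \<delta>0_def)
    then have "\<delta> k * (\<Lambda> + 1) \<le> e1" using L0 by (simp add: pos_le_divide_eq)
    then show ?thesis using \<delta>(1)[of k] by (simp add: algebra_simps)
  qed
  have g: "avg (\<delta> k) (w N) \<in> Cc1_on {a<..<b}"
  proof (rule Cc1_on_avg[OF wc])
    show "w N s = 0" if "s \<notin> {a + 1 / real N..b - 1 / real N}" for s by (rule wz[OF that N])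
    show "0 < \<delta> k" by (rule \<delta>)
    show "a < a + 1 / real N - \<delta> k" using half by simp
    show "b - 1 / real N < b" using N by simp
  qed
  have ai: "integrable lborel (avg (\<delta> k) (w N))" by (rule avg_L1_contraction(1)[OF wi \<delta>(1)])
  have "(LBINT s. w N s) - (LBINT s. avg (\<delta> k) (w N) s) = (LBINT s. w N s - avg (\<delta> k) (w N) s)"
    using wi ai by simp
  also have "\<dots> \<le> (LBINT s. \<bar>avg (\<delta> k) (w N) s - w N s\<bar>)"
    using wi ai by (intro integral_mono) auto
  finally have int: "(LBINT s. w N s) - e / 3 \<le> (LBINT s. avg (\<delta> k) (w N) s)" using k by linarith
  show ?thesis
  proof (rule that[OF g])
    show "0 \<le> avg (\<delta> k) (w N) s" for s by (rule avg_nonneg[OF wi \<delta>(1) w0(1)])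
    show "avg (\<delta> k) (w N) s \<le> \<kappa> s" for s
    proof -
      have "\<bar>avg (\<delta> k) (w N) s\<bar> \<le> \<kappa> s"
      proof (rule avg_bound[OF wi \<delta>(1)])
        fix r assume r: "s < r" "r \<le> s + \<delta> k"
        have "\<bar>\<kappa> r - \<kappa> s\<bar> \<le> \<Lambda> * \<bar>r - s\<bar>" by (rule \<kappa>(2))
        also have "\<dots> \<le> \<Lambda> * \<delta> k" using r L0 by (intro mult_left_mono) auto
        finally have "\<kappa> r - e1 \<le> \<kappa> s" using small by linarith
        then show "\<bar>w N r\<bar> \<le> \<kappa> s" using w0[of N r] \<kappa>(1)[of s] by auto
      qed
      then show ?thesis by linarith
    qed
    show "(LBINT s. indicator {a<..<b} s * \<kappa> s) - e \<le> (LBINT s. avg (\<delta> k) (w N) s)"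
      using int n W_ge unfolding N_def by linarith
  qed
qed

text \<open>
  The test functions are mollified trapezoids: the derivative of \<open>avg \<delta>\<close> of an approximate indicator of an
  interval is a difference of two normalized indicators, so testing with it compares two averages of \<open>u\<close>.
  With \<open>C = 0\<close> this bounds the oscillation of \<open>u\<close>, with \<open>T = 0\<close> it gives Lipschitz continuity, and with
  \<open>C = T = 0\<close> it shows that \<open>u\<close> is constant.
\<close>
lemma AE_modulus_from_test_functions:
  assumes u: "integrable lborel u" and ab: "a < b"
    and test: "\<And>c d \<eta>. a < c \<Longrightarrow> c \<le> d \<Longrightarrow> d < b \<Longrightarrow> \<eta> \<in> Cc1_on {a<..<b} \<Longrightarrow> (\<And>s. 0 \<le> \<eta> s \<and> \<eta> s \<le> 1) \<Longrightarrow>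
      (\<And>s. s \<notin> {c..d} \<Longrightarrow> \<eta> s = 0) \<Longrightarrow> \<bar>LBINT s. u s * deriv \<eta> s\<bar> \<le> T + C * (d - c)"
  obtains Z where "Z \<in> null_sets lborel"
    "\<And>s t. s \<in> {a<..<b} - Z \<Longrightarrow> t \<in> {a<..<b} - Z \<Longrightarrow> \<bar>u s - u t\<bar> \<le> T + C * \<bar>s - t\<bar>"
proof -
  have um[measurable]: "u \<in> borel_measurable borel" using u by auto
  have trap: "\<bar>avg \<delta> u (c - \<delta>) - avg \<delta> u (d - \<delta>)\<bar> \<le> T + C * (d - (c - \<delta>))"
    if cd: "c < d" "0 < \<delta>" "a < c - \<delta>" "d < b" for c d \<delta>
  proof -
    \<comment> \<open>Continuous functions that increase to the indicator of the open interval from \<open>c\<close> to \<open>d\<close>.\<close>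
    define A where "A n s = max 0 (min 1 (real n * min (s - c) (d - s)))" for n s
    have A: "0 \<le> A n s" "A n s \<le> 1" for n s by (auto simp: A_def)
    have Az: "A n s = 0" if "s \<notin> {c<..<d}" for n s
    proof -
      have "real n * min (s - c) (d - s) \<le> 0" using that by (intro mult_nonneg_nonpos) auto
      then show ?thesis by (simp add: A_def)
    qed
    have Ac: "continuous_on UNIV (A n)" for n
      unfolding A_def by (intro continuous_intros continuous_on_max continuous_on_min)
    have [measurable]: "A n \<in> borel_measurable borel" for n by (rule borel_measurable_continuous_onI[OF Ac])
    have Alim: "(\<lambda>n. A n s) \<longlonglongrightarrow> indicator {c<..<d} s" for s
    proof (cases "s \<in> {c<..<d}")
      case True
      define m where "m = min (s - c) (d - s)"
      have m: "m > 0" using True by (auto simp: m_def)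
      obtain n0 :: nat where n0: "1 / m < real n0" using reals_Archimedean2 by blast
      have "A n s = indicator {c<..<d} s" if "n \<ge> n0" for n
      proof -
        have "1 / m < real n" using n0 that by (meson less_le_trans of_nat_le_iff)
        then have "1 < real n * m" using m by (simp add: pos_divide_less_eq)
        then show ?thesis using True unfolding A_def m_def[symmetric] by simp
      qed
      then have "eventually (\<lambda>n. A n s = indicator {c<..<d} s) sequentially"
        unfolding eventually_sequentially by blast
      then show ?thesis by (rule tendsto_eventually)
    qed (use Az in simp)
    have bnd: "\<bar>LBINT s. u s * ((A n (s + \<delta>) - A n s) / \<delta>)\<bar> \<le> T + C * (d - (c - \<delta>))" for n
    proof -
      have z: "A n s = 0" if "s \<notin> {c..d}" for s using Az that by auto
      note \<eta> = Cc1_on_avg[OF Ac z cd(2,3,4)]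
      have "\<bar>LBINT s. u s * deriv (avg \<delta> (A n)) s\<bar> \<le> T + C * (d - (c - \<delta>))"
      proof (rule test[OF cd(3) _ cd(4) \<eta>(2)])
        fix s
        have "\<bar>avg \<delta> (A n) s\<bar> \<le> 1" by (rule avg_bound[OF \<eta>(1) cd(2)]) (use A[of n] in auto)
        moreover have "0 \<le> avg \<delta> (A n) s" by (rule avg_nonneg[OF \<eta>(1) cd(2) A(1)])
        ultimately show "0 \<le> avg \<delta> (A n) s \<and> avg \<delta> (A n) s \<le> 1" by auto
      qed (use cd \<eta>(4) in auto)
      moreover have "(LBINT s. u s * deriv (avg \<delta> (A n)) s) = (LBINT s. u s * ((A n (s + \<delta>) - A n s) / \<delta>))"
        by (intro Bochner_Integration.integral_cong refl arg_cong[where f="(*) _"] fun_cong[OF \<eta>(3)])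
      ultimately show ?thesis by (simp only:)
    qed
    have ind_i: "integrable lborel (\<lambda>s. u s * indicator {x<..<y} s)" for x y
      using integrable_indicator_mult[OF u, of "{x<..<y}"] by (simp add: mult.commute)
    have lim: "(\<lambda>n. LBINT s. u s * ((A n (s + \<delta>) - A n s) / \<delta>))
        \<longlonglongrightarrow> (LBINT s. u s * ((indicator {c<..<d} (s + \<delta>) - indicator {c<..<d} s) / \<delta>))"
    proof (rule integral_dominated_convergence[where w="\<lambda>s. \<bar>u s\<bar> * (1 / \<delta>)"])
      show "AE s in lborel. (\<lambda>n. u s * ((A n (s + \<delta>) - A n s) / \<delta>))
          \<longlonglongrightarrow> u s * ((indicator {c<..<d} (s + \<delta>) - indicator {c<..<d} s) / \<delta>)"
        by (intro AE_I2 tendsto_mult tendsto_divide tendsto_diff tendsto_const Alim) (use cd in auto)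
      show "AE s in lborel. norm (u s * ((A n (s + \<delta>) - A n s) / \<delta>)) \<le> \<bar>u s\<bar> * (1 / \<delta>)" for n
      proof (rule AE_I2)
        fix s
        have "\<bar>A n (s + \<delta>) - A n s\<bar> \<le> 1" using A[of n s] A[of n "s + \<delta>"] by linarith
        then have "\<bar>(A n (s + \<delta>) - A n s) / \<delta>\<bar> \<le> 1 / \<delta>" using cd(2) by (simp add: abs_divide divide_right_mono)
        then show "norm (u s * ((A n (s + \<delta>) - A n s) / \<delta>)) \<le> \<bar>u s\<bar> * (1 / \<delta>)"
          unfolding real_norm_def abs_mult by (intro mult_left_mono) auto
      qed
      show "(\<lambda>s. u s * ((indicator {c<..<d} (s + \<delta>) - indicator {c<..<d} s) / \<delta>)) \<in> borel_measurable lborel" by measurable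
      show "integrable lborel (\<lambda>s. \<bar>u s\<bar> * (1 / \<delta>))" using u by auto
    qed measurable
    have half_open: "(LBINT s. u s * indicator {x<..<y} s) = prim u y - prim u x" if "x \<le> y" for x y
    proof -
      have "(LBINT s. u s * indicator {x<..<y} s) = (LBINT s. indicator {x<..y} s * u s)"
        by (rule integral_cong_AE) (use AE_lborel_singleton[of y] in \<open>auto split: split_indicator\<close>)
      then show ?thesis using prim_diff[OF u that] by simp
    qed
    have "(LBINT s. u s * ((indicator {c<..<d} (s + \<delta>) - indicator {c<..<d} s) / \<delta>))
        = (LBINT s. (u s * indicator {c - \<delta><..<d - \<delta>} s - u s * indicator {c<..<d} s) / \<delta>)"
      by (intro Bochner_Integration.integral_cong) (auto split: split_indicator)
    also have "\<dots> = ((prim u (d - \<delta>) - prim u (c - \<delta>)) - (prim u d - prim u c)) / \<delta>"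
      using cd by (simp add: ind_i half_open)
    also have "\<dots> = avg \<delta> u (c - \<delta>) - avg \<delta> u (d - \<delta>)"
      unfolding avg_def by (simp add: diff_divide_distrib)
    finally have "(\<lambda>n. LBINT s. u s * ((A n (s + \<delta>) - A n s) / \<delta>))
        \<longlonglongrightarrow> avg \<delta> u (c - \<delta>) - avg \<delta> u (d - \<delta>)" using lim by simp
    from tendsto_rabs[OF this] show ?thesis
      by (rule LIMSEQ_le_const2) (use bnd in auto)
  qed
  obtain \<delta> :: "nat \<Rightarrow> real" where \<delta>: "\<And>n. 0 < \<delta> n" "\<delta> \<longlonglongrightarrow> 0" and ae: "AE s in lborel. (\<lambda>n. avg (\<delta> n) u s) \<longlonglongrightarrow> u s"
    by (rule avg_AE_subsequence[OF u]) (rule that)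
  obtain Z where Z: "Z \<in> null_sets lborel" "\<And>s. s \<notin> Z \<Longrightarrow> (\<lambda>n. avg (\<delta> n) u s) \<longlonglongrightarrow> u s"
    using AE_E3[OF ae] by auto
  have lt: "\<bar>u s - u t\<bar> \<le> T + C * (t - s)" if s: "s \<in> {a<..<b} - Z" and t: "t \<in> {a<..<b} - Z" and st: "s < t" for s t
  proof -
    have "\<forall>\<^sub>F n in sequentially. \<delta> n < b - t" using \<delta>(2) t by (intro order_tendstoD(2)) auto
    then have ev: "\<forall>\<^sub>F n in sequentially. \<bar>avg (\<delta> n) u s - avg (\<delta> n) u t\<bar> \<le> T + C * ((t + \<delta> n) - s)"
    proof eventually_elim
      case (elim n)
      then show ?case using trap[of "s + \<delta> n" "t + \<delta> n" "\<delta> n"] st \<delta>(1)[of n] s by simp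
    qed
    have lim: "(\<lambda>n. \<bar>avg (\<delta> n) u s - avg (\<delta> n) u t\<bar>) \<longlonglongrightarrow> \<bar>u s - u t\<bar>"
      using s t by (intro tendsto_intros Z) auto
    have "(\<lambda>n. T + C * ((t + \<delta> n) - s)) \<longlonglongrightarrow> T + C * ((t + 0) - s)"
      by (intro tendsto_intros \<delta>)
    from tendsto_le[OF sequentially_bot this lim ev] show ?thesis by simp
  qed
  have eq: "\<bar>u s - u t\<bar> \<le> T + C * \<bar>s - t\<bar>" if "s \<in> {a<..<b} - Z" "t \<in> {a<..<b} - Z" "s \<noteq> t" for s t
    using lt[of s t] lt[of t s] that by (cases "s < t") (auto simp: abs_minus_commute)
  have "a < (a + b) / 2" "(a + b) / 2 \<le> (a + b) / 2" "(a + b) / 2 < b" using ab by auto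
  moreover have "(\<lambda>_. 0) \<in> Cc1_on {a<..<b}"
    by (rule Cc1_onI[of _ "\<lambda>_. 0" "(a + b) / 2" "(a + b) / 2"]) (use ab in auto)
  ultimately have "0 \<le> T" using test[of "(a + b) / 2" "(a + b) / 2" "\<lambda>_. 0"] by simp
  then have "\<bar>u s - u t\<bar> \<le> T + C * \<bar>s - t\<bar>" if "s \<in> {a<..<b} - Z" "t \<in> {a<..<b} - Z" for s t
    using eq[OF that] by (cases "s = t") auto
  then show ?thesis using that[OF Z(1)] by blast
qed

text \<open>
  McShane's extension formula.
\<close>
lemma lipschitz_extension_AE:
  assumes ab: "a < b" and Z: "Z \<in> null_sets lborel" and C: "0 \<le> C"
    and lip: "\<And>s t. s \<in> {a<..<b} - Z \<Longrightarrow> t \<in> {a<..<b} - Z \<Longrightarrow> \<bar>u s - u t\<bar> \<le> C * \<bar>s - t\<bar>"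
  obtains w where "\<And>s. s \<in> {a<..<b} - Z \<Longrightarrow> u s = w s" "C-lipschitz_on UNIV w"
proof -
  let ?G = "{a<..<b} - Z"
  have ne: "?G \<noteq> {}"
  proof
    assume "?G = {}"
    then have "emeasure lborel {a<..<b} \<le> emeasure lborel Z" using Z by (intro emeasure_mono) auto
    then show False using Z ab by (auto simp: null_sets_def)
  qed
  then obtain r where r: "r \<in> ?G" by blast
  define w where "w s = (INF t\<in>?G. u t + C * \<bar>s - t\<bar>)" for s
  have bdd: "bdd_below ((\<lambda>t. u t + C * \<bar>s - t\<bar>) ` ?G)" for s
  proof (rule bdd_belowI2[of _ "u r - C * \<bar>s - r\<bar>"])
    fix t assume t: "t \<in> ?G"
    have "C * \<bar>r - t\<bar> \<le> C * (\<bar>s - r\<bar> + \<bar>s - t\<bar>)" using C by (intro mult_left_mono) auto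
    then show "u r - C * \<bar>s - r\<bar> \<le> u t + C * \<bar>s - t\<bar>" using lip[OF r t] by (simp add: distrib_left)
  qed
  have eq: "u s = w s" if s: "s \<in> ?G" for s
  proof (rule antisym)
    show "u s \<le> w s" unfolding w_def
    proof (rule cINF_greatest[OF ne])
      fix t assume "t \<in> ?G"
      then show "u s \<le> u t + C * \<bar>s - t\<bar>" using lip[OF s, of t] by simp
    qed
    show "w s \<le> u s" unfolding w_def using cINF_lower[OF bdd s, of s] by simp
  qed
  have le: "w s \<le> w t + C * \<bar>s - t\<bar>" for s t
  proof -
    have "w s - C * \<bar>s - t\<bar> \<le> w t" unfolding w_def[of t]
    proof (rule cINF_greatest[OF ne])
      fix r assume r: "r \<in> ?G"
      have "w s \<le> u r + C * \<bar>s - r\<bar>" unfolding w_def by (rule cINF_lower[OF bdd r])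
      also have "C * \<bar>s - r\<bar> \<le> C * (\<bar>t - r\<bar> + \<bar>s - t\<bar>)" using C by (intro mult_left_mono) auto
      finally show "w s - C * \<bar>s - t\<bar> \<le> u r + C * \<bar>t - r\<bar>" by (simp add: distrib_left)
    qed
    then show ?thesis by simp
  qed
  have "C-lipschitz_on UNIV w"
  proof (rule lipschitz_onI[OF _ C])
    fix s t show "dist (w s) (w t) \<le> C * dist s t"
      using le[of s t] le[of t s] by (simp add: dist_real_def abs_le_iff abs_minus_commute)
  qed
  then show ?thesis using that eq by blast
qed

section \<open>The anisotropic area\<close>

context symmetric_anisotropy
begin

lemma area_ge:
  assumes u: "integrable lborel u" and ab: "a < b" and h: "h1 \<in> Cc1_on {a<..<b}" "h2 \<in> Cc1_on {a<..<b}"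
    and le: "\<And>s. \<phi> (h1 s, h2 s) \<le> 1"
  shows "ereal ((LBINT s. u s * deriv h1 s) + (LBINT s. h2 s)) \<le> aniso_area \<phi> {a<..<b} u"
proof -
  note b1 = Cc1_on_bounded_borel[OF h(1) ab] and b2 = Cc1_on_bounded_borel[OF h(2) ab]
  have [measurable]: "u \<in> borel_measurable borel" "deriv h1 \<in> borel_measurable borel" "h2 \<in> borel_measurable borel"
    using u bounded_borel_measurable b1(2) b2(1) by auto
  have "continuous_on UNIV (\<lambda>s. \<phi> (h1 s, h2 s))"
    using b1 b2 by (intro continuous_on_compose2[OF phi_continuous] continuous_intros) auto
  then have "(\<lambda>s. \<phi> (h1 s, h2 s)) \<in> borel_measurable borel" by (rule borel_measurable_continuous_onI)
  then have "Linf_norm {a<..<b} (\<lambda>s. \<phi> (h1 s, h2 s)) \<le> 1"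
    unfolding Linf_norm_def using le phi_nonneg
    by (intro esssup_I measurable_lebesgue_on borel_measurable_ereal borel_measurable_abs) auto
  then have "ereal (\<integral>s. (u s * deriv h1 s + h2 s) \<partial>lebesgue_on {a<..<b}) \<le> aniso_area \<phi> {a<..<b} u"
    unfolding aniso_area_def using h by (intro Sup_upper) blast
  moreover have "(\<integral>s. (u s * deriv h1 s + h2 s) \<partial>lebesgue_on {a<..<b}) = (LBINT s. (u s * deriv h1 s + h2 s))"
    by (rule integral_lebesgue_on) (use bounded_borel_zero[OF b1(2)] bounded_borel_zero[OF b2(1)] in auto)
  moreover have "\<dots> = (LBINT s. u s * deriv h1 s) + (LBINT s. h2 s)"
    by (intro Bochner_Integration.integral_add integrable_mult_bounded[OF u b1(2)] bounded_borel_integrable[OF b2(1)])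
  ultimately show ?thesis by simp
qed

lemma area_le:
  assumes u: "integrable lborel u" and ab: "a < b"
    and le: "\<And>h1 h2. h1 \<in> Cc1_on {a<..<b} \<Longrightarrow> h2 \<in> Cc1_on {a<..<b} \<Longrightarrow> (\<And>s. \<phi> (h1 s, h2 s) \<le> 1) \<Longrightarrow>
      (LBINT s. u s * deriv h1 s) + (LBINT s. h2 s) \<le> c"
  shows "aniso_area \<phi> {a<..<b} u \<le> ereal c"
  unfolding aniso_area_def
proof (rule Sup_least, clarify)
  fix h1 h2 assume h: "h1 \<in> Cc1_on {a<..<b}" "h2 \<in> Cc1_on {a<..<b}"
    and L: "Linf_norm {a<..<b} (\<lambda>s. \<phi> (h1 s, h2 s)) \<le> 1"
  note b1 = Cc1_on_bounded_borel[OF h(1) ab] and b2 = Cc1_on_bounded_borel[OF h(2) ab]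
  have [measurable]: "u \<in> borel_measurable borel" "deriv h1 \<in> borel_measurable borel" "h2 \<in> borel_measurable borel"
    using u bounded_borel_measurable b1(2) b2(1) by auto
  have c: "continuous_on UNIV (\<lambda>s. \<phi> (h1 s, h2 s))"
    using b1 b2 by (intro continuous_on_compose2[OF phi_continuous] continuous_intros) auto
  have "AE s in lebesgue_on {a<..<b}. ereal \<bar>\<phi> (h1 s, h2 s)\<bar> \<le> Linf_norm {a<..<b} (\<lambda>s. \<phi> (h1 s, h2 s))"
    unfolding Linf_norm_def by (rule esssup_AE)
  then have "AE s in lebesgue_on {a<..<b}. \<phi> (h1 s, h2 s) \<le> 1"
  proof eventually_elim
    case (elim s)
    then have "ereal \<bar>\<phi> (h1 s, h2 s)\<bar> \<le> 1" using L by (rule order_trans)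
    then show ?case by (simp add: one_ereal_def)
  qed
  then have "\<phi> (h1 s, h2 s) \<le> 1" if "s \<in> {a<..<b}" for s by (rule AE_le_continuous[OF _ c that])
  moreover have "\<phi> (h1 s, h2 s) \<le> 1" if "s \<notin> {a<..<b}" for s
    using bounded_borel_zero[OF b1(1) that] bounded_borel_zero[OF b2(1) that] phi_zero by (simp add: zero_prod_def)
  ultimately have "\<phi> (h1 s, h2 s) \<le> 1" for s by blast
  then have "(LBINT s. u s * deriv h1 s) + (LBINT s. h2 s) \<le> c" by (rule le[OF h])
  moreover have "(\<integral>s. (u s * deriv h1 s + h2 s) \<partial>lebesgue_on {a<..<b}) = (LBINT s. (u s * deriv h1 s + h2 s))"
    by (rule integral_lebesgue_on) (use bounded_borel_zero[OF b1(2)] bounded_borel_zero[OF b2(1)] in auto)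
  moreover have "\<dots> = (LBINT s. u s * deriv h1 s) + (LBINT s. h2 s)"
    by (intro Bochner_Integration.integral_add integrable_mult_bounded[OF u b1(2)] bounded_borel_integrable[OF b2(1)])
  ultimately show "ereal (\<integral>s. (u s * deriv h1 s + h2 s) \<partial>lebesgue_on {a<..<b}) \<le> ereal c" by simp
qed

text \<open>
  The best second component for a given first component \<open>h\<close> is \<open>profile (h s)\<close>. It is not compactly
  supported, but it can be approximated from below by test functions.
\<close>
lemma area_ge_profile:
  assumes u: "integrable lborel u" and ab: "a < b" and h: "h \<in> Cc1_on {a<..<b}"
    and r: "\<And>s. \<bar>h s\<bar> \<le> r" "r < halfwidth" and A: "aniso_area \<phi> {a<..<b} u \<le> ereal A"
  shows "(LBINT s. u s * deriv h s) + (LBINT s. indicator {a<..<b} s * profile (h s)) \<le> A"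
proof (rule field_le_epsilon)
  fix e :: real assume e: "0 < e"
  obtain B where B: "B \<ge> 0" "\<And>s. \<bar>deriv h s\<bar> \<le> B"
    using bounded_borel_bound[OF Cc1_on_bounded_borel(2)[OF h ab]] by blast
  have hl: "\<bar>h s - h t\<bar> \<le> B * \<bar>s - t\<bar>" for s t
    using field_differentiable_bound[of UNIV h "deriv h" B s t] Cc1_on_derivative[OF h ab] B(2) by simp
  have k: "\<bar>profile (h s) - profile (h t)\<bar> \<le> (slope_bound r * B) * \<bar>s - t\<bar>" for s t
  proof -
    have "\<bar>profile (h s) - profile (h t)\<bar> \<le> slope_bound r * \<bar>h s - h t\<bar>"
      by (rule profile_lipschitz[OF r(2,1,1)])
    also have "\<dots> \<le> slope_bound r * (B * \<bar>s - t\<bar>)" by (intro mult_left_mono hl slope_bound_nonneg)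
    finally show ?thesis by (simp add: mult.assoc)
  qed
  have hw: "\<bar>h s\<bar> \<le> halfwidth" for s using r(1)[of s] r(2) by linarith
  obtain g where g: "g \<in> Cc1_on {a<..<b}" "\<And>s. 0 \<le> g s" "\<And>s. g s \<le> profile (h s)"
    and gi: "(LBINT s. indicator {a<..<b} s * profile (h s)) - e \<le> (LBINT s. g s)"
    by (rule Cc1_approx_below[OF ab profile_nonneg[OF hw] k e]) (rule that)
  have "ereal ((LBINT s. u s * deriv h s) + (LBINT s. g s)) \<le> aniso_area \<phi> {a<..<b} u"
    by (rule area_ge[OF u ab h g(1)]) (rule profile_in_ball_below[OF hw g(2,3)])
  also note A
  finally show "(LBINT s. u s * deriv h s) + (LBINT s. indicator {a<..<b} s * profile (h s)) \<le> A + e"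
    using gi by simp
qed

text \<open>
  The hypothesis on \<open>\<kappa>\<close> says that \<open>\<kappa>\<close> dominates the integrand \<open>\<phi>\<^sup>o (- \<xi>, 1)\<close> of the area of a primitive
  of \<open>\<xi>\<close>.
\<close>
lemma area_primitive_le:
  assumes ab: "a < b" and \<xi>: "\<xi> \<in> bounded_borel a b" and \<kappa>: "\<kappa> \<in> bounded_borel a b"
    and le: "\<And>s x y. s \<in> {a<..<b} \<Longrightarrow> \<phi> (x, y) \<le> 1 \<Longrightarrow> y - \<xi> s * x \<le> \<kappa> s"
    and v: "(\<lambda>s. indicator {a<..<b} s * (c + prim \<xi> s)) \<in> bounded_borel a b"
  shows "aniso_area \<phi> {a<..<b} (\<lambda>s. indicator {a<..<b} s * (c + prim \<xi> s)) \<le> ereal (LBINT s. \<kappa> s)"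
proof (rule area_le[OF bounded_borel_integrable[OF v] ab])
  fix h1 h2 assume h: "h1 \<in> Cc1_on {a<..<b}" "h2 \<in> Cc1_on {a<..<b}" and p: "\<And>s. \<phi> (h1 s, h2 s) \<le> 1"
  note b1 = Cc1_on_bounded_borel[OF h(1) ab] and b2 = Cc1_on_bounded_borel[OF h(2) ab]
  have i1: "integrable lborel (\<lambda>s. h1 s * \<xi> s)" by (rule integrable_mult_bounded[OF bounded_borel_integrable[OF b1(1)] \<xi>])
  have i2: "integrable lborel h2" by (rule bounded_borel_integrable[OF b2(1)])
  have "(LBINT s. (indicator {a<..<b} s * (c + prim \<xi> s)) * deriv h1 s) + (LBINT s. h2 s)
      = (LBINT s. h2 s - h1 s * \<xi> s)"
    using test_function_by_parts[OF h(1) ab \<xi>] i1 i2 by simp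
  also have "\<dots> \<le> (LBINT s. \<kappa> s)"
  proof (rule integral_mono)
    show "h2 s - h1 s * \<xi> s \<le> \<kappa> s" for s
    proof (cases "s \<in> {a<..<b}")
      case True
      then show ?thesis using le[OF True p[of s]] by (simp add: mult.commute)
    next
      case False
      then show ?thesis
        using bounded_borel_zero[OF \<xi> False] bounded_borel_zero[OF b2(1) False] bounded_borel_zero[OF \<kappa> False] by simp
    qed
  qed (use i1 i2 bounded_borel_integrable[OF \<kappa>] in auto)
  finally show "(LBINT s. (indicator {a<..<b} s * (c + prim \<xi> s)) * deriv h1 s) + (LBINT s. h2 s)
      \<le> (LBINT s. \<kappa> s)" .
qed

text \<open>
  The area controls \<open>halfwidth\<close> times the total variation, as the ball contains the horizontal segment
  from \<open>(- halfwidth, 0)\<close> to \<open>(halfwidth, 0)\<close>.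
\<close>
lemma area_ge_test:
  assumes u: "integrable lborel u" and ab: "a < b" and h: "h \<in> Cc1_on {a<..<b}" and h1: "\<And>s. \<bar>h s\<bar> \<le> 1"
    and A: "aniso_area \<phi> {a<..<b} u \<le> ereal A"
  shows "\<bar>LBINT s. u s * deriv h s\<bar> \<le> A / halfwidth"
proof -
  have z: "(\<lambda>_. 0) \<in> Cc1_on {a<..<b}"
    by (rule Cc1_onI[of _ "\<lambda>_. 0" "(a + b) / 2" "(a + b) / 2"]) (use ab in auto)
  have dz: "deriv (\<lambda>_. 0 :: real) = (\<lambda>_. 0)" by (auto simp: fun_eq_iff)
  have *: "t * (LBINT s. u s * deriv h s) \<le> A" if "\<bar>t\<bar> = halfwidth" for t
  proof -
    note L = Cc1_on_lincomb[OF z h ab, of t]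
    have "ereal ((LBINT s. u s * deriv (\<lambda>s. 0 + t * h s) s) + (\<integral>s. 0 \<partial>(lborel :: real measure))) \<le> aniso_area \<phi> {a<..<b} u"
    proof (rule area_ge[OF u ab L(1) z])
      fix s
      have "\<bar>t * h s\<bar> \<le> halfwidth * 1" unfolding abs_mult that using h1[of s] halfwidth_pos by (intro mult_left_mono) auto
      then show "\<phi> (0 + t * h s, 0) \<le> 1" using halfwidth_pos by (simp add: phi_horizontal)
    qed
    also note A
    finally have "(LBINT s. u s * deriv (\<lambda>s. 0 + t * h s) s) \<le> A" by simp
    moreover have "(LBINT s. u s * deriv (\<lambda>s. 0 + t * h s) s) = (LBINT s. t * (u s * deriv h s))"
      unfolding L(2) dz by (intro Bochner_Integration.integral_cong) auto
    ultimately show ?thesis by simp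
  qed
  show ?thesis
    using *[of halfwidth] *[of "- halfwidth"] halfwidth_pos
    by (simp add: abs_le_iff pos_le_divide_eq mult.commute)
qed

lemma total_variation_finite:
  assumes u: "integrable lborel u" and ab: "a < b" and A: "aniso_area \<phi> {a<..<b} u \<le> ereal A"
  shows "total_variation {a<..<b} u < \<infinity>"
proof -
  have "total_variation {a<..<b} u \<le> ereal (A / halfwidth)"
    unfolding total_variation_def
  proof (rule Sup_least, clarify)
    fix h assume h: "h \<in> Cc1_on {a<..<b}" and L: "Linf_norm {a<..<b} h \<le> 1"
    note hb = Cc1_on_bounded_borel[OF h ab]
    have [measurable]: "u \<in> borel_measurable borel" "deriv h \<in> borel_measurable borel"
      using u bounded_borel_measurable[OF hb(2)] by auto
    have "AE s in lebesgue_on {a<..<b}. ereal \<bar>h s\<bar> \<le> Linf_norm {a<..<b} h"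
      unfolding Linf_norm_def by (rule esssup_AE)
    then have ae: "AE s in lebesgue_on {a<..<b}. \<bar>h s\<bar> \<le> 1"
    proof eventually_elim
      case (elim s)
      then have "ereal \<bar>h s\<bar> \<le> 1" using L by (rule order_trans)
      then show ?case by (simp add: one_ereal_def)
    qed
    have "\<bar>h s\<bar> \<le> 1" for s
    proof (cases "s \<in> {a<..<b}")
      case True
      show ?thesis by (rule AE_le_continuous[OF ae _ True]) (intro continuous_intros hb)
    next
      case False
      then show ?thesis using bounded_borel_zero[OF hb(1) False] by simp
    qed
    then have "\<bar>LBINT s. u s * deriv h s\<bar> \<le> A / halfwidth" by (rule area_ge_test[OF u ab h _ A])
    moreover have "(\<integral>s. u s * deriv h s \<partial>lebesgue_on {a<..<b}) = (LBINT s. u s * deriv h s)"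
      by (rule integral_lebesgue_on) (use bounded_borel_zero[OF hb(2)] in auto)
    ultimately show "ereal (\<integral>s. u s * deriv h s \<partial>lebesgue_on {a<..<b}) \<le> ereal (A / halfwidth)" by simp
  qed
  then show ?thesis by (rule le_less_trans) simp
qed

end

lemma aniso_area_cong_AE:
  assumes u: "u \<in> borel_measurable (lebesgue_on {a<..<b})" and v: "v \<in> borel_measurable (lebesgue_on {a<..<b})"
    and ae: "AE s in lebesgue_on {a<..<b}. u s = v s" and ab: "a < b"
  shows "aniso_area \<phi> {a<..<b} u = aniso_area \<phi> {a<..<b} v"
proof -
  have "(\<integral>s. (u s * deriv h1 s + h2 s) \<partial>lebesgue_on {a<..<b}) = (\<integral>s. (v s * deriv h1 s + h2 s) \<partial>lebesgue_on {a<..<b})"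
    if "h1 \<in> Cc1_on {a<..<b}" "h2 \<in> Cc1_on {a<..<b}" for h1 h2
  proof (rule integral_cong_AE)
    have [measurable]: "deriv h1 \<in> borel_measurable (lebesgue_on {a<..<b})" "h2 \<in> borel_measurable (lebesgue_on {a<..<b})"
      using Cc1_on_bounded_borel[OF that(1) ab] Cc1_on_bounded_borel[OF that(2) ab]
      by (auto intro!: measurable_lebesgue_on bounded_borel_measurable)
    show "(\<lambda>s. u s * deriv h1 s + h2 s) \<in> borel_measurable (lebesgue_on {a<..<b})" using u by measurable
    show "(\<lambda>s. v s * deriv h1 s + h2 s) \<in> borel_measurable (lebesgue_on {a<..<b})" using v by measurable
    show "AE s in lebesgue_on {a<..<b}. u s * deriv h1 s + h2 s = v s * deriv h1 s + h2 s"
      using ae by eventually_elim simp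
  qed
  then show ?thesis unfolding aniso_area_def by (metis (no_types, lifting))
qed

section \<open>Regularity from a dual potential\<close>

lemma abs_divide_le: "\<bar>x\<bar> \<le> C * c \<Longrightarrow> 0 < c \<Longrightarrow> \<bar>x / c\<bar> \<le> C" for x c C :: real
  by (simp add: abs_divide pos_divide_le_eq)

text \<open>
  An average is a primitive of a bounded function, namely of the difference quotient of \<open>u\<close>. This is the form
  needed for \<open>integration_by_parts\<close>.
\<close>
lemma prim_shift_difference:
  assumes u: "integrable lborel u" and d: "0 < d" and s: "s \<in> {a<..<b}"
  shows "prim (\<lambda>t. indicator {a<..<b} t * ((u (t + d) - u t) / d)) s = avg d u s - avg d u a"
proof -
  have ush: "integrable lborel (\<lambda>t. u (t + d))"
    using lborel_integrable_real_affine[OF u, of 1 d] by (simp add: add.commute)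
  have "prim (\<lambda>t. indicator {a<..<b} t * ((u (t + d) - u t) / d)) s
      = (LBINT t. (indicator {a<..s} t * u (t + d) - indicator {a<..s} t * u t) / d)"
    unfolding prim_def by (intro Bochner_Integration.integral_cong) (use s in \<open>auto split: split_indicator\<close>)
  also have "\<dots> = ((LBINT t. indicator {a<..s} t * u (t + d)) - (LBINT t. indicator {a<..s} t * u t)) / d"
    using integrable_indicator_mult[OF ush, of "{a<..s}"] integrable_indicator_mult[OF u, of "{a<..s}"] by simp
  also have "(LBINT t. indicator {a<..s} t * u (t + d)) = (LBINT t. indicator {a + d<..s + d} (d + 1 * t) * u (d + 1 * t))"
    by (intro Bochner_Integration.integral_cong) (auto simp: add.commute split: split_indicator)
  also have "\<dots> = (LBINT t. indicator {a + d<..s + d} t * u t)"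
    using lborel_integral_real_affine[of 1 "\<lambda>t. indicator {a + d<..s + d} t * u t" d] by simp
  also have "\<dots> = prim u (s + d) - prim u (a + d)" using prim_diff[OF u, of "a + d" "s + d"] s by simp
  also have "(LBINT t. indicator {a<..s} t * u t) = prim u s - prim u a" using prim_diff[OF u, of a s] s by simp
  finally show ?thesis unfolding avg_def by (simp add: diff_divide_distrib)
qed

text \<open>
  Soft thresholding. Applied to a Lipschitz function that vanishes at the ends of an interval, it makes the support
  compact in the open interval without increasing the Lipschitz constant.
\<close>
definition shrink :: "real \<Rightarrow> real \<Rightarrow> real" where
  "shrink e y = max (y - e) 0 + min (y + e) 0"

lemma shrink_properties:
  assumes "0 \<le> e"
  shows "\<bar>shrink e y - shrink e z\<bar> \<le> \<bar>y - z\<bar>" "\<bar>shrink e y - y\<bar> \<le> e" "\<bar>shrink e y\<bar> \<le> \<bar>y\<bar>"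
    "\<bar>y\<bar> \<le> e \<Longrightarrow> shrink e y = 0"
  using assms by (auto simp: shrink_def max_def min_def)

context bounded_functional
begin

text \<open>
  Thresholding the potential makes its support compact in the interval, and averaging makes it continuously
  differentiable; neither increases the Lipschitz constant or the maximum.
\<close>
lemma potential_approximation:
  assumes B: "\<And>s. \<bar>potential s\<bar> \<le> B"
  obtains h where "\<And>n. h n \<in> Cc1_on {a<..<b}" "\<And>n s. \<bar>deriv (h n) s\<bar> \<le> M"
    "\<And>n s. \<bar>h n s - potential s\<bar> \<le> 2 / real (Suc n)"
    "\<And>n s. \<bar>h n s\<bar> \<le> B"
proof -
  define e where "e n = 1 / real (Suc n)" for n
  \<comment> \<open>Within distance \<open>\<rho> n\<close> of the end points the potential is at most the threshold \<open>e n\<close>.\<close>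
  define \<rho> where "\<rho> n = e n / (M + 1)" for n
  define z where "z n s = shrink (e n) (potential s)" for n s
  define h where "h n = avg (\<rho> n / 2) (z n)" for n
  have e: "0 < e n" for n by (simp add: e_def)
  have \<rho>: "0 < \<rho> n" "M * \<rho> n \<le> e n" for n
  proof -
    show "0 < \<rho> n" using e[of n] M_nonneg by (simp add: \<rho>_def)
    then have "M * \<rho> n \<le> (M + 1) * \<rho> n" by (intro mult_right_mono) auto
    also have "\<dots> = e n" using M_nonneg by (simp add: \<rho>_def)
    finally show "M * \<rho> n \<le> e n" .
  qed
  have zlip: "\<bar>z n s - z n t\<bar> \<le> M * \<bar>s - t\<bar>" for n s t
    using shrink_properties(1)[OF less_imp_le[OF e], of n "potential s" "potential t"] potential_lipschitz[of s t]
    unfolding z_def by linarith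
  have zc: "continuous_on UNIV (z n)" for n
    unfolding z_def shrink_def by (intro continuous_intros continuous_on_max continuous_on_min potential_continuous)
  have zz: "z n s = 0" if s: "s \<notin> {a + \<rho> n..b - \<rho> n}" for n s
    unfolding z_def
  proof (rule shrink_properties(4)[OF less_imp_le[OF e]])
    show "\<bar>potential s\<bar> \<le> e n"
    proof (cases "s \<in> {a<..<b}")
      case True
      then consider "\<bar>s - a\<bar> \<le> \<rho> n" | "\<bar>s - b\<bar> \<le> \<rho> n" using s by fastforce
      then show ?thesis
      proof cases
        case 1
        have "\<bar>potential s\<bar> \<le> M * \<bar>s - a\<bar>" using potential_lipschitz[of s a] potential_outside[of a] by simp
        also have "\<dots> \<le> M * \<rho> n" using 1 M_nonneg by (rule mult_left_mono)
        also have "\<dots> \<le> e n" by (rule \<rho>)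
        finally show ?thesis .
      next
        case 2
        have "\<bar>potential s\<bar> \<le> M * \<bar>s - b\<bar>" using potential_lipschitz[of s b] potential_outside[of b] by simp
        also have "\<dots> \<le> M * \<rho> n" using 2 M_nonneg by (rule mult_left_mono)
        also have "\<dots> \<le> e n" by (rule \<rho>)
        finally show ?thesis .
      qed
    next
      case False
      then show ?thesis using potential_outside[OF False] e[of n] by simp
    qed
  qed
  have h2: "0 < \<rho> n / 2" "a < a + \<rho> n - \<rho> n / 2" "b - \<rho> n < b" for n
    using \<rho>(1)[of n] by auto
  note H = Cc1_on_avg[OF zc zz h2]
  show ?thesis
  proof (rule that[of h])
    show "h n \<in> Cc1_on {a<..<b}" for n unfolding h_def by (rule H(2))
    show "\<bar>deriv (h n) s\<bar> \<le> M" for n s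
    proof -
      have "\<bar>z n (s + \<rho> n / 2) - z n s\<bar> \<le> M * (\<rho> n / 2)" using zlip[of n "s + \<rho> n / 2" s] h2(1)[of n] by simp
      moreover have "deriv (h n) s = (z n (s + \<rho> n / 2) - z n s) / (\<rho> n / 2)"
        unfolding h_def by (rule fun_cong[OF H(3)])
      ultimately show ?thesis using abs_divide_le[OF _ h2(1)] by (simp only:)
    qed
    show "\<bar>h n s - potential s\<bar> \<le> 2 / real (Suc n)" for n s
      unfolding h_def
    proof (rule avg_near[OF H(1) h2(1)])
      fix r assume r: "s < r" "r \<le> s + \<rho> n / 2"
      have "\<bar>potential r - potential s\<bar> \<le> M * \<bar>r - s\<bar>" by (rule potential_lipschitz)
      also have "\<dots> \<le> M * \<rho> n" using r \<rho>(1)[of n] M_nonneg by (intro mult_left_mono) auto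
      finally have "\<bar>potential r - potential s\<bar> \<le> e n" using \<rho>(2)[of n] by linarith
      moreover have "\<bar>z n r - potential r\<bar> \<le> e n" unfolding z_def by (rule shrink_properties(2)[OF less_imp_le[OF e]])
      ultimately have "\<bar>z n r - potential s\<bar> \<le> 2 * e n" by linarith
      then show "\<bar>z n r - potential s\<bar> \<le> 2 / real (Suc n)" by (simp add: e_def)
    qed
    show "\<bar>h n s\<bar> \<le> B" for n s
      unfolding h_def
    proof (rule avg_bound[OF H(1) h2(1)])
      fix r show "\<bar>z n r\<bar> \<le> B"
        using shrink_properties(3)[OF less_imp_le[OF e], of n "potential r"] B[of r] unfolding z_def by linarith
    qed
  qed
qed

text \<open>
  For a Lipschitz function \<open>v\<close> both \<open>\<integral> v h'\<close> and \<open>l v\<close> can be integrated by parts, and the claim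
  follows from the uniform convergence of \<open>h n\<close>. Replacing \<open>u\<close> by the average \<open>v\<close> costs at most
  \<open>2 M \<parallel>u - v\<parallel>\<close> in the \<open>L\<^sup>1\<close> norm, because the derivatives of \<open>h n\<close> are bounded by \<open>M\<close> and so is \<open>l\<close>.
\<close>
lemma derivative_pairing_tendsto:
  assumes u: "u \<in> bounded_borel a b"
    and h: "\<And>n. h n \<in> Cc1_on {a<..<b}" "\<And>n s. \<bar>deriv (h n) s\<bar> \<le> M"
      "\<And>n s. \<bar>h n s - potential s\<bar> \<le> \<epsilon> n" and \<epsilon>: "\<epsilon> \<longlonglongrightarrow> 0"
  shows "(\<lambda>n. LBINT s. u s * deriv (h n) s) \<longlonglongrightarrow> l u"
proof (rule LIMSEQ_I)
  fix e :: real assume e: "0 < e"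
  have ui: "integrable lborel u" by (rule bounded_borel_integrable[OF u])
  have um[measurable]: "u \<in> borel_measurable borel" by (rule bounded_borel_measurable[OF u])
  obtain C where C: "C \<ge> 0" "\<And>s. \<bar>u s\<bar> \<le> C" using bounded_borel_bound[OF u] by blast
  define d where "d n = inverse (real (Suc n))" for n
  have d: "\<And>n. 0 < d n" "d \<longlonglongrightarrow> 0" unfolding d_def using LIMSEQ_inverse_real_of_nat by auto
  define e1 where "e1 = (e / 4) / (M + 1)"
  have e1: "0 < e1" "M * e1 \<le> e / 4"
  proof -
    show e10: "0 < e1" using e M_nonneg by (simp add: e1_def)
    have "M * e1 \<le> (M + 1) * e1" using e10 by (intro mult_right_mono) auto
    also have "\<dots> = e / 4"
      using iffD1[OF nonzero_eq_divide_eq e1_def] M_nonneg by (simp add: mult.commute)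
    finally show "M * e1 \<le> e / 4" .
  qed
  have "eventually (\<lambda>n. (LBINT s. \<bar>avg (d n) u s - u s\<bar>) < e1) sequentially"
    using avg_tendsto_L1[OF ui d] e1(1) by (rule order_tendstoD(2))
  then obtain m where m: "(LBINT s. \<bar>avg (d m) u s - u s\<bar>) < e1" unfolding eventually_sequentially by blast
  define \<delta> where "\<delta> = d m"
  have \<delta>: "0 < \<delta>" using d(1) by (simp add: \<delta>_def)
  define \<xi> where "\<xi> s = indicator {a<..<b} s * ((u (s + \<delta>) - u s) / \<delta>)" for s
  have \<xi>: "\<xi> \<in> bounded_borel a b"
    unfolding \<xi>_def
  proof (rule bounded_borel_restrict)
    show "\<bar>(u (s + \<delta>) - u s) / \<delta>\<bar> \<le> 2 * C / \<delta>" for s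
      using C(2)[of s] C(2)[of "s + \<delta>"] \<delta> by (simp add: abs_divide divide_right_mono)
  qed measurable
  define v where "v s = indicator {a<..<b} s * (avg \<delta> u a + prim \<xi> s)" for s
  have v_eq: "v s = indicator {a<..<b} s * avg \<delta> u s" for s
    using prim_shift_difference[OF ui \<delta>, of s a b] unfolding v_def \<xi>_def[abs_def] by (cases "s \<in> {a<..<b}") auto
  have v: "v \<in> bounded_borel a b" and lv: "l v = - (LBINT s. potential s * \<xi> s)"
    unfolding v_def by (rule integration_by_parts[OF \<xi>])+
  have uv: "u - v \<in> bounded_borel a b" by (rule subspace_diff[OF subspace_bounded_borel u v])
  have dist: "(LBINT s. \<bar>(u - v) s\<bar>) \<le> e1"
  proof -
    have "(LBINT s. \<bar>(u - v) s\<bar>) \<le> (LBINT s. \<bar>avg \<delta> u s - u s\<bar>)"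
    proof (rule integral_mono)
      show "integrable lborel (\<lambda>s. \<bar>(u - v) s\<bar>)" by (rule integrable_abs[OF bounded_borel_integrable[OF uv]])
      show "integrable lborel (\<lambda>s. \<bar>avg \<delta> u s - u s\<bar>)" using avg_L1_contraction(1)[OF ui \<delta>] ui by auto
      show "\<bar>(u - v) s\<bar> \<le> \<bar>avg \<delta> u s - u s\<bar>" for s
        using bounded_borel_zero[OF u, of s] by (cases "s \<in> {a<..<b}") (simp_all add: v_eq)
    qed
    then show ?thesis using m by (simp add: \<delta>_def)
  qed
  have \<xi>i: "integrable lborel (\<lambda>s. \<bar>\<xi> s\<bar>)" using bounded_borel_integrable[OF \<xi>] by simp
  define X where "X = (LBINT s. \<bar>\<xi> s\<bar>)"
  have "(\<lambda>n. \<epsilon> n * X) \<longlonglongrightarrow> 0 * X" by (intro tendsto_intros \<epsilon>)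
  then have "eventually (\<lambda>n. \<epsilon> n * X < e / 4) sequentially" using e by (intro order_tendstoD(2)) auto
  then obtain n0 where n0: "\<And>n. n \<ge> n0 \<Longrightarrow> \<epsilon> n * X < e / 4" unfolding eventually_sequentially by blast
  show "\<exists>n0. \<forall>n\<ge>n0. norm ((LBINT s. u s * deriv (h n) s) - l u) < e"
  proof (intro exI[of _ n0] allI impI)
    fix n assume n: "n \<ge> n0"
    note hb = Cc1_on_bounded_borel[OF h(1)[of n] ab]
    have hx: "integrable lborel (\<lambda>s. w s * \<xi> s)" if "w \<in> bounded_borel a b" for w
      by (rule integrable_mult_bounded[OF bounded_borel_integrable[OF that] \<xi>])
    have i: "integrable lborel (\<lambda>s. w s * deriv (h n) s)" if "w \<in> bounded_borel a b" for w
      by (rule integrable_mult_bounded[OF bounded_borel_integrable[OF that] hb(2)])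
    have 1: "\<bar>LBINT s. (u - v) s * deriv (h n) s\<bar> \<le> M * e1"
    proof -
      have "\<bar>LBINT s. (u - v) s * deriv (h n) s\<bar> \<le> (LBINT s. \<bar>(u - v) s * deriv (h n) s\<bar>)"
        by (rule integral_abs_bound)
      also have "\<dots> \<le> (LBINT s. M * \<bar>(u - v) s\<bar>)"
      proof (rule integral_mono)
        show "integrable lborel (\<lambda>s. \<bar>(u - v) s * deriv (h n) s\<bar>)" by (rule integrable_abs[OF i[OF uv]])
        show "integrable lborel (\<lambda>s. M * \<bar>(u - v) s\<bar>)"
          by (intro integrable_mult_right integrable_abs bounded_borel_integrable[OF uv])
        show "\<bar>(u - v) s * deriv (h n) s\<bar> \<le> M * \<bar>(u - v) s\<bar>" for s
          using mult_right_mono[OF h(2)[of n s], of "\<bar>(u - v) s\<bar>"] by (simp add: abs_mult mult.commute)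
      qed
      also have "\<dots> \<le> M * e1" using dist M_nonneg by (simp add: mult_left_mono)
      finally show ?thesis .
    qed
    have 2: "\<bar>l (u - v)\<bar> \<le> M * e1" using bound[OF uv] dist M_nonneg by (meson mult_left_mono order_trans)
    have 3: "\<bar>(LBINT s. v s * deriv (h n) s) - l v\<bar> \<le> \<epsilon> n * X"
    proof -
      have "(LBINT s. v s * deriv (h n) s) = - (LBINT s. h n s * \<xi> s)"
        unfolding v_def by (rule test_function_by_parts[OF h(1) ab \<xi>])
      then have "(LBINT s. v s * deriv (h n) s) - l v = (LBINT s. potential s * \<xi> s - h n s * \<xi> s)"
        using hx[OF potential_bounded_borel] hx[OF hb(1)] by (simp add: lv)
      also have "\<bar>\<dots>\<bar> \<le> (LBINT s. \<bar>potential s * \<xi> s - h n s * \<xi> s\<bar>)" by (rule integral_abs_bound)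
      also have "\<dots> \<le> (LBINT s. \<epsilon> n * \<bar>\<xi> s\<bar>)"
      proof (rule integral_mono)
        fix s
        have "\<bar>potential s * \<xi> s - h n s * \<xi> s\<bar> = \<bar>h n s - potential s\<bar> * \<bar>\<xi> s\<bar>"
          unfolding left_diff_distrib[symmetric] abs_mult by (simp only: abs_minus_commute)
        also have "\<dots> \<le> \<epsilon> n * \<bar>\<xi> s\<bar>" by (rule mult_right_mono[OF h(3)]) simp
        finally show "\<bar>potential s * \<xi> s - h n s * \<xi> s\<bar> \<le> \<epsilon> n * \<bar>\<xi> s\<bar>" .
      qed (use hx[OF potential_bounded_borel] hx[OF hb(1)] \<xi>i in auto)
      finally show ?thesis by (simp add: X_def)
    qed
    have "(LBINT s. (u - v) s * deriv (h n) s) = (LBINT s. u s * deriv (h n) s) - (LBINT s. v s * deriv (h n) s)"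
      using i[OF u] i[OF v] by (simp add: left_diff_distrib)
    moreover have "l (u - v) = l u - l v" by (rule diff[OF u v])
    ultimately have "\<bar>(LBINT s. u s * deriv (h n) s) - l u\<bar> \<le> M * e1 + M * e1 + \<epsilon> n * X"
      using 1 2 3 by linarith
    then show "norm ((LBINT s. u s * deriv (h n) s) - l u) < e"
      using n0[OF n] e1(2) e by simp
  qed
qed

end

text \<open>
  The potential acts as a calibration: by \<open>area_ge_profile\<close> the area of \<open>u\<close> is never below the right-hand side of
  \<open>optimal\<close>, so the potential attains the supremum that defines the area. The bound by \<open>r < halfwidth\<close>
  leaves room for variations of the potential in every direction.
\<close>
locale dual_certificate = symmetric_anisotropy \<phi> + bounded_functional a b l M
  for \<phi> a b l M +
  fixes u :: "real \<Rightarrow> real" and A r :: real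
  assumes u: "u \<in> bounded_borel a b"
    and area: "aniso_area \<phi> {a<..<b} u \<le> ereal A"
    and r: "0 < r" "r < halfwidth"
    and potential_le: "\<And>s. \<bar>potential s\<bar> \<le> r"
    and optimal: "A \<le> l u + (LBINT s. indicator {a<..<b} s * profile (potential s))"
begin

text \<open>
  Half of the room between \<open>r\<close> and \<open>halfwidth\<close> is used for variations of the potential.
\<close>
definition radius :: real where "radius = (r + halfwidth) / 2"

lemma radius: "r < radius" "radius < halfwidth" "0 < radius" using r by (auto simp: radius_def)

definition clip :: "real \<Rightarrow> real" where "clip y = max (- radius) (min radius y)"

lemma clip: "\<bar>clip y\<bar> \<le> radius" "\<bar>y\<bar> \<le> radius \<Longrightarrow> clip y = y"
  using radius(3) by (auto simp: clip_def)

lemma profile_integrable: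
  assumes [measurable]: "f \<in> borel_measurable borel" and "\<And>s. \<bar>f s\<bar> \<le> radius"
  shows "(\<lambda>s. indicator {a<..<b} s * profile (f s)) \<in> bounded_borel a b"
proof -
  have [measurable]: "(\<lambda>y. profile (clip y)) \<in> borel_measurable borel"
    unfolding clip_def using clamped_profile_continuous[of radius] radius by (intro borel_measurable_continuous_onI) auto
  have "(\<lambda>s. indicator {a<..<b} s * profile (clip (f s))) \<in> bounded_borel a b"
  proof (rule bounded_borel_restrict)
    show "\<bar>profile (clip (f s))\<bar> \<le> profile 0" for s
      using clip(1)[of "f s"] radius(2) profile_nonneg[of "clip (f s)"] profile_le_max[of "clip (f s)"] by auto
  qed measurable
  then show ?thesis using assms(2) by (simp add: clip)
qed

lemma slope_integrable:
  assumes [measurable]: "f \<in> borel_measurable borel"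
  shows "(\<lambda>s. indicator {a<..<b} s * slope (clip (f s))) \<in> bounded_borel a b"
proof (rule bounded_borel_restrict)
  have [measurable]: "(\<lambda>y. slope (clip y)) \<in> borel_measurable borel"
    unfolding clip_def using clamped_slope_measurable[of radius] radius by auto
  show "(\<lambda>s. slope (clip (f s))) \<in> borel_measurable borel" by measurable
  show "\<bar>slope (clip (f s))\<bar> \<le> slope_bound radius" for s
    by (rule slope_bounded[OF radius(2) clip(1)])
qed

text \<open>
  The competitor \<open>potential + t * \<eta>\<close> in the supremum that defines the area cannot beat the potential, and the
  profile at both points is compared by a supergradient. For \<open>\<eta>\<close> and \<open>- \<eta>\<close> together, the limit \<open>t \<rightarrow> 0\<close> leads to
  the Euler-Lagrange equation \<open>u' = slope potential\<close>.
\<close>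
lemma variation_le:
  assumes \<eta>: "\<eta> \<in> Cc1_on {a<..<b}"
  obtains t0 where "0 < t0" "\<And>t s. 0 < t \<Longrightarrow> t \<le> t0 \<Longrightarrow> \<bar>potential s + t * \<eta> s\<bar> \<le> radius"
    "\<And>t. 0 < t \<Longrightarrow> t \<le> t0 \<Longrightarrow>
      (LBINT s. u s * deriv \<eta> s) \<le> - (LBINT s. (indicator {a<..<b} s * slope (clip (potential s + t * \<eta> s))) * \<eta> s)"
proof -
  note \<eta>b = Cc1_on_bounded_borel[OF \<eta> ab]
  have [measurable]: "\<eta> \<in> borel_measurable borel" by (rule bounded_borel_measurable[OF \<eta>b(1)])
  have ui: "integrable lborel u" by (rule bounded_borel_integrable[OF u])
  obtain B where B: "B \<ge> 0" "\<And>s. \<bar>\<eta> s\<bar> \<le> B" using bounded_borel_bound[OF \<eta>b(1)] by blast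
  define t0 where "t0 = (radius - r) / (B + 1)"
  have t0: "0 < t0" using radius B by (simp add: t0_def)
  have tB: "\<bar>t * \<eta> s\<bar> \<le> radius - r" if t: "0 < t" "t \<le> t0" for t s
  proof -
    have "\<bar>t * \<eta> s\<bar> \<le> t0 * (B + 1)" unfolding abs_mult using t B(2)[of s] t0 by (intro mult_mono) auto
    also have "\<dots> = radius - r" using B by (simp add: t0_def)
    finally show ?thesis .
  qed
  have pt: "\<bar>potential s + t * \<eta> s\<bar> \<le> radius" if "0 < t" "t \<le> t0" for t s
    using tB[OF that, of s] potential_le[of s] by linarith
  obtain h where h: "\<And>n. h n \<in> Cc1_on {a<..<b}" "\<And>n s. \<bar>deriv (h n) s\<bar> \<le> M"
    "\<And>n s. \<bar>h n s - potential s\<bar> \<le> 2 / real (Suc n)"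
    and hr: "\<And>n s. \<bar>h n s\<bar> \<le> r"
    by (rule potential_approximation[OF potential_le]) (rule that)
  have [measurable]: "h n \<in> borel_measurable borel" for n
    by (rule bounded_borel_measurable[OF Cc1_on_bounded_borel(1)[OF h(1) ab]])
  have "(\<lambda>n. 2 * inverse (real (Suc n))) \<longlonglongrightarrow> 2 * 0" by (intro tendsto_intros LIMSEQ_inverse_real_of_nat)
  then have null: "(\<lambda>n. 2 / real (Suc n)) \<longlonglongrightarrow> 0" by (simp add: divide_inverse)
  have lim1: "(\<lambda>n. LBINT s. u s * deriv (h n) s) \<longlonglongrightarrow> l u"
    by (rule derivative_pairing_tendsto[OF u h null])
  have main: "(LBINT s. u s * deriv \<eta> s) \<le> - (LBINT s. (indicator {a<..<b} s * slope (clip (potential s + t * \<eta> s))) * \<eta> s)"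
    if t: "0 < t" "t \<le> t0" for t
  proof -
    have hr': "\<bar>h n s + t * \<eta> s\<bar> \<le> radius" for n s using tB[OF t, of s] hr[of n s] by linarith
    have low: "(LBINT s. u s * deriv (h n) s) + t * (LBINT s. u s * deriv \<eta> s)
        + (LBINT s. indicator {a<..<b} s * profile (h n s + t * \<eta> s)) \<le> A" for n
    proof -
      note L = Cc1_on_lincomb[OF h(1)[of n] \<eta> ab, of t]
      have "(LBINT s. u s * deriv (\<lambda>s. h n s + t * \<eta> s) s)
          + (LBINT s. indicator {a<..<b} s * profile (h n s + t * \<eta> s)) \<le> A"
        by (rule area_ge_profile[OF ui ab L(1) hr' radius(2) area])
      moreover have "(LBINT s. u s * deriv (\<lambda>s. h n s + t * \<eta> s) s)
          = (LBINT s. u s * deriv (h n) s + t * (u s * deriv \<eta> s))"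
        unfolding L(2) by (intro Bochner_Integration.integral_cong) (auto simp: algebra_simps)
      moreover have "\<dots> = (LBINT s. u s * deriv (h n) s) + t * (LBINT s. u s * deriv \<eta> s)"
        using integrable_mult_bounded[OF ui Cc1_on_bounded_borel(2)[OF h(1)[of n] ab]] integrable_mult_bounded[OF ui \<eta>b(2)]
        by simp
      ultimately show ?thesis by simp
    qed
    have lim2: "(\<lambda>n. LBINT s. indicator {a<..<b} s * profile (h n s + t * \<eta> s))
        \<longlonglongrightarrow> (LBINT s. indicator {a<..<b} s * profile (potential s + t * \<eta> s))"
    proof (rule integral_dominated_convergence[where w="\<lambda>s. profile 0 * indicator {a..b} s"])
      show "AE s in lborel. (\<lambda>n. indicator {a<..<b} s * profile (h n s + t * \<eta> s))
          \<longlonglongrightarrow> indicator {a<..<b} s * profile (potential s + t * \<eta> s)"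
      proof (intro AE_I2 tendsto_mult tendsto_const)
        fix s
        have "(\<lambda>n. slope_bound radius * (2 / real (Suc n))) \<longlonglongrightarrow> slope_bound radius * 0" by (intro tendsto_mult tendsto_const null)
        then have "(\<lambda>n. slope_bound radius * (2 / real (Suc n))) \<longlonglongrightarrow> 0" by simp
        moreover have "\<forall>n. norm (profile (h n s + t * \<eta> s) - profile (potential s + t * \<eta> s)) \<le> slope_bound radius * (2 / real (Suc n))"
        proof
          fix n
          have "\<bar>profile (h n s + t * \<eta> s) - profile (potential s + t * \<eta> s)\<bar>
              \<le> slope_bound radius * \<bar>(h n s + t * \<eta> s) - (potential s + t * \<eta> s)\<bar>"
            by (rule profile_lipschitz[OF radius(2) hr' pt[OF t]])
          also have "\<dots> \<le> slope_bound radius * (2 / real (Suc n))"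
            using h(3)[of n s] by (intro mult_left_mono slope_bound_nonneg) simp
          finally show "norm (profile (h n s + t * \<eta> s) - profile (potential s + t * \<eta> s)) \<le> slope_bound radius * (2 / real (Suc n))"
            by (simp only: real_norm_def)
        qed
        ultimately have "(\<lambda>n. profile (h n s + t * \<eta> s) - profile (potential s + t * \<eta> s)) \<longlonglongrightarrow> 0"
          by (rule Lim_null_comparison[OF always_eventually, rotated])
        then show "(\<lambda>n. profile (h n s + t * \<eta> s)) \<longlonglongrightarrow> profile (potential s + t * \<eta> s)" by (simp add: LIM_zero_iff)
      qed
      show "(\<lambda>s. indicator {a<..<b} s * profile (h n s + t * \<eta> s)) \<in> borel_measurable lborel" for n
        using bounded_borel_measurable[OF profile_integrable[of "\<lambda>s. h n s + t * \<eta> s"]] hr' by simp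
      show "(\<lambda>s. indicator {a<..<b} s * profile (potential s + t * \<eta> s)) \<in> borel_measurable lborel"
        using bounded_borel_measurable[OF profile_integrable[of "\<lambda>s. potential s + t * \<eta> s"]] pt[OF t] by simp
      show "AE s in lborel. norm (indicator {a<..<b} s * profile (h n s + t * \<eta> s)) \<le> profile 0 * indicator {a..b} s" for n
      proof (rule AE_I2)
        fix s
        have "\<bar>h n s + t * \<eta> s\<bar> \<le> halfwidth" using hr'[of n s] radius(2) by linarith
        then show "norm (indicator {a<..<b} s * profile (h n s + t * \<eta> s)) \<le> profile 0 * indicator {a..b} s"
          using profile_nonneg profile_le_max profile_zero_pos by (auto split: split_indicator)
      qed
    qed simp
    have lim3: "(\<lambda>n. (LBINT s. u s * deriv (h n) s) + t * (LBINT s. u s * deriv \<eta> s)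
        + (LBINT s. indicator {a<..<b} s * profile (h n s + t * \<eta> s)))
        \<longlonglongrightarrow> l u + t * (LBINT s. u s * deriv \<eta> s) + (LBINT s. indicator {a<..<b} s * profile (potential s + t * \<eta> s))"
      by (intro tendsto_add lim1 lim2 tendsto_const)
    have "l u + t * (LBINT s. u s * deriv \<eta> s) + (LBINT s. indicator {a<..<b} s * profile (potential s + t * \<eta> s)) \<le> A"
      by (rule LIMSEQ_le_const2[OF lim3]) (use low in auto)
    then have ineq: "t * (LBINT s. u s * deriv \<eta> s) + (LBINT s. indicator {a<..<b} s * profile (potential s + t * \<eta> s))
        \<le> (LBINT s. indicator {a<..<b} s * profile (potential s))" using optimal by linarith
    have pb: "\<bar>potential s\<bar> \<le> radius" for s using potential_le[of s] radius(1) by linarith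
    have S: "(\<lambda>s. indicator {a<..<b} s * slope (clip (potential s + t * \<eta> s))) \<in> bounded_borel a b"
      by (rule slope_integrable) measurable
    have Si: "integrable lborel (\<lambda>s. (indicator {a<..<b} s * slope (clip (potential s + t * \<eta> s))) * \<eta> s)"
      by (rule integrable_mult_bounded[OF bounded_borel_integrable[OF S] \<eta>b(1)])
    have Pi: "integrable lborel (\<lambda>s. indicator {a<..<b} s * profile (potential s + t * \<eta> s))"
      by (rule bounded_borel_integrable[OF profile_integrable]) (use pt[OF t] in auto)
    have "(LBINT s. indicator {a<..<b} s * profile (potential s))
        \<le> (LBINT s. indicator {a<..<b} s * profile (potential s + t * \<eta> s)
            - t * ((indicator {a<..<b} s * slope (clip (potential s + t * \<eta> s))) * \<eta> s))"
    proof (rule integral_mono)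
      show "integrable lborel (\<lambda>s. indicator {a<..<b} s * profile (potential s))"
        by (rule bounded_borel_integrable[OF profile_integrable]) (use pb in auto)
      show "integrable lborel (\<lambda>s. indicator {a<..<b} s * profile (potential s + t * \<eta> s)
            - t * ((indicator {a<..<b} s * slope (clip (potential s + t * \<eta> s))) * \<eta> s))"
        by (intro Bochner_Integration.integrable_diff integrable_mult_right Pi Si)
      fix s
      have "profile (potential s) \<le> profile (potential s + t * \<eta> s)
          + slope (potential s + t * \<eta> s) * (potential s - (potential s + t * \<eta> s))"
        using pt[OF t, of s] pb[of s] radius(2) by (intro profile_le_slope) linarith+
      then have "profile (potential s) \<le> profile (potential s + t * \<eta> s)
          - t * (slope (clip (potential s + t * \<eta> s)) * \<eta> s)"
        using clip(2)[OF pt[OF t, of s]] by (simp add: algebra_simps)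
      then show "indicator {a<..<b} s * profile (potential s) \<le> indicator {a<..<b} s * profile (potential s + t * \<eta> s)
            - t * ((indicator {a<..<b} s * slope (clip (potential s + t * \<eta> s))) * \<eta> s)"
        by (auto split: split_indicator)
    qed
    also have "\<dots> = (LBINT s. indicator {a<..<b} s * profile (potential s + t * \<eta> s))
        - t * (LBINT s. (indicator {a<..<b} s * slope (clip (potential s + t * \<eta> s))) * \<eta> s)"
      using Pi Si by simp
    finally have "t * (LBINT s. u s * deriv \<eta> s)
        \<le> t * - (LBINT s. (indicator {a<..<b} s * slope (clip (potential s + t * \<eta> s))) * \<eta> s)"
      using ineq by linarith
    then show ?thesis using t(1) by (simp only: mult_le_cancel_left_pos)
  qed
  show ?thesis by (rule that[OF t0 pt main])
qed

lemma uminus_test: "\<eta> \<in> Cc1_on {a<..<b} \<Longrightarrow> (\<lambda>s. - \<eta> s) \<in> Cc1_on {a<..<b}"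
  "\<eta> \<in> Cc1_on {a<..<b} \<Longrightarrow> deriv (\<lambda>s. - \<eta> s) = (\<lambda>s. - deriv \<eta> s)"
  using Cc1_on_lincomb[of \<eta> a b \<eta> "-2"] ab by auto

text \<open>
  The slope is bounded on the range of the potential, so the distributional derivative of \<open>u\<close> is bounded.
\<close>
theorem lipschitz: "\<exists>Z w. Z \<in> null_sets lborel \<and> (\<forall>s\<in>{a<..<b} - Z. u s = w s) \<and> (slope_bound radius)-lipschitz_on UNIV w"
proof -
  have le: "(LBINT s. u s * deriv \<eta> s) \<le> slope_bound radius * (LBINT s. \<bar>\<eta> s\<bar>)"
    if \<eta>: "\<eta> \<in> Cc1_on {a<..<b}" for \<eta>
  proof -
    note \<eta>b = Cc1_on_bounded_borel[OF \<eta> ab]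
    have [measurable]: "\<eta> \<in> borel_measurable borel" by (rule bounded_borel_measurable[OF \<eta>b(1)])
    obtain t where t: "(LBINT s. u s * deriv \<eta> s)
        \<le> - (LBINT s. (indicator {a<..<b} s * slope (clip (potential s + t * \<eta> s))) * \<eta> s)"
      by (rule variation_le[OF \<eta>]) blast
    have S: "(\<lambda>s. indicator {a<..<b} s * slope (clip (potential s + t * \<eta> s))) \<in> bounded_borel a b"
      by (rule slope_integrable) measurable
    have Si: "integrable lborel (\<lambda>s. (indicator {a<..<b} s * slope (clip (potential s + t * \<eta> s))) * \<eta> s)"
      by (rule integrable_mult_bounded[OF bounded_borel_integrable[OF S] \<eta>b(1)])
    have "- (LBINT s. (indicator {a<..<b} s * slope (clip (potential s + t * \<eta> s))) * \<eta> s)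
        = (LBINT s. - ((indicator {a<..<b} s * slope (clip (potential s + t * \<eta> s))) * \<eta> s))" by simp
    also have "\<dots> \<le> (LBINT s. slope_bound radius * \<bar>\<eta> s\<bar>)"
    proof (rule integral_mono)
      fix s
      have "\<bar>slope (clip (potential s + t * \<eta> s)) * \<eta> s\<bar> \<le> slope_bound radius * \<bar>\<eta> s\<bar>"
        unfolding abs_mult by (intro mult_right_mono slope_bounded[OF radius(2) clip(1)]) simp
      moreover have "0 \<le> slope_bound radius * \<bar>\<eta> s\<bar>" by (simp add: slope_bound_nonneg)
      ultimately show "- ((indicator {a<..<b} s * slope (clip (potential s + t * \<eta> s))) * \<eta> s) \<le> slope_bound radius * \<bar>\<eta> s\<bar>"
        by (auto split: split_indicator)
    qed (use Si bounded_borel_integrable[OF \<eta>b(1)] in auto)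
    finally show ?thesis using t by simp
  qed
  have test: "\<bar>LBINT s. u s * deriv \<eta> s\<bar> \<le> 0 + slope_bound radius * (d - c)"
    if c: "a < c" "c \<le> d" "d < b" and \<eta>: "\<eta> \<in> Cc1_on {a<..<b}" and \<eta>1: "\<And>s. 0 \<le> \<eta> s \<and> \<eta> s \<le> 1"
      and \<eta>0: "\<And>s. s \<notin> {c..d} \<Longrightarrow> \<eta> s = 0" for c d \<eta>
  proof -
    have "(LBINT s. \<bar>\<eta> s\<bar>) \<le> (LBINT s. indicator {c..d} s)"
    proof (rule integral_mono)
      show "integrable lborel (\<lambda>s. \<bar>\<eta> s\<bar>)"
        using bounded_borel_integrable[OF Cc1_on_bounded_borel(1)[OF \<eta> ab]] by simp
      show "\<bar>\<eta> s\<bar> \<le> indicator {c..d} s" for s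
        using \<eta>1[of s] \<eta>0[of s] by (cases "s \<in> {c..d}") auto
    qed simp
    then have I: "slope_bound radius * (LBINT s. \<bar>\<eta> s\<bar>) \<le> slope_bound radius * (d - c)"
      using c slope_bound_nonneg by (intro mult_left_mono) auto
    have "(LBINT s. u s * deriv (\<lambda>s. - \<eta> s) s) = - (LBINT s. u s * deriv \<eta> s)"
      unfolding uminus_test(2)[OF \<eta>] by simp
    then show ?thesis using le[OF \<eta>] le[OF uminus_test(1)[OF \<eta>]] I by simp
  qed
  obtain Z where Z: "Z \<in> null_sets lborel"
    "\<And>s t. s \<in> {a<..<b} - Z \<Longrightarrow> t \<in> {a<..<b} - Z \<Longrightarrow> \<bar>u s - u t\<bar> \<le> 0 + slope_bound radius * \<bar>s - t\<bar>"
    by (rule AE_modulus_from_test_functions[OF bounded_borel_integrable[OF u] ab test]) (assumption | rule that)+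
  have Z2: "\<bar>u s - u t\<bar> \<le> slope_bound radius * \<bar>s - t\<bar>" if "s \<in> {a<..<b} - Z" "t \<in> {a<..<b} - Z" for s t
    using Z(2)[OF that] by simp
  obtain w where "\<And>s. s \<in> {a<..<b} - Z \<Longrightarrow> u s = w s" "(slope_bound radius)-lipschitz_on UNIV w"
    by (rule lipschitz_extension_AE[OF ab Z(1) slope_bound_nonneg Z2]) (assumption | rule that)+
  then show ?thesis using Z(1) by blast
qed

text \<open>
  When the slope is Lipschitz, the variational inequality becomes an equation in the limit, and \<open>u\<close> is a
  primitive of the Lipschitz function \<open>slope potential\<close> up to a constant.
\<close>
theorem differentiable:
  assumes C2: "C2_on (- {0}) \<phi>"
  shows "\<exists>Z w. Z \<in> null_sets lborel \<and> (\<forall>s\<in>{a<..<b} - Z. u s = w s) \<and> w C1_differentiable_on {a<..<b}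
      \<and> (\<exists>C. C-lipschitz_on {a<..<b} (deriv w))"
proof -
  obtain K where K: "0 \<le> K" "\<And>y z. \<bar>y\<bar> \<le> radius \<Longrightarrow> \<bar>z\<bar> \<le> radius \<Longrightarrow> \<bar>slope y - slope z\<bar> \<le> K * \<bar>y - z\<bar>"
    by (rule slope_lipschitz[OF C2 less_imp_le[OF radius(3)] radius(2)]) (rule that)
  have pb: "\<bar>potential s\<bar> \<le> radius" for s using potential_le[of s] radius(1) by linarith
  define q where "q s = indicator {a<..<b} s * slope (clip (potential s))" for s
  have q: "q \<in> bounded_borel a b" unfolding q_def by (rule slope_integrable) measurable
  have q_eq: "q s = slope (potential s)" if "s \<in> {a<..<b}" for s using that pb[of s] by (simp add: q_def clip)
  have le: "(LBINT s. u s * deriv \<eta> s) \<le> - (LBINT s. \<eta> s * q s)"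
    if \<eta>: "\<eta> \<in> Cc1_on {a<..<b}" for \<eta>
  proof -
    note \<eta>b = Cc1_on_bounded_borel[OF \<eta> ab]
    have [measurable]: "\<eta> \<in> borel_measurable borel" by (rule bounded_borel_measurable[OF \<eta>b(1)])
    obtain t0 where t0: "0 < t0" and pt: "\<And>t s. 0 < t \<Longrightarrow> t \<le> t0 \<Longrightarrow> \<bar>potential s + t * \<eta> s\<bar> \<le> radius"
      and var: "\<And>t. 0 < t \<Longrightarrow> t \<le> t0 \<Longrightarrow> (LBINT s. u s * deriv \<eta> s)
        \<le> - (LBINT s. (indicator {a<..<b} s * slope (clip (potential s + t * \<eta> s))) * \<eta> s)"
      by (rule variation_le[OF \<eta>]) (rule that)
    have qi: "integrable lborel (\<lambda>s. \<eta> s * q s)" by (rule integrable_mult_bounded[OF bounded_borel_integrable[OF \<eta>b(1)] q])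
    have \<eta>2: "integrable lborel (\<lambda>s. \<eta> s * \<eta> s)" by (rule integrable_mult_bounded[OF bounded_borel_integrable[OF \<eta>b(1)] \<eta>b(1)])
    define Q where "Q = (LBINT s. \<eta> s * \<eta> s)"
    have est: "(LBINT s. u s * deriv \<eta> s) \<le> - (LBINT s. \<eta> s * q s) + t * (K * Q)" if t: "0 < t" "t \<le> t0" for t
    proof -
      have S: "(\<lambda>s. indicator {a<..<b} s * slope (clip (potential s + t * \<eta> s))) \<in> bounded_borel a b"
        by (rule slope_integrable) measurable
      have Si: "integrable lborel (\<lambda>s. (indicator {a<..<b} s * slope (clip (potential s + t * \<eta> s))) * \<eta> s)"
        by (rule integrable_mult_bounded[OF bounded_borel_integrable[OF S] \<eta>b(1)])
      have "- (LBINT s. (indicator {a<..<b} s * slope (clip (potential s + t * \<eta> s))) * \<eta> s)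
          = (LBINT s. - ((indicator {a<..<b} s * slope (clip (potential s + t * \<eta> s))) * \<eta> s))" by simp
      also have "\<dots> \<le> (LBINT s. - (\<eta> s * q s) + (t * K) * (\<eta> s * \<eta> s))"
      proof (rule integral_mono)
        fix s
        show "- ((indicator {a<..<b} s * slope (clip (potential s + t * \<eta> s))) * \<eta> s) \<le> - (\<eta> s * q s) + (t * K) * (\<eta> s * \<eta> s)"
        proof (cases "s \<in> {a<..<b}")
          case True
          have "\<bar>slope (potential s) - slope (potential s + t * \<eta> s)\<bar> \<le> K * \<bar>t * \<eta> s\<bar>"
            using K(2)[OF pb pt[OF t], of s s] by simp
          then have "\<bar>slope (potential s) - slope (potential s + t * \<eta> s)\<bar> * \<bar>\<eta> s\<bar> \<le> (K * \<bar>t * \<eta> s\<bar>) * \<bar>\<eta> s\<bar>"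
            by (rule mult_right_mono) simp
          also have "\<dots> = (t * K) * (\<eta> s * \<eta> s)" using t(1) by (simp add: abs_mult)
          finally have "(slope (potential s) - slope (potential s + t * \<eta> s)) * \<eta> s \<le> (t * K) * (\<eta> s * \<eta> s)"
            unfolding abs_mult[symmetric] by linarith
          then show ?thesis using True q_eq[OF True] clip(2)[OF pt[OF t, of s]] by (simp add: algebra_simps)
        next
          case False
          then show ?thesis using bounded_borel_zero[OF \<eta>b(1) False] by simp
        qed
      qed (use Si qi \<eta>2 in auto)
      also have "\<dots> = - (LBINT s. \<eta> s * q s) + t * (K * Q)"
        using qi \<eta>2 by (simp add: Q_def)
      finally show ?thesis using var[OF t] by linarith
    qed
    show ?thesis
    proof (rule field_le_epsilon)
      fix e :: real assume e: "0 < e"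
      have "0 \<le> Q" unfolding Q_def by (rule Bochner_Integration.integral_nonneg) simp
      then have Q0: "0 \<le> K * Q" using K(1) by simp
      define t where "t = min t0 (e / (K * Q + 1))"
      have t: "0 < t" "t \<le> t0" using t0 e Q0 by (auto simp: t_def)
      have "t \<le> e / (K * Q + 1)" by (simp add: t_def)
      then have "t * (K * Q + 1) \<le> e" using Q0 by (simp add: pos_le_divide_eq)
      then have "t * (K * Q) \<le> e" using t(1) by (simp add: algebra_simps)
      then show "(LBINT s. u s * deriv \<eta> s) \<le> - (LBINT s. \<eta> s * q s) + e" using est[OF t] by linarith
    qed
  qed
  define P where "P s = indicator {a<..<b} s * (0 + prim q s)" for s
  have P: "P \<in> bounded_borel a b" unfolding P_def by (rule integration_by_parts(1)[OF q])
  have zero: "(LBINT s. (u - P) s * deriv \<eta> s) = 0" if \<eta>: "\<eta> \<in> Cc1_on {a<..<b}" for \<eta>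
  proof -
    note \<eta>b = Cc1_on_bounded_borel[OF \<eta> ab]
    have "(LBINT s. u s * deriv (\<lambda>s. - \<eta> s) s) = - (LBINT s. u s * deriv \<eta> s)"
      unfolding uminus_test(2)[OF \<eta>] by simp
    then have eq: "(LBINT s. u s * deriv \<eta> s) = - (LBINT s. \<eta> s * q s)"
      using le[OF \<eta>] le[OF uminus_test(1)[OF \<eta>]] by simp
    have "(LBINT s. (u - P) s * deriv \<eta> s) = (LBINT s. u s * deriv \<eta> s - P s * deriv \<eta> s)"
      by (intro Bochner_Integration.integral_cong) (auto simp: algebra_simps)
    also have "\<dots> = (LBINT s. u s * deriv \<eta> s) - (LBINT s. P s * deriv \<eta> s)"
      by (intro Bochner_Integration.integral_diff integrable_mult_bounded[OF bounded_borel_integrable[OF u] \<eta>b(2)]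
          integrable_mult_bounded[OF bounded_borel_integrable[OF P] \<eta>b(2)])
    also have "(LBINT s. P s * deriv \<eta> s) = - (LBINT s. \<eta> s * q s)"
      unfolding P_def by (rule test_function_by_parts[OF \<eta> ab q])
    finally show ?thesis using eq by simp
  qed
  have uP: "u - P \<in> bounded_borel a b" by (rule subspace_diff[OF subspace_bounded_borel u P])
  have test: "\<bar>LBINT s. (u - P) s * deriv \<eta> s\<bar> \<le> 0 + 0 * (d - c)" if "\<eta> \<in> Cc1_on {a<..<b}" for \<eta> c d
    using zero[OF that] by simp
  obtain Z where Z: "Z \<in> null_sets lborel"
    "\<And>s t. s \<in> {a<..<b} - Z \<Longrightarrow> t \<in> {a<..<b} - Z \<Longrightarrow> \<bar>(u - P) s - (u - P) t\<bar> \<le> 0 + 0 * \<bar>s - t\<bar>"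
    by (rule AE_modulus_from_test_functions[OF bounded_borel_integrable[OF uP] ab test]) (assumption | rule that)+
  obtain s0 where s0: "s0 \<in> {a<..<b} - Z"
  proof -
    have "\<not> {a<..<b} \<subseteq> Z"
    proof
      assume "{a<..<b} \<subseteq> Z"
      then have "emeasure lborel {a<..<b} \<le> emeasure lborel Z" using Z by (intro emeasure_mono) auto
      then show False using Z ab by (auto simp: null_sets_def)
    qed
    then show ?thesis using that by blast
  qed
  define c where "c = (u - P) s0"
  define w where "w s = c + prim q s" for s
  have uw: "u s = w s" if s: "s \<in> {a<..<b} - Z" for s
    using Z(2)[OF s s0] s by (simp add: w_def c_def P_def)
  have lip: "\<bar>slope (potential s) - slope (potential t)\<bar> \<le> (K * M) * \<bar>s - t\<bar>" for s t
  proof -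
    have "\<bar>slope (potential s) - slope (potential t)\<bar> \<le> K * \<bar>potential s - potential t\<bar>" by (rule K(2)[OF pb pb])
    also have "\<dots> \<le> K * (M * \<bar>s - t\<bar>)" by (intro mult_left_mono potential_lipschitz K)
    finally show ?thesis by (simp add: mult.assoc)
  qed
  have KM: "0 \<le> K * M" using K(1) M_nonneg by simp
  have cont: "continuous_on UNIV (\<lambda>s. slope (potential s))"
  proof (rule lipschitz_on_continuous_on)
    show "(K * M)-lipschitz_on UNIV (\<lambda>s. slope (potential s))"
      using lip KM by (intro lipschitz_onI) (auto simp: dist_real_def)
  qed
  have der: "(w has_real_derivative slope (potential s)) (at s)" if s: "s \<in> {a<..<b}" for s
  proof -
    have "isCont q s"
    proof (rule continuous_on_interior[of "{a<..<b}"])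
      show "continuous_on {a<..<b} q"
        by (rule iffD2[OF continuous_on_cong[OF refl q_eq] continuous_on_subset[OF cont subset_UNIV]])
    qed (use s in simp)
    from prim_has_derivative[OF bounded_borel_integrable[OF q] this]
    have "(prim q has_real_derivative slope (potential s)) (at s)" using q_eq[OF s] by simp
    from DERIV_add[OF DERIV_const[of c] this] show ?thesis unfolding w_def[abs_def] by simp
  qed
  have dw: "deriv w s = slope (potential s)" if "s \<in> {a<..<b}" for s using der[OF that] by (rule DERIV_imp_deriv)
  have "w C1_differentiable_on {a<..<b}"
    unfolding C1_differentiable_on_def
    using der continuous_on_subset[OF cont subset_UNIV, of "{a<..<b}"]
    by (intro exI[of _ "\<lambda>s. slope (potential s)"]) (auto simp: has_real_derivative_iff_has_vector_derivative)
  moreover have "(K * M)-lipschitz_on {a<..<b} (deriv w)"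
    using lip KM dw by (intro lipschitz_onI) (auto simp: dist_real_def)
  ultimately show ?thesis using Z(1) uw by blast
qed

end

section \<open>The dual functional of a minimizer\<close>

lemma abs_powr_convex:
  assumes p: "1 \<le> p"
  shows "convex_on UNIV (\<lambda>y::real. \<bar>y\<bar> powr p)"
proof (rule convex_onI)
  fix t x y :: real assume t: "0 < t" "t < 1"
  have pos: "((1 - t) * \<alpha> + t * \<beta>) powr p \<le> (1 - t) * \<alpha> powr p + t * \<beta> powr p" if "0 \<le> \<alpha>" "0 \<le> \<beta>" for \<alpha> \<beta>
  proof -
    have small: "(s * \<gamma>) powr p \<le> s * \<gamma> powr p" if "0 < s" "s < 1" "0 \<le> \<gamma>" for s \<gamma>
    proof -
      have "s powr p \<le> s powr 1" using that p by (intro powr_mono') auto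
      then show ?thesis using that by (simp add: powr_mult mult_right_mono)
    qed
    consider "\<alpha> = 0" | "\<beta> = 0" | "0 < \<alpha>" "0 < \<beta>" using \<open>0 \<le> \<alpha>\<close> \<open>0 \<le> \<beta>\<close> by linarith
    then show ?thesis
    proof cases
      case 3
      then show ?thesis using convex_onD[OF powr_convex[OF p], of t \<alpha> \<beta>] t by simp
    qed (use small[of t \<beta>] small[of "1 - t" \<alpha>] t that in auto)
  qed
  have "\<bar>(1 - t) *\<^sub>R x + t *\<^sub>R y\<bar> \<le> (1 - t) * \<bar>x\<bar> + t * \<bar>y\<bar>"
    using t abs_triangle_ineq[of "(1 - t) * x" "t * y"] by (simp add: abs_mult)
  then have "\<bar>(1 - t) *\<^sub>R x + t *\<^sub>R y\<bar> powr p \<le> ((1 - t) * \<bar>x\<bar> + t * \<bar>y\<bar>) powr p"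
    using p by (intro powr_mono2) auto
  also have "\<dots> \<le> (1 - t) * \<bar>x\<bar> powr p + t * \<bar>y\<bar> powr p" by (rule pos) auto
  finally show "\<bar>(1 - t) *\<^sub>R x + t *\<^sub>R y\<bar> powr p \<le> (1 - t) * \<bar>x\<bar> powr p + t * \<bar>y\<bar> powr p" .
qed simp

text \<open>
  The difference quotient is at most the derivative at \<open>K\<close>, and at the possibly singular point \<open>\<alpha> = 0\<close> a direct
  estimate replaces the mean value theorem.
\<close>
lemma powr_diff_le:
  fixes p :: real
  assumes p: "1 \<le> p" and \<alpha>: "0 \<le> \<alpha>" and \<beta>: "0 \<le> \<beta>" "\<beta> \<le> K" and d: "\<beta> - \<alpha> \<le> d" and d0: "0 \<le> d"
  shows "\<beta> powr p - \<alpha> powr p \<le> p * K powr (p - 1) * d"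
proof (cases "\<beta> \<le> \<alpha>")
  case True
  then have "\<beta> powr p \<le> \<alpha> powr p" using \<beta>(1) p by (intro powr_mono2) auto
  moreover have "0 \<le> p * K powr (p - 1) * d" using p d0 by simp
  ultimately show ?thesis by linarith
next
  case False
  have "\<beta> powr p - \<alpha> powr p \<le> p * K powr (p - 1) * (\<beta> - \<alpha>)"
  proof (cases "\<alpha> = 0")
    case True
    have "\<beta> powr p = \<beta> powr (p - 1) * \<beta>" using False \<alpha> by (simp add: powr_mult_base powr_diff)
    also have "\<dots> \<le> (p * K powr (p - 1)) * \<beta>"
    proof (rule mult_right_mono)
      have "\<beta> powr (p - 1) \<le> 1 * K powr (p - 1)" using \<beta> p by (simp add: powr_mono2)
      also have "\<dots> \<le> p * K powr (p - 1)" using p by (intro mult_right_mono) auto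
      finally show "\<beta> powr (p - 1) \<le> p * K powr (p - 1)" .
    qed (use \<beta> in auto)
    finally show ?thesis using True by simp
  next
    case False2: False
    have pos: "0 < \<alpha>" "\<alpha> < \<beta>" using False2 False \<alpha> by auto
    obtain z where z: "\<alpha> < z" "z < \<beta>" "\<beta> powr p - \<alpha> powr p = (\<beta> - \<alpha>) * (p * z powr (p - 1))"
    proof -
      have "\<exists>z. \<alpha> < z \<and> z < \<beta> \<and> \<beta> powr p - \<alpha> powr p = (\<beta> - \<alpha>) * (p * z powr (p - 1))"
        by (rule MVT2[OF pos(2)]) (use pos in \<open>auto intro!: derivative_eq_intros\<close>)
      then show ?thesis using that by blast
    qed
    have "z powr (p - 1) \<le> K powr (p - 1)" using z pos \<beta> p by (intro powr_mono2) auto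
    then have "(\<beta> - \<alpha>) * (p * z powr (p - 1)) \<le> (\<beta> - \<alpha>) * (p * K powr (p - 1))"
      using pos p by (intro mult_left_mono) auto
    then show ?thesis using z(3) by (simp add: mult.commute)
  qed
  also have "\<dots> \<le> p * K powr (p - 1) * d" using d p by (intro mult_left_mono) auto
  finally show ?thesis .
qed

lemma fidelity_bounded_borel:
  assumes w: "w \<in> bounded_borel a b" and g: "g \<in> bounded_borel a b" and p: "1 \<le> p"
  shows "(\<lambda>s. \<bar>w s - g s\<bar> powr p) \<in> bounded_borel a b"
proof -
  have [measurable]: "w \<in> borel_measurable borel" "g \<in> borel_measurable borel"
    using bounded_borel_measurable w g by auto
  obtain B where B: "\<And>s. \<bar>w s\<bar> \<le> B" using bounded_borel_bound[OF w] by blast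
  obtain C where C: "\<And>s. \<bar>g s\<bar> \<le> C" using bounded_borel_bound[OF g] by blast
  show ?thesis
  proof (rule bounded_borelI[of _ "(B + C) powr p"])
    show "(\<lambda>s. \<bar>w s - g s\<bar> powr p) \<in> borel_measurable borel" by measurable
    show "\<bar>\<bar>w s - g s\<bar> powr p\<bar> \<le> (B + C) powr p" for s
      using B[of s] C[of s] p by (simp add: powr_mono2)
    show "\<bar>w s - g s\<bar> powr p = 0" if "s \<notin> {a<..<b}" for s
      using bounded_borel_zero[OF w that] bounded_borel_zero[OF g that] by simp
  qed
qed

definition fidelity :: "real \<Rightarrow> (real \<Rightarrow> real) \<Rightarrow> (real \<Rightarrow> real) \<Rightarrow> real" where
  "fidelity p g w = (LBINT s. \<bar>w s - g s\<bar> powr p)"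

context symmetric_anisotropy
begin

lemma zero_test: "a < b \<Longrightarrow> (\<lambda>_. 0) \<in> Cc1_on {a<..<b}" "deriv (\<lambda>_. 0 :: real) = (\<lambda>_. 0)"
  by (rule Cc1_onI[of _ "\<lambda>_. 0" "(a + b) / 2" "(a + b) / 2"]) (auto simp: fun_eq_iff)

text \<open>
  The vertical vector field with components \<open>0\<close> and \<open>profile 0\<close> is admissible up to approximation.
\<close>
lemma area_ge_max:
  assumes u: "integrable lborel u" and ab: "a < b" and A: "aniso_area \<phi> {a<..<b} u \<le> ereal A"
  shows "profile 0 * (b - a) \<le> A"
proof -
  have "(LBINT s. u s * deriv (\<lambda>_. 0) s) + (LBINT s. indicator {a<..<b} s * profile 0) \<le> A"
    by (rule area_ge_profile[OF u ab zero_test(1)[OF ab] _ halfwidth_pos A]) simp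
  then show ?thesis using ab by (simp add: zero_test mult.commute)
qed

lemma area_nonneg:
  assumes u: "integrable lborel u" and ab: "a < b"
  shows "0 \<le> aniso_area \<phi> {a<..<b} u"
proof -
  have "ereal ((LBINT s. u s * deriv (\<lambda>_. 0) s) + (\<integral>s. 0 \<partial>(lborel :: real measure))) \<le> aniso_area \<phi> {a<..<b} u"
    by (rule area_ge[OF u ab zero_test(1)[OF ab] zero_test(1)[OF ab]]) (simp add: phi_zero flip: zero_prod_def)
  then show ?thesis by (simp add: zero_test zero_ereal_def)
qed

lemma area_zero:
  assumes ab: "a < b"
  shows "aniso_area \<phi> {a<..<b} (\<lambda>_. 0) \<le> ereal (profile 0 * (b - a))"
proof (rule area_le[OF _ ab])
  fix h1 h2 assume h: "h1 \<in> Cc1_on {a<..<b}" "h2 \<in> Cc1_on {a<..<b}" and p: "\<And>s. \<phi> (h1 s, h2 s) \<le> 1"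
  note b2 = Cc1_on_bounded_borel[OF h(2) ab]
  have "(LBINT s. h2 s) \<le> (LBINT s. profile 0 * indicator {a..b} s)"
  proof (rule integral_mono)
    fix s
    have "h2 s \<le> profile (h1 s)" by (rule profile_upper[OF p])
    also have "\<dots> \<le> profile 0" by (rule profile_le_max[OF ball_fst[OF p]])
    finally show "h2 s \<le> profile 0 * indicator {a..b} s"
      using bounded_borel_zero[OF b2(1), of s] by (cases "s \<in> {a..b}") auto
  qed (use bounded_borel_integrable[OF b2(1)] in auto)
  then show "(LBINT s. 0 * deriv h1 s) + (LBINT s. h2 s) \<le> profile 0 * (b - a)" using ab by simp
qed simp

lemma area_convex:
  assumes v: "integrable lborel v" "aniso_area \<phi> {a<..<b} v \<le> ereal c"
    and w: "integrable lborel w" "aniso_area \<phi> {a<..<b} w \<le> ereal d"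
    and t: "0 \<le> t" "t \<le> 1" and ab: "a < b"
  shows "aniso_area \<phi> {a<..<b} ((1 - t) *\<^sub>R v + t *\<^sub>R w) \<le> ereal ((1 - t) * c + t * d)"
proof (rule area_le[OF _ ab])
  show "integrable lborel ((1 - t) *\<^sub>R v + t *\<^sub>R w)"
    using v(1) w(1) by (simp add: plus_fun_def scaleR_fun_def)
  fix h1 h2 assume h: "h1 \<in> Cc1_on {a<..<b}" "h2 \<in> Cc1_on {a<..<b}" and p: "\<And>s. \<phi> (h1 s, h2 s) \<le> 1"
  note b1 = Cc1_on_bounded_borel(2)[OF h(1) ab]
  have iv: "integrable lborel (\<lambda>s. v s * deriv h1 s)" "integrable lborel (\<lambda>s. w s * deriv h1 s)"
    by (intro integrable_mult_bounded[OF _ b1] v w)+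
  have "((1 - t) *\<^sub>R v + t *\<^sub>R w) s * deriv h1 s = (1 - t) * (v s * deriv h1 s) + t * (w s * deriv h1 s)" for s
    by (simp add: scaleR_fun_def algebra_simps)
  then have eq: "(LBINT s. ((1 - t) *\<^sub>R v + t *\<^sub>R w) s * deriv h1 s)
      = (1 - t) * (LBINT s. v s * deriv h1 s) + t * (LBINT s. w s * deriv h1 s)"
    using iv by simp
  have "ereal ((LBINT s. v s * deriv h1 s) + (LBINT s. h2 s)) \<le> ereal c"
    using area_ge[OF v(1) ab h p] v(2) by (rule order_trans)
  then have 1: "(LBINT s. v s * deriv h1 s) + (LBINT s. h2 s) \<le> c" by simp
  have "ereal ((LBINT s. w s * deriv h1 s) + (LBINT s. h2 s)) \<le> ereal d"
    using area_ge[OF w(1) ab h p] w(2) by (rule order_trans)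
  then have 2: "(LBINT s. w s * deriv h1 s) + (LBINT s. h2 s) \<le> d" by simp
  have "(1 - t) * ((LBINT s. v s * deriv h1 s) + (LBINT s. h2 s))
      + t * ((LBINT s. w s * deriv h1 s) + (LBINT s. h2 s)) \<le> (1 - t) * c + t * d"
    using 1 2 t by (intro add_mono mult_left_mono) auto
  then show "(LBINT s. ((1 - t) *\<^sub>R v + t *\<^sub>R w) s * deriv h1 s) + (LBINT s. h2 s) \<le> (1 - t) * c + t * d"
    unfolding eq by (simp add: algebra_simps)
qed

text \<open>
  The derivative of a test function has integral \<open>0\<close>.
\<close>
lemma area_add_const:
  assumes u: "integrable lborel u" and ab: "a < b" and A: "aniso_area \<phi> {a<..<b} u \<le> ereal A"
  shows "aniso_area \<phi> {a<..<b} (u + c *\<^sub>R indicator {a<..<b}) \<le> ereal A"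
proof (rule area_le[OF _ ab])
  have ii: "integrable lborel (\<lambda>s. indicator {a<..<b} s :: real)"
    using bounded_borel_integrable[OF bounded_borel_indicator[of UNIV a b]] by simp
  show "integrable lborel (u + c *\<^sub>R indicator {a<..<b})"
    using u ii by (simp add: plus_fun_def scaleR_fun_def)
  fix h1 h2 assume h: "h1 \<in> Cc1_on {a<..<b}" "h2 \<in> Cc1_on {a<..<b}" and p: "\<And>s. \<phi> (h1 s, h2 s) \<le> 1"
  note b1 = Cc1_on_bounded_borel(2)[OF h(1) ab]
  have "(LBINT s. (indicator {a<..<b} s * (1 + prim 0 s)) * deriv h1 s) = - (LBINT s. h1 s * 0 s)"
    by (rule test_function_by_parts[OF h(1) ab subspace_0[OF subspace_bounded_borel]])
  then have z: "(LBINT s. indicator {a<..<b} s * deriv h1 s) = 0" by (simp add: prim_def)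
  have "(LBINT s. (u + c *\<^sub>R indicator {a<..<b}) s * deriv h1 s)
      = (LBINT s. u s * deriv h1 s + c * (indicator {a<..<b} s * deriv h1 s))"
    by (intro Bochner_Integration.integral_cong) (auto simp: scaleR_fun_def algebra_simps)
  also have "\<dots> = (LBINT s. u s * deriv h1 s)"
    using integrable_mult_bounded[OF u b1] integrable_mult_bounded[OF ii b1] z by simp
  finally have "(LBINT s. (u + c *\<^sub>R indicator {a<..<b}) s * deriv h1 s) = (LBINT s. u s * deriv h1 s)" .
  moreover have "ereal ((LBINT s. u s * deriv h1 s) + (LBINT s. h2 s)) \<le> ereal A"
    using area_ge[OF u ab h p] A by (rule order_trans)
  ultimately show "(LBINT s. (u + c *\<^sub>R indicator {a<..<b}) s * deriv h1 s) + (LBINT s. h2 s) \<le> A" by simp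
qed

text \<open>
  Minimality means that the increment of the area at \<open>u\<close> dominates the negative increment of the fidelity term.
  Both are convex, and the separating functional \<open>l\<close> is a subgradient of the area at \<open>u\<close>, while \<open>- l\<close> is one
  of the fidelity term. The latter is locally Lipschitz in the \<open>L\<^sup>1\<close> norm on bounded functions, and so \<open>l\<close> is
  bounded. No derivative of \<open>\<bar>y\<bar> powr p\<close> is taken, which treats \<open>p = 1\<close> and \<open>p > 1\<close> alike.
\<close>
theorem minimizer_dual_functional:
  assumes ab: "a < b" and p: "1 \<le> p" and u: "u \<in> bounded_borel a b" and g: "g \<in> bounded_borel a b"
    and R: "\<And>s. \<bar>u s - g s\<bar> \<le> R" and A: "aniso_area \<phi> {a<..<b} u = ereal A"
    and min: "\<And>v c. v \<in> bounded_borel a b \<Longrightarrow> aniso_area \<phi> {a<..<b} v \<le> ereal c \<Longrightarrow>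
      A + fidelity p g u \<le> c + fidelity p g v"
  obtains l where "bounded_functional a b l (p * (R + 1) powr (p - 1))"
    "\<And>v c. v \<in> bounded_borel a b \<Longrightarrow> aniso_area \<phi> {a<..<b} v \<le> ereal c \<Longrightarrow> l v - l u \<le> c - A"
    "fidelity p g u \<le> l (g - u)"
proof -
  let ?E = "bounded_borel a b"
  define F where "F w = aniso_area \<phi> {a<..<b} (u + w)" for w
  define V where "V = {w \<in> ?E. F w < \<infinity>}"
  define dA where "dA w = real_of_ereal (F w) - A" for w
  define dJ where "dJ w = fidelity p g (u + w) - fidelity p g u" for w
  note E = subspace_bounded_borel[of a b]
  have uE: "u + w \<in> ?E" if "w \<in> ?E" for w by (rule subspace_add[OF E u that])
  have i: "integrable lborel v" if "v \<in> ?E" for v by (rule bounded_borel_integrable[OF that])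
  have Freal: "F w = ereal (dA w + A)" if "w \<in> V" for w
  proof -
    have "0 \<le> F w" unfolding F_def using that uE by (intro area_nonneg ab i) (auto simp: V_def)
    moreover have "F w < \<infinity>" using that by (simp add: V_def)
    ultimately show ?thesis unfolding dA_def by (cases "F w") auto
  qed
  have VI: "w \<in> V \<and> dA w \<le> c - A" if "w \<in> ?E" "F w \<le> ereal c" for w c
  proof -
    have "w \<in> V" using that le_less_trans[OF that(2)] by (auto simp: V_def)
    then show ?thesis using Freal[of w] that(2) by simp
  qed
  have conv: "(1 - t) *\<^sub>R v + t *\<^sub>R w \<in> V \<and> dA ((1 - t) *\<^sub>R v + t *\<^sub>R w) \<le> (1 - t) * dA v + t * dA w"
    if "v \<in> V" "w \<in> V" "0 \<le> t" "t \<le> 1" for v w t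
  proof -
    have vw: "v \<in> ?E" "w \<in> ?E" using that by (auto simp: V_def)
    have "u + ((1 - t) *\<^sub>R v + t *\<^sub>R w) = (1 - t) *\<^sub>R (u + v) + t *\<^sub>R (u + w)"
      by (simp add: algebra_simps)
    then have "F ((1 - t) *\<^sub>R v + t *\<^sub>R w) \<le> ereal ((1 - t) * (dA v + A) + t * (dA w + A))"
      unfolding F_def
      using area_convex[OF i[OF uE[OF vw(1)]] _ i[OF uE[OF vw(2)]] _ that(3,4) ab, of "dA v + A" "dA w + A"]
        Freal[OF that(1)] Freal[OF that(2)] by (simp add: F_def)
    note V = VI[OF subspace_add[OF E subspace_scale[OF E vw(1)] subspace_scale[OF E vw(2)]] this]
    have "(1 - t) * (dA v + A) + t * (dA w + A) - A = (1 - t) * dA v + t * dA w" by (simp add: algebra_simps)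
    then show ?thesis using V by (simp only:)
  qed
  have fi: "integrable lborel (\<lambda>s. \<bar>w s - g s\<bar> powr p)" if "w \<in> ?E" for w
    by (rule bounded_borel_integrable[OF fidelity_bounded_borel[OF that g p]])
  have "convex V" unfolding convex_alt using conv by blast
  then have dA: "convex_on V dA" using conv by (auto intro!: convex_onI)
  have dJ: "convex_on ?E dJ"
  proof (rule convex_onI)
    show "convex ?E" by (rule subspace_imp_convex[OF E])
    fix t :: real and v w assume t: "0 < t" "t < 1" and v: "v \<in> ?E" and w: "w \<in> ?E"
    have vw: "(1 - t) *\<^sub>R v + t *\<^sub>R w \<in> ?E" using v w E by (intro subspace_add subspace_scale)
    have "fidelity p g (u + ((1 - t) *\<^sub>R v + t *\<^sub>R w))
        \<le> (LBINT s. (1 - t) * (\<bar>(u + v) s - g s\<bar> powr p) + t * (\<bar>(u + w) s - g s\<bar> powr p))"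
      unfolding fidelity_def
    proof (rule integral_mono[OF fi[OF uE[OF vw]]])
      show "integrable lborel (\<lambda>s. (1 - t) * (\<bar>(u + v) s - g s\<bar> powr p) + t * (\<bar>(u + w) s - g s\<bar> powr p))"
        using fi[OF uE[OF v]] fi[OF uE[OF w]] by simp
      fix s
      have "(u + ((1 - t) *\<^sub>R v + t *\<^sub>R w)) s - g s = (1 - t) *\<^sub>R ((u + v) s - g s) + t *\<^sub>R ((u + w) s - g s)"
        by (simp add: scaleR_fun_def algebra_simps)
      then show "\<bar>(u + ((1 - t) *\<^sub>R v + t *\<^sub>R w)) s - g s\<bar> powr p
          \<le> (1 - t) * (\<bar>(u + v) s - g s\<bar> powr p) + t * (\<bar>(u + w) s - g s\<bar> powr p)"
        using convex_onD[OF abs_powr_convex[OF p], of t "(u + v) s - g s" "(u + w) s - g s"] t by simp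
    qed
    also have "\<dots> = (1 - t) * fidelity p g (u + v) + t * fidelity p g (u + w)"
      unfolding fidelity_def using fi[OF uE[OF v]] fi[OF uE[OF w]] by simp
    finally show "dJ ((1 - t) *\<^sub>R v + t *\<^sub>R w) \<le> (1 - t) * dJ v + t * dJ w"
      unfolding dJ_def by (simp add: algebra_simps)
  qed
  have V0: "0 \<in> V" and A10: "dA 0 = 0"
    using A subspace_0[OF E] by (auto simp: V_def dA_def F_def)
  have nonneg: "0 \<le> dA v + dJ v" if "v \<in> V" for v
    using min[OF uE, of v "dA v + A"] Freal[OF that] that by (simp add: F_def V_def dJ_def)
  have VE: "V \<subseteq> ?E" by (auto simp: V_def)
  have B10: "dJ 0 = 0" by (simp add: dJ_def)
  obtain l where l: "\<And>v w. v \<in> ?E \<Longrightarrow> w \<in> ?E \<Longrightarrow> l (v + w) = l v + l w"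
    "\<And>c v. v \<in> ?E \<Longrightarrow> l (c *\<^sub>R v) = c * l v" "\<And>v. v \<in> V \<Longrightarrow> l v \<le> dA v" "\<And>w. w \<in> ?E \<Longrightarrow> - dJ w \<le> l w"
    by (rule sandwich_linear[where E="bounded_borel a b" and V=V and A=dA and B=dJ, OF E VE V0 dA dJ A10 B10 nonneg]) (assumption | rule that)+
  define M where "M = p * (R + 1) powr (p - 1)"
  have R0: "0 \<le> R" using R[of a] abs_ge_zero order_trans by blast
  have M: "0 \<le> M" using p by (simp add: M_def)
  have small: "dJ w \<le> M * (LBINT s. \<bar>w s\<bar>)" if w: "w \<in> ?E" and w1: "\<And>s. \<bar>w s\<bar> \<le> 1" for w
  proof -
    have "dJ w = (LBINT s. \<bar>(u + w) s - g s\<bar> powr p - \<bar>u s - g s\<bar> powr p)"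
      unfolding dJ_def fidelity_def
      by (rule Bochner_Integration.integral_diff[symmetric, OF fi[OF uE[OF w]] fi[OF u]])
    also have "\<dots> \<le> (LBINT s. M * \<bar>w s\<bar>)"
    proof (rule integral_mono[OF Bochner_Integration.integrable_diff[OF fi[OF uE[OF w]] fi[OF u]]])
      show "integrable lborel (\<lambda>s. M * \<bar>w s\<bar>)" by (intro integrable_mult_right integrable_abs i w)
      fix s
      have "\<bar>(u + w) s - g s\<bar> \<le> R + 1" using R[of s] w1[of s] by simp
      then show "\<bar>(u + w) s - g s\<bar> powr p - \<bar>u s - g s\<bar> powr p \<le> M * \<bar>w s\<bar>"
        unfolding M_def by (intro powr_diff_le[OF p]) auto
    qed
    finally show ?thesis by simp
  qed
  \<comment> \<open>The bound for increments of height at most \<open>1\<close> extends by homogeneity.\<close>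
  have lower: "- (M * (LBINT s. \<bar>w s\<bar>)) \<le> l w" if w: "w \<in> ?E" for w
  proof -
    obtain C where C: "C \<ge> 0" "\<And>s. \<bar>w s\<bar> \<le> C" using bounded_borel_bound[OF w] by blast
    define t where "t = 1 / (C + 1)"
    have t: "0 < t" using C by (simp add: t_def)
    have tw: "t *\<^sub>R w \<in> ?E" by (rule subspace_scale[OF E w])
    have "\<bar>(t *\<^sub>R w) s\<bar> \<le> 1" for s
    proof -
      have "t * \<bar>w s\<bar> \<le> t * (C + 1)" using C(2)[of s] t by (intro mult_left_mono) auto
      also have "\<dots> = 1" using C by (simp add: t_def)
      finally show ?thesis using t by (simp add: scaleR_fun_def abs_mult)
    qed
    then have "dJ (t *\<^sub>R w) \<le> M * (LBINT s. \<bar>(t *\<^sub>R w) s\<bar>)" by (rule small[OF tw])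
    also have "(LBINT s. \<bar>(t *\<^sub>R w) s\<bar>) = t * (LBINT s. \<bar>w s\<bar>)"
      using t by (simp add: scaleR_fun_def abs_mult)
    finally have "- (t * (M * (LBINT s. \<bar>w s\<bar>))) \<le> l (t *\<^sub>R w)" using l(4)[OF tw] by (simp add: algebra_simps)
    then have "t * - (M * (LBINT s. \<bar>w s\<bar>)) \<le> t * l w" using l(2)[OF w, of t] by simp
    then show ?thesis using t by (simp only: mult_le_cancel_left_pos)
  qed
  have IE: "indicator {a<..<b} \<in> ?E" using bounded_borel_indicator[of UNIV a b] by simp
  have const: "l (c *\<^sub>R indicator {a<..<b}) \<le> 0" for c
  proof -
    have cE: "c *\<^sub>R indicator {a<..<b} \<in> ?E" by (rule subspace_scale[OF E IE])
    have "F (c *\<^sub>R indicator {a<..<b}) \<le> ereal A"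
      unfolding F_def using A by (intro area_add_const i u ab) simp
    from VI[OF cE this] have "c *\<^sub>R indicator {a<..<b} \<in> V" "dA (c *\<^sub>R indicator {a<..<b}) \<le> 0" by auto
    then show ?thesis using l(3) order_trans by blast
  qed
  have bf: "bounded_functional a b l M"
  proof
    fix v assume v: "v \<in> ?E"
    have "- (M * (LBINT s. \<bar>((-1) *\<^sub>R v) s\<bar>)) \<le> l ((-1) *\<^sub>R v)" by (rule lower[OF subspace_scale[OF E v]])
    moreover have "l ((-1) *\<^sub>R v) = - l v" using l(2)[OF v, of "-1"] by simp
    moreover have "(LBINT s. \<bar>((-1) *\<^sub>R v) s\<bar>) = (LBINT s. \<bar>v s\<bar>)"
      by (intro Bochner_Integration.integral_cong) (auto simp: scaleR_fun_def)
    ultimately show "\<bar>l v\<bar> \<le> M * (LBINT s. \<bar>v s\<bar>)" using lower[OF v] by (simp add: abs_le_iff)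
  next
    show "l (indicator {a<..<b}) = 0"
      using const[of 1] const[of "-1"] l(2)[OF IE, of 1] l(2)[OF IE, of "-1"] by simp
  qed (use ab l(1,2) M in auto)
  have dl: "l (v - w) = l v - l w" if "v \<in> ?E" "w \<in> ?E" for v w
    by (rule bounded_functional.diff[OF bf that])
  show ?thesis
  proof (rule that[of l])
    show "bounded_functional a b l (p * (R + 1) powr (p - 1))" using bf by (simp add: M_def)
    show "l v - l u \<le> c - A" if v: "v \<in> ?E" and c: "aniso_area \<phi> {a<..<b} v \<le> ereal c" for v c
    proof -
      have vu: "v - u \<in> ?E" by (rule subspace_diff[OF E v u])
      have "F (v - u) \<le> ereal c" unfolding F_def using c by simp
      from VI[OF vu this] have "l (v - u) \<le> c - A" using l(3) order_trans by blast
      then show ?thesis by (simp add: dl[OF v u])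
    qed
    have "- dJ (g - u) \<le> l (g - u)" by (rule l(4)[OF subspace_diff[OF E g u]])
    moreover have "fidelity p g (u + (g - u)) = 0" by (simp add: fidelity_def)
    ultimately show "fidelity p g u \<le> l (g - u)" by (simp add: dJ_def)
  qed
qed

text \<open>
  As \<open>l\<close> is a subgradient of the area at \<open>u\<close>, the number \<open>A - l u\<close> is at most \<open>area v - l v\<close> for every \<open>v\<close>. The
  competitor \<open>v\<close> is a primitive of the slope at the truncated potential \<open>y\<close>; it minimizes the right-hand
  side as long as no truncation occurs. Where the potential is truncated, the error \<open>slope y * (potential - y)\<close> has the right sign.
\<close>
lemma dual_inequality:
  assumes bf: "bounded_functional a b l M"
    and dual: "\<And>v c. v \<in> bounded_borel a b \<Longrightarrow> aniso_area \<phi> {a<..<b} v \<le> ereal c \<Longrightarrow> l v - l u \<le> c - A"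
    and r: "0 < r" "r < halfwidth"
  defines "y \<equiv> \<lambda>s. max (- r) (min r (bounded_functional.potential a b l s))"
  shows "(\<lambda>s. indicator {a<..<b} s * profile (y s)) \<in> bounded_borel a b"
    "A \<le> l u + (LBINT s. indicator {a<..<b} s * profile (y s))"
proof -
  interpret bounded_functional a b l M by (rule bf)
  have y: "\<bar>y s\<bar> \<le> r" for s using r by (auto simp: y_def)
  have yh: "\<bar>y s\<bar> < halfwidth" for s using y[of s] r by linarith
  have [measurable]: "y \<in> borel_measurable borel" unfolding y_def by measurable
  have [measurable]: "(\<lambda>s. profile (y s)) \<in> borel_measurable borel" "(\<lambda>s. slope (y s)) \<in> borel_measurable borel"
  proof -
    have "(\<lambda>y. profile (max (- r) (min r y))) \<in> borel_measurable borel"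
      using clamped_profile_continuous[of r] r by (intro borel_measurable_continuous_onI) auto
    from measurable_compose[OF potential_measurable this] show "(\<lambda>s. profile (y s)) \<in> borel_measurable borel"
      by (simp add: y_def)
    have "(\<lambda>y. slope (max (- r) (min r y))) \<in> borel_measurable borel"
      using clamped_slope_measurable[of r] r by auto
    from measurable_compose[OF potential_measurable this] show "(\<lambda>s. slope (y s)) \<in> borel_measurable borel"
      by (simp add: y_def)
  qed
  have sb: "\<bar>slope (y s)\<bar> \<le> slope_bound r" for s by (rule slope_bounded[OF r(2) y])
  have pb: "\<bar>profile (y s)\<bar> \<le> profile 0" for s
    using profile_nonneg[of "y s"] profile_le_max[of "y s"] yh[of s] by simp
  show P: "(\<lambda>s. indicator {a<..<b} s * profile (y s)) \<in> bounded_borel a b"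
    by (rule bounded_borel_restrict[OF _ pb]) measurable
  define \<xi> where "\<xi> s = indicator {a<..<b} s * slope (y s)" for s
  have \<xi>: "\<xi> \<in> bounded_borel a b" unfolding \<xi>_def by (rule bounded_borel_restrict[OF _ sb]) measurable
  define \<kappa> where "\<kappa> s = indicator {a<..<b} s * (profile (y s) - slope (y s) * y s)" for s
  have \<kappa>: "\<kappa> \<in> bounded_borel a b" unfolding \<kappa>_def
  proof (rule bounded_borel_restrict)
    show "\<bar>profile (y s) - slope (y s) * y s\<bar> \<le> profile 0 + slope_bound r * r" for s
    proof -
      have "\<bar>slope (y s) * y s\<bar> \<le> slope_bound r * r"
        unfolding abs_mult by (intro mult_mono sb y) (auto simp: slope_bound_nonneg)
      then show ?thesis using pb[of s] by linarith
    qed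
  qed measurable
  define v where "v s = indicator {a<..<b} s * (0 + prim \<xi> s)" for s
  have v: "v \<in> bounded_borel a b" and lv: "l v = - (LBINT s. potential s * \<xi> s)"
    unfolding v_def by (rule integration_by_parts[OF \<xi>])+
  have "aniso_area \<phi> {a<..<b} v \<le> ereal (LBINT s. \<kappa> s)"
    unfolding v_def
  proof (rule area_primitive_le[OF ab \<xi> \<kappa>])
    fix s X Y assume s: "s \<in> {a<..<b}" and XY: "\<phi> (X, Y) \<le> 1"
    have "Y \<le> profile X" by (rule profile_upper[OF XY])
    also have "\<dots> \<le> profile (y s) + slope (y s) * (X - y s)" by (rule profile_le_slope[OF yh ball_fst[OF XY]])
    finally show "Y - \<xi> s * X \<le> \<kappa> s" using s by (simp add: \<xi>_def \<kappa>_def algebra_simps)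
  next
    show "(\<lambda>s. indicator {a<..<b} s * (0 + prim \<xi> s)) \<in> bounded_borel a b" by (rule integration_by_parts(1)[OF \<xi>])
  qed
  from dual[OF v this] have "A \<le> l u + ((LBINT s. \<kappa> s) + (LBINT s. potential s * \<xi> s))" using lv by simp
  also have "(LBINT s. \<kappa> s) + (LBINT s. potential s * \<xi> s) = (LBINT s. \<kappa> s + potential s * \<xi> s)"
    using bounded_borel_integrable[OF \<kappa>] integrable_mult_bounded[OF bounded_borel_integrable[OF potential_bounded_borel] \<xi>]
    by simp
  also have "\<dots> \<le> (LBINT s. indicator {a<..<b} s * profile (y s))"
  proof (rule integral_mono)
    show "\<kappa> s + potential s * \<xi> s \<le> indicator {a<..<b} s * profile (y s)" for s
    proof (cases "s \<in> {a<..<b}")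
      case True
      have "slope (y s) * (potential s - y s) \<le> 0"
      proof -
        consider "potential s = y s" | "r < potential s" "y s = r" | "potential s < - r" "y s = - r"
          by (cases "r < potential s"; cases "potential s < - r") (use r in \<open>auto simp: y_def\<close>)
        then show ?thesis
        proof cases
          case 2
          then show ?thesis using slope_sign(1)[of r] r by (intro mult_nonpos_nonneg) auto
        next
          case 3
          then show ?thesis using slope_sign(2)[of "- r"] r by (intro mult_nonneg_nonpos) auto
        qed simp
      qed
      then show ?thesis using True by (simp add: \<kappa>_def \<xi>_def algebra_simps)
    qed (simp add: \<kappa>_def \<xi>_def)
  qed (use bounded_borel_integrable[OF \<kappa>] bounded_borel_integrable[OF P]
      integrable_mult_bounded[OF bounded_borel_integrable[OF potential_bounded_borel] \<xi>] in auto)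
  finally show "A \<le> l u + (LBINT s. indicator {a<..<b} s * profile (y s))" by simp
qed

lemma profile_abs: "profile \<bar>x\<bar> = profile x"
  by (auto simp: abs_if profile_def phi_reflect)

text \<open>
  The duality inequality, the bound \<open>profile 0 * (b - a) \<le> A\<close> and \<open>l u \<le> l g\<close> show that the integral of
  \<open>profile 0 - profile y\<close> is at most \<open>l g\<close>, which is of order \<open>\<sigma>\<close>. If the potential reached \<open>r\<close>, then, being
  \<open>M\<close>-Lipschitz, its absolute value would stay above \<open>r1\<close> on an interval of length \<open>(r - r1) / M\<close>, and the integral would be at
  least \<open>(profile 0 - profile r1) * (r - r1) / M\<close>. Hence the truncation is inactive.
\<close>
theorem small_data_certificate:
  assumes bf: "bounded_functional a b l M" and M: "0 < M"
    and u: "u \<in> bounded_borel a b" and A: "aniso_area \<phi> {a<..<b} u \<le> ereal A"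
    and dual: "\<And>v c. v \<in> bounded_borel a b \<Longrightarrow> aniso_area \<phi> {a<..<b} v \<le> ereal c \<Longrightarrow> l v - l u \<le> c - A"
    and g: "g \<in> bounded_borel a b" "\<And>s. \<bar>g s\<bar> \<le> \<sigma>" and fid: "0 \<le> l (g - u)"
    and r: "0 < r1" "r1 < r" "r < halfwidth"
    and small: "M * (M * (\<sigma> * (b - a))) < (profile 0 - profile r1) * (r - r1)"
  shows "dual_certificate \<phi> a b l M u A r"
proof -
  interpret bounded_functional a b l M by (rule bf)
  have r0: "0 < r" using r by simp
  define y where "y s = max (- r) (min r (potential s))" for s
  have P: "(\<lambda>s. indicator {a<..<b} s * profile (y s)) \<in> bounded_borel a b"
    and ineq: "A \<le> l u + (LBINT s. indicator {a<..<b} s * profile (y s))"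
    unfolding y_def using dual_inequality[OF bf dual r0 r(3)] by blast+
  have y: "\<bar>y s\<bar> \<le> r" for s using r0 by (auto simp: y_def)
  have low: "profile 0 * (b - a) \<le> A" by (rule area_ge_max[OF bounded_borel_integrable[OF u] ab A])
  have "l u \<le> l g" using fid diff[OF g(1) u] by simp
  also have "l g \<le> M * (LBINT s. \<bar>g s\<bar>)" using bound[OF g(1)] by linarith
  also have "\<dots> \<le> M * (\<sigma> * (b - a))"
  proof (rule mult_left_mono)
    have "(LBINT s. \<bar>g s\<bar>) \<le> (LBINT s. \<sigma> * indicator {a..b} s)"
    proof (rule integral_mono)
      show "\<bar>g s\<bar> \<le> \<sigma> * indicator {a..b} s" for s
        using g(2)[of s] bounded_borel_zero[OF g(1), of s] by (cases "s \<in> {a..b}") auto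
    qed (use bounded_borel_integrable[OF g(1)] in auto)
    then show "(LBINT s. \<bar>g s\<bar>) \<le> \<sigma> * (b - a)" using ab by simp
  qed (use M in simp)
  finally have lu: "l u \<le> M * (\<sigma> * (b - a))" .
  have lt: "\<bar>potential s0\<bar> < r" for s0
  proof (rule ccontr)
    assume "\<not> \<bar>potential s0\<bar> < r"
    then have s0: "r \<le> \<bar>potential s0\<bar>" by simp
    define \<rho> where "\<rho> = (r - r1) / M"
    have \<rho>: "0 < \<rho>" "M * \<rho> = r - r1" using r M by (auto simp: \<rho>_def)
    have big: "r1 \<le> \<bar>potential s\<bar>" if s: "s \<in> {s0 - \<rho><..s0}" for s
    proof -
      have "\<bar>potential s - potential s0\<bar> \<le> M * \<bar>s - s0\<bar>" by (rule potential_lipschitz)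
      also have "\<dots> \<le> M * \<rho>" using s M by (intro mult_left_mono) auto
      finally show ?thesis using s0 \<rho>(2) by linarith
    qed
    have inI: "s \<in> {a<..<b}" if "s \<in> {s0 - \<rho><..s0}" for s
      using big[OF that] potential_outside[of s] r(1) by force
    have "(LBINT s. indicator {a<..<b} s * profile (y s))
        \<le> (LBINT s. profile 0 * indicator {a..b} s - (profile 0 - profile r1) * indicator {s0 - \<rho><..s0} s)"
    proof (rule integral_mono[OF bounded_borel_integrable[OF P]])
      show "integrable lborel (\<lambda>s. profile 0 * indicator {a..b} s - (profile 0 - profile r1) * indicator {s0 - \<rho><..s0} s)"
        by simp
      fix s
      show "indicator {a<..<b} s * profile (y s) \<le> profile 0 * indicator {a..b} s - (profile 0 - profile r1) * indicator {s0 - \<rho><..s0} s"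
      proof (cases "s \<in> {s0 - \<rho><..s0}")
        case True
        have "r1 \<le> \<bar>y s\<bar>" using big[OF True] r unfolding y_def by (auto simp: max_def min_def abs_if split: if_splits)
        then have "profile \<bar>y s\<bar> \<le> profile r1" using y[of s] r by (intro profile_antimono) auto
        then show ?thesis using True inI[OF True] by (simp add: profile_abs)
      next
        case False
        have "profile (y s) \<le> profile 0" using y[of s] r by (intro profile_le_max) simp
        then show ?thesis using False profile_zero_pos by (auto split: split_indicator)
      qed
    qed
    also have "\<dots> = profile 0 * (b - a) - (profile 0 - profile r1) * \<rho>"
      using ab \<rho>(1) by simp
    finally have "(profile 0 - profile r1) * \<rho> \<le> M * (\<sigma> * (b - a))" using ineq low lu by linarith
    then have "M * ((profile 0 - profile r1) * \<rho>) \<le> M * (M * (\<sigma> * (b - a)))" using M by (intro mult_left_mono) auto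
    moreover have "M * ((profile 0 - profile r1) * \<rho>) = (profile 0 - profile r1) * (r - r1)"
      using \<rho>(2) by (metis mult.assoc mult.commute)
    ultimately show False using small by linarith
  qed
  have yeq: "y s = potential s" for s using lt[of s] by (auto simp: y_def abs_less_iff)
  show ?thesis
  proof
    show "A \<le> l u + (LBINT s. indicator {a<..<b} s * profile (potential s))" using ineq by (simp add: yeq)
    show "\<bar>potential s\<bar> \<le> r" for s using lt[of s] by simp
  qed (use u A r r0 in auto)
qed

end

section \<open>Bounded representatives of minimizers\<close>

lemma borel_representative:
  assumes f: "f \<in> borel_measurable (lebesgue_on {a<..<b})"
  obtains f' :: "real \<Rightarrow> real" where "f' \<in> borel_measurable borel" "\<And>s. s \<notin> {a<..<b} \<Longrightarrow> f' s = 0"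
    "AE s in lebesgue_on {a<..<b}. f s = f' s"
proof -
  have "(\<lambda>s. if s \<in> {a<..<b} then f s else 0) \<in> borel_measurable lebesgue"
    using f borel_measurable_if[of "{a<..<b}" f] by simp
  then obtain f0 where f0: "f0 \<in> borel_measurable lborel" and ae: "AE s in lborel. (if s \<in> {a<..<b} then f s else 0) = f0 s"
    using completion_ex_borel_measurable_real by blast
  show ?thesis
  proof (rule that[of "\<lambda>s. indicator {a<..<b} s * f0 s"])
    show "(\<lambda>s. indicator {a<..<b} s * f0 s) \<in> borel_measurable borel" using f0 by simp
    have "AE s in lebesgue. s \<in> {a<..<b} \<longrightarrow> f s = indicator {a<..<b} s * f0 s"
      using AE_completion[OF ae] by eventually_elim auto
    then show "AE s in lebesgue_on {a<..<b}. f s = indicator {a<..<b} s * f0 s"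
      by (simp add: AE_restrict_space_iff)
  qed simp
qed

lemma lebesgue_on_transfer:
  fixes f f' :: "real \<Rightarrow> real"
  assumes f: "f \<in> borel_measurable (lebesgue_on {a<..<b})" and f': "f' \<in> borel_measurable borel"
    and z: "\<And>s. s \<notin> {a<..<b} \<Longrightarrow> f' s = 0" and ae: "AE s in lebesgue_on {a<..<b}. f s = f' s"
  shows "integrable (lebesgue_on {a<..<b}) f \<longleftrightarrow> integrable lborel f'"
    "(\<integral>s. f s \<partial>lebesgue_on {a<..<b}) = (LBINT s. f' s)"
proof -
  have m: "f' \<in> borel_measurable (lebesgue_on {a<..<b})" by (rule measurable_lebesgue_on[OF f'])
  have "integrable (lebesgue_on {a<..<b}) f \<longleftrightarrow> integrable (lebesgue_on {a<..<b}) f'"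
    by (rule integrable_cong_AE[OF f m ae])
  also have "\<dots> \<longleftrightarrow> integrable lebesgue (\<lambda>s. indicator {a<..<b} s *\<^sub>R f' s)"
    by (rule integrable_restrict_space) simp
  also have "(\<lambda>s. indicator {a<..<b} s *\<^sub>R f' s) = f'" using z by (auto simp: fun_eq_iff split: split_indicator)
  also have "integrable lebesgue f' \<longleftrightarrow> integrable lborel f'" by (rule integrable_completion) (use f' in simp)
  finally show "integrable (lebesgue_on {a<..<b}) f \<longleftrightarrow> integrable lborel f'" .
  show "(\<integral>s. f s \<partial>lebesgue_on {a<..<b}) = (LBINT s. f' s)"
    using integral_cong_AE[OF f m ae] integral_lebesgue_on[OF f' z] by simp
qed

lemma AE_lebesgue_on_null:
  fixes a b :: real
  assumes Z: "Z \<in> null_sets lborel"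
  shows "AE s in lebesgue_on {a<..<b}. s \<in> {a<..<b} - Z"
proof -
  have "AE s in lebesgue. s \<notin> Z" by (rule AE_completion[OF AE_not_in[OF Z]])
  then have "AE s in lebesgue. s \<in> {a<..<b} \<longrightarrow> s \<in> {a<..<b} - Z" by eventually_elim auto
  then show ?thesis by (rule iffD2[OF AE_restrict_space_iff, rotated]) simp
qed

context symmetric_anisotropy
begin

text \<open>
  The area bounds the oscillation of \<open>u\<close>, and some value of \<open>\<bar>u\<bar>\<close> is at most its mean.
\<close>
lemma bounded_from_area:
  assumes u: "integrable lborel u" and ab: "a < b" and A: "aniso_area \<phi> {a<..<b} u \<le> ereal A"
    and z: "\<And>s. s \<notin> {a<..<b} \<Longrightarrow> u s = 0"
  obtains Z where "Z \<in> null_sets lborel"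
    "\<And>s. s \<in> {a<..<b} - Z \<Longrightarrow> \<bar>u s\<bar> \<le> A / halfwidth + (LBINT t. \<bar>u t\<bar>) / (b - a)"
proof -
  have test: "\<bar>LBINT s. u s * deriv \<eta> s\<bar> \<le> A / halfwidth + 0 * (d - c)"
    if "\<eta> \<in> Cc1_on {a<..<b}" "\<And>s. 0 \<le> \<eta> s \<and> \<eta> s \<le> 1" for \<eta> c d
    using area_ge_test[OF u ab that(1) _ A] that(2) by simp
  obtain Z where Z: "Z \<in> null_sets lborel"
    "\<And>s t. s \<in> {a<..<b} - Z \<Longrightarrow> t \<in> {a<..<b} - Z \<Longrightarrow> \<bar>u s - u t\<bar> \<le> A / halfwidth + 0 * \<bar>s - t\<bar>"
    by (rule AE_modulus_from_test_functions[OF u ab test]) (assumption | rule that)+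
  show ?thesis
  proof (rule that[OF Z(1)])
    fix s assume s: "s \<in> {a<..<b} - Z"
    have ii: "integrable lborel (\<lambda>t. indicator {a<..<b} t :: real)"
      using bounded_borel_integrable[OF bounded_borel_indicator[of UNIV a b]] by simp
    have "\<bar>u s\<bar> * (b - a) = (LBINT t. \<bar>u s\<bar> * indicator {a<..<b} t)" using ab by simp
    also have "\<dots> \<le> (LBINT t. (A / halfwidth) * indicator {a<..<b} t + \<bar>u t\<bar>)"
    proof (rule integral_mono_AE)
      show "integrable lborel (\<lambda>t. \<bar>u s\<bar> * indicator {a<..<b} t)" by (rule integrable_mult_right[OF ii])
      show "integrable lborel (\<lambda>t. (A / halfwidth) * indicator {a<..<b} t + \<bar>u t\<bar>)"
        by (intro Bochner_Integration.integrable_add integrable_mult_right ii integrable_abs u)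
      show "AE t in lborel. \<bar>u s\<bar> * indicator {a<..<b} t \<le> (A / halfwidth) * indicator {a<..<b} t + \<bar>u t\<bar>"
        using AE_not_in[OF Z(1)]
      proof eventually_elim
        case (elim t)
        show ?case
        proof (cases "t \<in> {a<..<b}")
          case True
          then have "\<bar>u s - u t\<bar> \<le> A / halfwidth" using Z(2)[OF s, of t] elim by simp
          then show ?thesis using True by simp
        qed simp
      qed
    qed
    also have "\<dots> = (A / halfwidth) * (b - a) + (LBINT t. \<bar>u t\<bar>)"
      using ii u ab by (subst Bochner_Integration.integral_add) auto
    finally show "\<bar>u s\<bar> \<le> A / halfwidth + (LBINT t. \<bar>u t\<bar>) / (b - a)"
      using ab by (simp add: field_simps)
  qed
qed

text \<open>
  A bound for minimizers on an interval of length \<open>L\<close> when \<open>\<bar>g\<bar> \<le> 1\<close>. Comparison with the zero function bounds the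
  area plus the fidelity term by \<open>(profile 0 + 1) * L\<close>; the first summand then bounds the oscillation
  and the other two the mean of \<open>\<bar>u\<bar>\<close>.
\<close>
definition sup_bound :: "real \<Rightarrow> real" where
  "sup_bound L = (profile 0 + 1) * L / halfwidth + 3 + profile 0"

text \<open>
  Passing to Borel representatives that vanish outside the interval, and bounded by \<open>sup_bound\<close>, changes neither
  the area nor the fidelity term. Every bounded Borel function of finite area is an admissible competitor.
\<close>
lemma minimizer_bounded_representative:
  assumes p: "1 \<le> p" and ab: "a < b" and \<sigma>: "0 \<le> \<sigma>" "\<sigma> \<le> 1"
    and g: "g \<in> borel_measurable (lebesgue_on {a<..<b})" "AE s in lebesgue_on {a<..<b}. \<bar>g s\<bar> \<le> \<sigma>"
    and minimizer: "is_minimizer \<phi> p {a<..<b} g u"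
  obtains u' g' A where "u' \<in> bounded_borel a b" "g' \<in> bounded_borel a b"
    "AE s in lebesgue_on {a<..<b}. u s = u' s" "\<And>s. \<bar>g' s\<bar> \<le> \<sigma>" "\<And>s. \<bar>u' s\<bar> \<le> sup_bound (b - a)"
    "aniso_area \<phi> {a<..<b} u' = ereal A"
    "\<And>v c. v \<in> bounded_borel a b \<Longrightarrow> aniso_area \<phi> {a<..<b} v \<le> ereal c \<Longrightarrow> A + fidelity p g' u' \<le> c + fidelity p g' v"
proof -
  let ?I = "{a<..<b}"
  let ?L = "b - a"
  have um: "u \<in> borel_measurable (lebesgue_on ?I)" and ui: "integrable (lebesgue_on ?I) (\<lambda>s. \<bar>u s\<bar> powr 1)"
    and min: "\<And>v. v \<in> Lp_on 1 ?I \<Longrightarrow> aniso_functional \<phi> p ?I g u \<le> aniso_functional \<phi> p ?I g v"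
    using minimizer by (auto simp: is_minimizer_def Lp_on_def)
  obtain u0 where u0: "u0 \<in> borel_measurable borel" "\<And>s. s \<notin> ?I \<Longrightarrow> u0 s = 0" and uu0: "AE s in lebesgue_on ?I. u s = u0 s"
    by (rule borel_representative[OF um]) (rule that)
  obtain g0 where g0: "g0 \<in> borel_measurable borel" "\<And>s. s \<notin> ?I \<Longrightarrow> g0 s = 0" and gg0: "AE s in lebesgue_on ?I. g s = g0 s"
    by (rule borel_representative[OF g(1)]) (rule that)
  define g' where "g' s = max (- \<sigma>) (min \<sigma> (g0 s))" for s
  have g'\<sigma>: "\<bar>g' s\<bar> \<le> \<sigma>" for s using \<sigma> by (auto simp: g'_def)
  have [measurable]: "u0 \<in> borel_measurable borel" "g0 \<in> borel_measurable borel" by fact+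
  have g': "g' \<in> bounded_borel a b"
  proof (rule bounded_borelI[OF _ g'\<sigma>])
    show "g' \<in> borel_measurable borel" unfolding g'_def by measurable
    show "g' s = 0" if "s \<notin> ?I" for s using g0(2)[OF that] \<sigma> by (simp add: g'_def)
  qed
  note [measurable] = bounded_borel_measurable[OF g']
  have gg': "AE s in lebesgue_on ?I. g s = g' s"
    using gg0 g(2) by eventually_elim (auto simp: g'_def)
  have fid: "integrable (lebesgue_on ?I) (\<lambda>s. \<bar>v s - g s\<bar> powr p) \<longleftrightarrow> integrable lborel (\<lambda>s. \<bar>v' s - g' s\<bar> powr p)"
    "(\<integral>s. \<bar>v s - g s\<bar> powr p \<partial>lebesgue_on ?I) = fidelity p g' v'"
    if [measurable]: "v \<in> borel_measurable (lebesgue_on ?I)" "v' \<in> borel_measurable borel"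
      and z: "\<And>s. s \<notin> ?I \<Longrightarrow> v' s = 0" and vv': "AE s in lebesgue_on ?I. v s = v' s" for v v'
  proof -
    note [measurable] = g(1)
    have ae: "AE s in lebesgue_on ?I. \<bar>v s - g s\<bar> powr p = \<bar>v' s - g' s\<bar> powr p"
      using vv' gg' by eventually_elim simp
    have m: "(\<lambda>s. \<bar>v s - g s\<bar> powr p) \<in> borel_measurable (lebesgue_on ?I)"
      "(\<lambda>s. \<bar>v' s - g' s\<bar> powr p) \<in> borel_measurable borel" by measurable
    have z': "\<bar>v' s - g' s\<bar> powr p = 0" if "s \<notin> ?I" for s
      using z[OF that] bounded_borel_zero[OF g' that] by simp
    show "integrable (lebesgue_on ?I) (\<lambda>s. \<bar>v s - g s\<bar> powr p) \<longleftrightarrow> integrable lborel (\<lambda>s. \<bar>v' s - g' s\<bar> powr p)"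
      by (rule lebesgue_on_transfer(1)[OF m z' ae])
    show "(\<integral>s. \<bar>v s - g s\<bar> powr p \<partial>lebesgue_on ?I) = fidelity p g' v'"
      unfolding fidelity_def by (rule lebesgue_on_transfer(2)[OF m z' ae])
  qed
  have u0i: "integrable lborel u0"
  proof -
    have "integrable lborel (\<lambda>s. \<bar>u0 s\<bar> powr 1) \<longleftrightarrow> integrable (lebesgue_on ?I) (\<lambda>s. \<bar>u s\<bar> powr 1)"
    proof (rule lebesgue_on_transfer(1)[symmetric])
      show "(\<lambda>s. \<bar>u s\<bar> powr 1) \<in> borel_measurable (lebesgue_on ?I)" using um by measurable
      show "AE s in lebesgue_on ?I. \<bar>u s\<bar> powr 1 = \<bar>u0 s\<bar> powr 1" using uu0 by eventually_elim simp
    qed (use u0(2) in auto)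
    then have "integrable lborel (\<lambda>s. \<bar>u0 s\<bar>)" using ui by simp
    then show ?thesis using integrable_abs_cancel[of lborel u0] by simp
  qed
  have competitor: "v \<in> Lp_on 1 ?I \<and> aniso_functional \<phi> p ?I g v = aniso_area \<phi> ?I v + ereal (fidelity p g' v)"
    if v: "v \<in> bounded_borel a b" and c: "aniso_area \<phi> ?I v \<le> ereal c" for v c
  proof -
    have vb: "v \<in> borel_measurable borel" by (rule bounded_borel_measurable[OF v])
    have vm: "v \<in> borel_measurable (lebesgue_on ?I)" by (rule measurable_lebesgue_on[OF vb])
    have vz: "\<And>s. s \<notin> ?I \<Longrightarrow> v s = 0" by (rule bounded_borel_zero[OF v])
    have vi: "integrable lborel v" by (rule bounded_borel_integrable[OF v])
    have "integrable (lebesgue_on ?I) v" using lebesgue_on_transfer(1)[OF vm vb vz] vi by simp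
    then have Lp: "v \<in> Lp_on 1 ?I" using vm by (simp add: Lp_on_def)
    moreover have "v \<in> BV_on ?I" using Lp total_variation_finite[OF vi ab c] by (simp add: BV_on_def)
    moreover have "(\<lambda>s. v s - g s) \<in> Lp_on p ?I"
    proof -
      have "(\<lambda>s. v s - g s) \<in> borel_measurable (lebesgue_on ?I)" using vm g(1) by measurable
      moreover have "integrable (lebesgue_on ?I) (\<lambda>s. \<bar>v s - g s\<bar> powr p)"
        using fid(1)[OF vm vb vz] bounded_borel_integrable[OF fidelity_bounded_borel[OF v g' p]] by simp
      ultimately show ?thesis by (simp add: Lp_on_def)
    qed
    ultimately show ?thesis using fid(2)[OF vm vb vz] by (simp add: aniso_functional_def)
  qed
  have zero: "(\<lambda>_. 0) \<in> bounded_borel a b" by (rule bounded_borelI[of _ 0]) auto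
  note comp0 = competitor[OF zero area_zero[OF ab]]
  have fin: "aniso_functional \<phi> p ?I g u \<le> ereal (profile 0 * ?L + fidelity p g' (\<lambda>_. 0))"
  proof -
    have "aniso_functional \<phi> p ?I g u \<le> aniso_area \<phi> ?I (\<lambda>_. 0) + ereal (fidelity p g' (\<lambda>_. 0))"
      using min comp0 by metis
    also have "\<dots> \<le> ereal (profile 0 * ?L) + ereal (fidelity p g' (\<lambda>_. 0))"
      by (intro add_right_mono area_zero ab)
    finally show ?thesis by simp
  qed
  then have "aniso_functional \<phi> p ?I g u \<noteq> \<infinity>" by auto
  then have Lp: "(\<lambda>s. u s - g s) \<in> Lp_on p ?I"
    and Gu: "aniso_functional \<phi> p ?I g u = aniso_area \<phi> ?I u + ereal (\<integral>s. \<bar>u s - g s\<bar> powr p \<partial>lebesgue_on ?I)"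
    by (auto simp: aniso_functional_def split: if_splits)
  define J where "J = fidelity p g' u0"
  note fid0 = fid[OF um u0(1) u0(2) uu0]
  have Ji: "integrable lborel (\<lambda>s. \<bar>u0 s - g' s\<bar> powr p)" using Lp fid0(1) by (simp add: Lp_on_def)
  have J0: "0 \<le> J" unfolding J_def fidelity_def by (rule Bochner_Integration.integral_nonneg) simp
  have area_u: "aniso_area \<phi> ?I u = aniso_area \<phi> ?I u0"
    by (rule aniso_area_cong_AE[OF um measurable_lebesgue_on[OF u0(1)] uu0 ab])
  have Gu': "aniso_functional \<phi> p ?I g u = aniso_area \<phi> ?I u0 + ereal J"
    using Gu fid0(2) area_u by (simp add: J_def)
  have pos: "0 \<le> aniso_area \<phi> ?I u0" by (rule area_nonneg[OF u0i ab])
  obtain A where A: "aniso_area \<phi> ?I u0 = ereal A" "0 \<le> A"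
    using fin pos unfolding Gu' by (cases "aniso_area \<phi> ?I u0") auto
  have F0: "fidelity p g' (\<lambda>_. 0) \<le> ?L"
  proof -
    have "fidelity p g' (\<lambda>_. 0) \<le> (LBINT s. indicator {a..b} s)"
      unfolding fidelity_def
    proof (rule integral_mono)
      show "integrable lborel (\<lambda>s. \<bar>0 - g' s\<bar> powr p)"
        by (rule bounded_borel_integrable[OF fidelity_bounded_borel[OF zero g' p]])
      show "\<bar>0 - g' s\<bar> powr p \<le> indicator {a..b} s" for s
      proof (cases "s \<in> {a..b}")
        case True
        have "\<bar>g' s\<bar> \<le> 1" using g'\<sigma>[of s] \<sigma> by linarith
        then have "\<bar>g' s\<bar> powr p \<le> 1 powr p" using p by (intro powr_mono2) auto
        then show ?thesis using True by simp
      next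
        case False
        then have "g' s = 0" by (intro bounded_borel_zero[OF g']) auto
        then show ?thesis using False by simp
      qed
    qed simp
    then show ?thesis using ab by simp
  qed
  have AJ: "A + J \<le> (profile 0 + 1) * ?L"
    using fin F0 unfolding Gu' A(1) by (simp add: algebra_simps)
  have U: "(LBINT s. \<bar>u0 s\<bar>) \<le> 2 * ?L + J"
  proof -
    have "(LBINT s. \<bar>u0 s\<bar>) \<le> (LBINT s. 2 * indicator {a..b} s + \<bar>u0 s - g' s\<bar> powr p)"
    proof (rule integral_mono)
      show "integrable lborel (\<lambda>s. \<bar>u0 s\<bar>)" by (rule integrable_abs[OF u0i])
      show "integrable lborel (\<lambda>s. 2 * indicator {a..b} s + \<bar>u0 s - g' s\<bar> powr p)"
        by (intro Bochner_Integration.integrable_add integrable_mult_right Ji) simp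
      fix s
      show "\<bar>u0 s\<bar> \<le> 2 * indicator {a..b} s + \<bar>u0 s - g' s\<bar> powr p"
      proof (cases "s \<in> {a..b}")
        case True
        have le: "x \<le> 1 + x powr p" if "0 \<le> x" for x :: real
        proof (cases "x \<le> 1")
          case False
          then have "x powr 1 \<le> x powr p" using p by (intro powr_mono) auto
          then show ?thesis using False by simp
        qed (simp add: add_increasing2)
        have "\<bar>u0 s\<bar> \<le> \<bar>u0 s - g' s\<bar> + 1" using g'\<sigma>[of s] \<sigma> by linarith
        also have "\<bar>u0 s - g' s\<bar> \<le> 1 + \<bar>u0 s - g' s\<bar> powr p" by (rule le) simp
        finally show ?thesis using True by simp
      qed (use u0(2) in auto)
    qed
    also have "\<dots> = 2 * ?L + J"
      unfolding J_def fidelity_def using Ji ab by (subst Bochner_Integration.integral_add) auto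
    finally show ?thesis .
  qed
  obtain Z where Z: "Z \<in> null_sets lborel"
    "\<And>s. s \<in> ?I - Z \<Longrightarrow> \<bar>u0 s\<bar> \<le> A / halfwidth + (LBINT t. \<bar>u0 t\<bar>) / ?L"
    by (rule bounded_from_area[OF u0i ab eq_refl[OF A(1)] u0(2)]) (assumption | rule that)+
  define R where "R = sup_bound ?L"
  have R: "A / halfwidth + (LBINT t. \<bar>u0 t\<bar>) / ?L \<le> R"
  proof -
    have "A \<le> (profile 0 + 1) * ?L" using AJ J0 by linarith
    then have 1: "A / halfwidth \<le> (profile 0 + 1) * ?L / halfwidth" using halfwidth_pos by (simp add: divide_right_mono)
    have "(LBINT t. \<bar>u0 t\<bar>) \<le> (3 + profile 0) * ?L" using U AJ A(2) by (simp add: algebra_simps)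
    then have 2: "(LBINT t. \<bar>u0 t\<bar>) / ?L \<le> 3 + profile 0" using ab by (simp add: pos_divide_le_eq)
    show ?thesis unfolding R_def sup_bound_def using 1 2 by linarith
  qed
  have R0: "0 \<le> R"
    unfolding R_def sup_bound_def using ab halfwidth_pos profile_zero_pos by (intro add_nonneg_nonneg divide_nonneg_nonneg mult_nonneg_nonneg) auto
  define u' where "u' s = max (- R) (min R (u0 s))" for s
  have u'R: "\<bar>u' s\<bar> \<le> R" for s using R0 by (auto simp: u'_def)
  have u': "u' \<in> bounded_borel a b"
  proof (rule bounded_borelI[OF _ u'R])
    show "u' \<in> borel_measurable borel" unfolding u'_def by measurable
    show "u' s = 0" if "s \<notin> ?I" for s using u0(2)[OF that] R0 by (simp add: u'_def)
  qed
  have u0u': "u0 s = u' s" if "s \<in> ?I - Z" for s using Z(2)[OF that] R by (auto simp: u'_def)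
  have uu': "AE s in lebesgue_on ?I. u s = u' s"
    using uu0 AE_lebesgue_on_null[OF Z(1), of a b] by eventually_elim (simp add: u0u')
  have area_u': "aniso_area \<phi> ?I u' = ereal A"
    using aniso_area_cong_AE[OF um measurable_lebesgue_on[OF bounded_borel_measurable[OF u']] uu' ab] area_u A(1) by simp
  have J': "fidelity p g' u' = J"
    using fid(2)[OF um bounded_borel_measurable[OF u'] bounded_borel_zero[OF u'] uu'] fid0(2) by (simp add: J_def)
  show ?thesis
  proof (rule that[OF u' g' uu' g'\<sigma> _ area_u'])
    show "\<bar>u' s\<bar> \<le> sup_bound ?L" for s using u'R by (simp add: R_def)
    show "A + fidelity p g' u' \<le> c + fidelity p g' v" if v: "v \<in> bounded_borel a b" and c: "aniso_area \<phi> ?I v \<le> ereal c" for v c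
    proof -
      note comp = competitor[OF v c]
      have "ereal (A + J) \<le> aniso_functional \<phi> p ?I g v"
        using min comp Gu' A(1) by (metis plus_ereal.simps(1))
      also have "\<dots> = aniso_area \<phi> ?I v + ereal (fidelity p g' v)" using comp by simp
      also have "\<dots> \<le> ereal c + ereal (fidelity p g' v)" by (rule add_right_mono[OF c])
      finally show ?thesis by (simp add: J')
    qed
  qed
qed

end

section \<open>Regularity of minimizers for small data\<close>

theorem theorem1p2:
  fixes \<phi> :: "real \<times> real \<Rightarrow> real" and p L :: real
  assumes "anisotropy \<phi>"
    and "axis_symmetric (aniso_ball \<phi>)"
    and "no_vertical_facets (aniso_ball \<phi>)"
    and "1 \<le> p"
    and "0 < L"
  shows "\<exists>\<sigma>>0. \<forall>a b g u.
           b - a = L \<and>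
           g \<in> Linf_on {a<..<b} \<and> Linf_norm {a<..<b} g < ereal \<sigma> \<and>
           is_minimizer \<phi> p {a<..<b} g u
           \<longrightarrow> lipschitz_rep {a<..<b} u \<and>
               (C2_on (- {0}) \<phi> \<and> elliptic \<phi> \<longrightarrow> C11_rep {a<..<b} u)"
proof -
  interpret symmetric_anisotropy \<phi> by unfold_locales (fact assms)+
  obtain r1 where r1: "0 < r1" "r1 < halfwidth" "profile r1 < profile 0" by (rule profile_below_max)
  define r where "r = (r1 + halfwidth) / 2"
  have r: "r1 < r" "r < halfwidth" using r1 by (auto simp: r_def)
  \<comment> \<open>Both \<open>M\<close> and \<open>R\<close> depend only on \<open>\<phi>\<close>, \<open>p\<close> and \<open>L\<close>; this makes the choice of \<open>\<sigma>\<close> possible before \<open>g\<close> is given.\<close>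
  define R where "R = sup_bound L + 1"
  have R: "1 \<le> R"
    unfolding R_def sup_bound_def using assms(5) halfwidth_pos profile_zero_pos
    by (simp add: add_nonneg_nonneg divide_nonneg_nonneg mult_nonneg_nonneg)
  define M where "M = p * (R + 1) powr (p - 1)"
  have M: "0 < M" using assms(4) R by (simp add: M_def)
  define D where "D = (profile 0 - profile r1) * (r - r1)"
  have D: "0 < D" using r r1 by (simp add: D_def)
  \<comment> \<open>Half of the value at which \<open>small_data_certificate\<close> would fail; the bound \<open>1\<close> is the normalization of
    \<open>g\<close> in \<open>sup_bound\<close>.\<close>
  define \<sigma> where "\<sigma> = min 1 (D / (2 * (M * (M * L))))"
  have \<sigma>: "0 < \<sigma>" "\<sigma> \<le> 1" using D M assms(5) by (auto simp: \<sigma>_def)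
  have small: "M * (M * (\<sigma> * L)) < D"
  proof -
    have pos: "0 < M * (M * L)" using M assms(5) by simp
    have "\<sigma> \<le> D / (2 * (M * (M * L)))" by (simp add: \<sigma>_def)
    then have "\<sigma> * (2 * (M * (M * L))) \<le> D" using pos by (simp add: pos_le_divide_eq)
    moreover have "\<sigma> * (2 * (M * (M * L))) = 2 * (M * (M * (\<sigma> * L)))" by (simp add: algebra_simps)
    ultimately show ?thesis using D by linarith
  qed
  show ?thesis
  proof (intro exI[of _ \<sigma>] conjI \<sigma>(1) allI impI; elim conjE)
    fix a b g u
    assume L: "b - a = L" and g: "g \<in> Linf_on {a<..<b}" "Linf_norm {a<..<b} g < ereal \<sigma>"
      and min: "is_minimizer \<phi> p {a<..<b} g u"
    let ?I = "{a<..<b}"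
    have ab: "a < b" using L assms(5) by simp
    have gm: "g \<in> borel_measurable (lebesgue_on ?I)" using g(1) by (simp add: Linf_on_def)
    have "AE s in lebesgue_on ?I. ereal \<bar>g s\<bar> \<le> Linf_norm ?I g" unfolding Linf_norm_def by (rule esssup_AE)
    then have g\<sigma>: "AE s in lebesgue_on ?I. \<bar>g s\<bar> \<le> \<sigma>"
    proof eventually_elim
      case (elim s)
      then have "ereal \<bar>g s\<bar> < ereal \<sigma>" using g(2) by (rule le_less_trans)
      then show ?case by simp
    qed
    obtain u' g' A where u': "u' \<in> bounded_borel a b" and g': "g' \<in> bounded_borel a b"
      and uu': "AE s in lebesgue_on ?I. u s = u' s" and g'\<sigma>: "\<And>s. \<bar>g' s\<bar> \<le> \<sigma>"
      and u'R: "\<And>s. \<bar>u' s\<bar> \<le> sup_bound (b - a)" and A: "aniso_area \<phi> ?I u' = ereal A"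
      and opt: "\<And>v c. v \<in> bounded_borel a b \<Longrightarrow> aniso_area \<phi> ?I v \<le> ereal c \<Longrightarrow> A + fidelity p g' u' \<le> c + fidelity p g' v"
      by (rule minimizer_bounded_representative[OF assms(4) ab less_imp_le[OF \<sigma>(1)] \<sigma>(2) gm g\<sigma> min]) (rule that)
    have diffR: "\<bar>u' s - g' s\<bar> \<le> R" for s
      using u'R[of s] g'\<sigma>[of s] \<sigma>(2) unfolding R_def L by linarith
    obtain l where bf0: "bounded_functional a b l (p * (R + 1) powr (p - 1))"
      and dual: "\<And>v c. v \<in> bounded_borel a b \<Longrightarrow> aniso_area \<phi> ?I v \<le> ereal c \<Longrightarrow> l v - l u' \<le> c - A"
      and fid: "fidelity p g' u' \<le> l (g' - u')"
      by (rule minimizer_dual_functional[OF ab assms(4) u' g' diffR A opt]) (assumption | rule that)+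
    have bf: "bounded_functional a b l M" unfolding M_def by (rule bf0)
    have "0 \<le> fidelity p g' u'" unfolding fidelity_def by (rule Bochner_Integration.integral_nonneg) simp
    then have fid0: "0 \<le> l (g' - u')" using fid by linarith
    have small': "M * (M * (\<sigma> * (b - a))) < (profile 0 - profile r1) * (r - r1)"
      using small unfolding L D_def .
    interpret dual_certificate \<phi> a b l M u' A r
      by (rule small_data_certificate[OF bf M u' eq_refl[OF A] dual g' g'\<sigma> fid0 r1(1) r small'])
    have rep: "AE s in lebesgue_on ?I. u s = w s"
      if "Z \<in> null_sets lborel" "\<forall>s\<in>?I - Z. u' s = w s" for Z w
      using uu' AE_lebesgue_on_null[OF that(1), of a b] by eventually_elim (use that(2) in auto)
    show "lipschitz_rep ?I u"
      using lipschitz rep unfolding lipschitz_rep_def by (meson lipschitz_on_subset subset_UNIV)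
    show "C11_rep ?I u" if "C2_on (- {0}) \<phi>"
      using differentiable[OF that] rep unfolding C11_rep_def by blast
  qed
qed

end
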